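(* Let $\Sigma$ be a sofic approximation to $G$, let $(X,\mu,T)$ and $(Y,\nu,S)$ be $G$-systems and let $\lambda$ be a joining of them. Then $$\mathrm h^{\mathrm q}_\Sigma(\lambda,T\times S)\le\mathrm h^{\mathrm q}_\Sigma(\mu,T)+\mathrm h^{\mathrm q}_\Sigma(\nu,S),$$ and similarly if $\mathrm h^{\mathrm q}_\Sigma$ is replaced with $\mathrm h^{\mathrm{dq}}_\Sigma$ throughout.
   Context: $G$ is a countable discrete sofic group. A sofic approximation $\Sigma=(\sigma_n)_{n\ge1}$ to $G$ is a sequence of nonempty finite sets $V_n$ and maps $\sigma_n:G\to\mathrm{Sym}(V_n)$, $g\mapsto\sigma_n^g$ (not necessarily homomorphisms), such that for all $g,h\in G$ the proportion of $v\in V_n$ with $\sigma_n^g(\sigma_n^h(v))=\sigma_n^{gh}(v)$ tends to $1$, and for all $g\ne e$ the proportion of $v\in V_n$ with $\sigma_n^g(v)\neq v$ tends to $1$. A $G$-system $(X,\mu,T)$ is a standard probability space with a measurable $\mu$-preserving action $T$ of $G$. A joining of $(X,\mu,T)$ and $(Y,\nu,S)$ is a $(T\times S)$-invariant probability measure on $X\times Y$ with marginals $\mu$ and $\nu$. A metric $G$-process $(\mathcal{X}^G,\mu,S,d)$ consists of a standard measurable space $\mathcal{X}$, a compact metric $d$ on $\mathcal X$ whose Borel $\sigma$-algebra is that of $\mathcal X$, the right-shift action $S^g((x_h)_{h})=(x_{hg})_{h}$, and an $S$-invariant probability measure $\mu$ on $\mathcal{X}^G$. $\mathcal{X}^G$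 has the product topology from $d$, and $\mathrm{Prob}(\mathcal X^G)$ the resulting weak$^\ast$ topology. For a finite set $V$, a map $\sigma:G\to\mathrm{Sym}(V)$, $\mathbf{x}\in\mathcal{X}^V$, $v\in V$: $\Pi^\sigma_v(\mathbf{x})=(x_{\sigma^g(v)})_{g\in G}\in\mathcal{X}^G$; $P^\sigma_{\mathbf x}=\frac1{|V|}\sum_{v}\delta_{\Pi^\sigma_v(\mathbf x)}$; $\Omega(\mathcal O,\sigma)=\{\mathbf x\in\mathcal X^V: P^\sigma_{\mathbf x}\in\mathcal O\}$ for $\mathcal{O}\subseteq\mathrm{Prob}(\mathcal X^G)$; $d^{(V)}(\mathbf x,\mathbf x')=\frac1{|V|}\sum_v d(x_v,x'_v)$. For a Borel probability $\nu$ on a metric space $(Y,d_Y)$, $\mathrm{cov}_{\varepsilon,\delta}(\nu,d_Y)=\min\{|F|: F\subseteq Y,\ \nu(B_\delta(F))>1-\varepsilon\}$, with $B_\delta(F)$ the $\delta$-neighbourhood of $F$. A sequence $\mu_i\in\mathrm{Prob}(\mathcal X^{V_{n_i}})$ quenched converges to $\mu$ over $(\sigma_{n_i})_{i\ge1}$ if for every weak$^\ast$ neighbourhood $\mathcal O$ of $\mu$ the proportion of $v\in V_{n_i}$ with $(\Pi^{\sigma_{n_i}}_v)_\ast\mu_i\in\mathcal O$ tends to $1$ and $\mu_i(\Omega(\mathcal O,\sigma_{n_i}))\to1$. It doubly-quenched converges to $\mu$ if $\mu_i\times\mu_i\in\mathrm{Prob}((\mathcal X\times\mathcal X)^{V_{n_i}})$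 quenched converges to $\mu\times\mu$ (on $(\mathcal X\times\mathcal X)^G$, with the average of the two copies of $d$). Then $$\mathrm h^{\mathrm{q}}_\Sigma(\mu)=\sup\Big\{\sup_{\delta,\varepsilon>0}\limsup_{i\to\infty}\tfrac1{|V_{n_i}|}\log\mathrm{cov}_{\varepsilon,\delta}(\mu_i,d^{(V_{n_i})})\Big\},$$ the outer supremum being over all subsequences $n_i\uparrow\infty$ and all sequences $(\mu_i)$ quenched converging to $\mu$ over $(\sigma_{n_i})_{i\ge1}$ (and $\sup\emptyset=-\infty$); $\mathrm h^{\mathrm{dq}}_\Sigma(\mu)$ is defined identically with doubly-quenched convergence. These quantities do not depend on $d$ and are isomorphism invariants of the underlying system. Every $G$-system is isomorphic to a $G$-process (via $x\mapsto(T^hx)_{h\in G}\in X^G$), and the quantities for a system are defined as those of any isomorphic metric $G$-process. A sum with a term equal to $-\infty$ is interpreted as $-\infty$. *)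

theory Defs
  imports "HOL-Probability.Probability" "HOL-Combinatorics.Permutations"
begin

text \<open>
  The acting group is a type \<open>'g\<close> of sort \<open>{group_add, countable}\<close>. The class \<open>group_add\<close> is not
  assumed commutative: \<open>g + h\<close> is the product \<open>gh\<close> and \<open>0\<close> is the identity \<open>e\<close>.
\<close>

section \<open>Sofic approximations\<close>

definition proportion :: "'v set \<Rightarrow> ('v \<Rightarrow> bool) \<Rightarrow> real"
  where "proportion V P = real (card {v \<in> V. P v}) / real (card V)"

definition sofic_approximation ::
    "(nat \<Rightarrow> 'v set) \<Rightarrow> (nat \<Rightarrow> 'g::group_add \<Rightarrow> 'v \<Rightarrow> 'v) \<Rightarrow> bool"
  where "sofic_approximation V \<sigma> \<longleftrightarrow>
    (\<forall>n. finite (V n) \<and> V n \<noteq> {}) \<and>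
    (\<forall>n g. \<sigma> n g permutes V n) \<and>
    (\<forall>g h. (\<lambda>n. proportion (V n) (\<lambda>v. \<sigma> n g (\<sigma> n h v) = \<sigma> n (g + h) v)) \<longlonglongrightarrow> 1) \<and>
    (\<forall>g. g \<noteq> 0 \<longrightarrow> (\<lambda>n. proportion (V n) (\<lambda>v. \<sigma> n g v \<noteq> v)) \<longlonglongrightarrow> 1)"

section \<open>Systems, joinings and isomorphism\<close>

definition standard_borel :: "'x measure \<Rightarrow> bool"
  where "standard_borel M \<longleftrightarrow>
    (\<exists>Z. completely_metrizable_space Z \<and> second_countable Z \<and> topspace Z = space M \<and>
         sets M = sigma_sets (space M) {U. openin Z U})"

definition g_system :: "'x measure \<Rightarrow> ('g::group_add \<Rightarrow> 'x \<Rightarrow> 'x) \<Rightarrow> bool"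
  where "g_system M T \<longleftrightarrow>
    standard_borel M \<and> prob_space M \<and>
    (\<forall>g. T g \<in> measurable M M) \<and>
    (\<forall>x\<in>space M. T 0 x = x) \<and>
    (\<forall>g h. \<forall>x\<in>space M. T g (T h x) = T (g + h) x) \<and>
    (\<forall>g. distr M M (T g) = M)"

definition product_action :: "('g \<Rightarrow> 'x \<Rightarrow> 'x) \<Rightarrow> ('g \<Rightarrow> 'y \<Rightarrow> 'y) \<Rightarrow> 'g \<Rightarrow> 'x \<times> 'y \<Rightarrow> 'x \<times> 'y"
  where "product_action T S g = map_prod (T g) (S g)"

definition joining ::
    "'x measure \<Rightarrow> ('g \<Rightarrow> 'x \<Rightarrow> 'x) \<Rightarrow> 'y measure \<Rightarrow> ('g \<Rightarrow> 'y \<Rightarrow> 'y) \<Rightarrow> ('x \<times> 'y) measure \<Rightarrow> bool"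
  where "joining M T N S L \<longleftrightarrow>
    prob_space L \<and> sets L = sets (M \<Otimes>\<^sub>M N) \<and>
    distr L M fst = M \<and> distr L N snd = N \<and>
    (\<forall>g. distr L L (product_action T S g) = L)"

definition system_isomorphic ::
    "'x measure \<Rightarrow> ('g \<Rightarrow> 'x \<Rightarrow> 'x) \<Rightarrow> 'y measure \<Rightarrow> ('g \<Rightarrow> 'y \<Rightarrow> 'y) \<Rightarrow> bool"
  where "system_isomorphic M T N S \<longleftrightarrow>
    (\<exists>\<phi> \<psi>. \<phi> \<in> measurable M N \<and> \<psi> \<in> measurable N M \<and>
      distr M N \<phi> = N \<and> distr N M \<psi> = M \<and>
      (AE x in M. \<psi> (\<phi> x) = x) \<and> (AE y in N. \<phi> (\<psi> y) = y) \<and>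
      (\<forall>g. AE x in M. \<phi> (T g x) = S g (\<phi> x)))"

section \<open>Metric processes\<close>

text \<open>
  The alphabet of a metric process is a type \<open>'a\<close> of sort \<open>polish_space\<close> with \<open>compact (UNIV :: 'a set)\<close>.
  Its compact metric is \<open>dist\<close> and its measurable structure is \<open>borel\<close>. A compact metric
  space is complete and second countable, so the sort is no restriction. The space of configurations
  \<open>'g \<Rightarrow> 'a\<close> carries the product topology, and as \<open>'g\<close> is countable its \<open>borel\<close> sets are
  those of the product \<open>\<sigma>\<close>-algebra.
\<close>

definition shift :: "'g::group_add \<Rightarrow> ('g \<Rightarrow> 'a) \<Rightarrow> ('g \<Rightarrow> 'a)"
  where "shift g x = (\<lambda>h. x (h + g))"

definition metric_process :: "('g::{group_add, countable} \<Rightarrow> 'a::polish_space) measure \<Rightarrow> bool"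
  where "metric_process P \<longleftrightarrow>
    compact (UNIV :: 'a set) \<and> prob_space P \<and> sets P = sets borel \<and>
    (\<forall>g. distr P borel (shift g) = P)"

text \<open>
  The sofic entropies of a system \<open>(M, T)\<close> are by definition those of any \<open>P\<close> with
  \<open>process_of_system P M T\<close>. A claim about them is stated for all such \<open>P\<close>, with no restriction on
  the alphabet type and its metric.
\<close>

definition process_of_system ::
    "('g::{group_add, countable} \<Rightarrow> 'a::polish_space) measure \<Rightarrow> 'x measure \<Rightarrow> ('g \<Rightarrow> 'x \<Rightarrow> 'x) \<Rightarrow> bool"
  where "process_of_system P M T \<longleftrightarrow> metric_process P \<and> system_isomorphic M T P shift"

definition prob_measures :: "'z::topological_space measure set"
  where "prob_measures = {P. prob_space P \<and> sets P = sets borel}"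

definition weak_star :: "'z::topological_space measure topology"
  where "weak_star = topology_generated_by
    {{P \<in> prob_measures. integral\<^sup>L P f \<in> U} | (f :: 'z \<Rightarrow> real) U.
       continuous_on UNIV f \<and> bounded (range f) \<and> open U}"

section \<open>Model spaces\<close>

text \<open>
  The model space over a finite set \<open>V\<close> is \<open>space (PiM V (\<lambda>_. borel))\<close>, i.e. the functions on \<open>V\<close>
  extended by \<open>undefined\<close> outside \<open>V\<close>.
\<close>

definition pullback_name :: "('g \<Rightarrow> 'v \<Rightarrow> 'v) \<Rightarrow> 'v \<Rightarrow> ('v \<Rightarrow> 'a) \<Rightarrow> ('g \<Rightarrow> 'a)"
  where "pullback_name \<tau> v x = (\<lambda>g. x (\<tau> g v))"

definition empirical ::
    "'v set \<Rightarrow> ('g \<Rightarrow> 'v \<Rightarrow> 'v) \<Rightarrow> ('v \<Rightarrow> 'a::topological_space) \<Rightarrow> ('g \<Rightarrow> 'a) measure"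
  where "empirical V \<tau> x = distr (uniform_count_measure V) borel (\<lambda>v. pullback_name \<tau> v x)"

definition good_models ::
    "('g \<Rightarrow> 'a::topological_space) measure set \<Rightarrow> 'v set \<Rightarrow> ('g \<Rightarrow> 'v \<Rightarrow> 'v) \<Rightarrow> ('v \<Rightarrow> 'a) set"
  where "good_models U V \<tau> = {x \<in> space (PiM V (\<lambda>_. borel)). empirical V \<tau> x \<in> U}"

definition model_measures :: "'v set \<Rightarrow> ('v \<Rightarrow> 'a::topological_space) measure set"
  where "model_measures V = {m. prob_space m \<and> sets m = sets (PiM V (\<lambda>_. borel))}"

definition quenched_converges ::
    "(nat \<Rightarrow> 'v set) \<Rightarrow> (nat \<Rightarrow> 'g \<Rightarrow> 'v \<Rightarrow> 'v) \<Rightarrow> (nat \<Rightarrow> ('v \<Rightarrow> 'a::topological_space) measure) \<Rightarrow>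
     ('g \<Rightarrow> 'a) measure \<Rightarrow> bool"
  where "quenched_converges W \<tau> m P \<longleftrightarrow>
    (\<forall>U. openin weak_star U \<and> P \<in> U \<longrightarrow>
      (\<lambda>i. proportion (W i) (\<lambda>v. distr (m i) borel (pullback_name (\<tau> i) v) \<in> U)) \<longlonglongrightarrow> 1 \<and>
      (\<lambda>i. measure (m i) (good_models U (W i) (\<tau> i))) \<longlonglongrightarrow> 1)"

text \<open>
  The products \<open>m \<times> m\<close> and \<open>P \<times> P\<close>, moved along the bijections that turn a pair of configurations
  into a configuration of pairs. Quenched convergence depends on the alphabet \<open>'a \<times> 'a\<close> only through
  its topology, which is the one given by the average of the two copies of the metric.
\<close>

definition pair_model ::
    "'v set \<Rightarrow> ('v \<Rightarrow> 'a::topological_space) measure \<Rightarrow> ('v \<Rightarrow> 'a \<times> 'a) measure"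
  where "pair_model V m =
    distr (m \<Otimes>\<^sub>M m) (PiM V (\<lambda>_. borel)) (\<lambda>(x, y). \<lambda>v\<in>V. (x v, y v))"

definition pair_process :: "('g \<Rightarrow> 'a::topological_space) measure \<Rightarrow> ('g \<Rightarrow> 'a \<times> 'a) measure"
  where "pair_process P = distr (P \<Otimes>\<^sub>M P) borel (\<lambda>(x, y). \<lambda>g. (x g, y g))"

definition doubly_quenched_converges ::
    "(nat \<Rightarrow> 'v set) \<Rightarrow> (nat \<Rightarrow> 'g \<Rightarrow> 'v \<Rightarrow> 'v) \<Rightarrow> (nat \<Rightarrow> ('v \<Rightarrow> 'a::topological_space) measure) \<Rightarrow>
     ('g \<Rightarrow> 'a) measure \<Rightarrow> bool"
  where "doubly_quenched_converges W \<tau> m P \<longleftrightarrow>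
    quenched_converges W \<tau> (\<lambda>i. pair_model (W i) (m i)) (pair_process P)"

section \<open>Covering numbers and entropies\<close>

definition hamming_dist :: "'v set \<Rightarrow> ('v \<Rightarrow> 'a::metric_space) \<Rightarrow> ('v \<Rightarrow> 'a) \<Rightarrow> real"
  where "hamming_dist V x y = (\<Sum>v\<in>V. dist (x v) (y v)) / real (card V)"

text \<open>
  Only finite \<open>F\<close> are admitted since \<open>card\<close> is \<open>0\<close> on infinite sets. For totally bounded spaces, in
  particular for the model spaces, such an \<open>F\<close> exists, so this is the minimum over all \<open>F\<close>.
\<close>

definition cov :: "real \<Rightarrow> real \<Rightarrow> 'y measure \<Rightarrow> ('y \<Rightarrow> 'y \<Rightarrow> real) \<Rightarrow> nat"
  where "cov \<epsilon> \<delta> \<nu> d =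
    (LEAST k. \<exists>F. finite F \<and> F \<subseteq> space \<nu> \<and> card F = k \<and>
       measure \<nu> {y \<in> space \<nu>. \<exists>z\<in>F. d z y < \<delta>} > 1 - \<epsilon>)"

text \<open>The covering number is \<open>0\<close> exactly if \<open>\<epsilon> > 1\<close>; its logarithm is then \<open>-\<infinity>\<close>.\<close>

definition log_nat :: "nat \<Rightarrow> ereal"
  where "log_nat k = (if k = 0 then -\<infinity> else ereal (ln (real k)))"

definition cov_rate ::
    "(nat \<Rightarrow> 'v set) \<Rightarrow> (nat \<Rightarrow> ('v \<Rightarrow> 'a::metric_space) measure) \<Rightarrow> ereal"
  where "cov_rate W m =
    (SUP \<delta>\<in>{0<..}. SUP \<epsilon>\<in>{0<..}.
      limsup (\<lambda>i. ereal (1 / real (card (W i))) * log_nat (cov \<epsilon> \<delta> (m i) (hamming_dist (W i)))))"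

definition quenched_entropy ::
    "(nat \<Rightarrow> 'v set) \<Rightarrow> (nat \<Rightarrow> 'g \<Rightarrow> 'v \<Rightarrow> 'v) \<Rightarrow> ('g \<Rightarrow> 'a::metric_space) measure \<Rightarrow> ereal"
  where "quenched_entropy V \<sigma> P =
    Sup {cov_rate (V \<circ> n) m | (n :: nat \<Rightarrow> nat) m.
      strict_mono n \<and> (\<forall>i. m i \<in> model_measures (V (n i))) \<and>
      quenched_converges (V \<circ> n) (\<sigma> \<circ> n) m P}"

definition doubly_quenched_entropy ::
    "(nat \<Rightarrow> 'v set) \<Rightarrow> (nat \<Rightarrow> 'g \<Rightarrow> 'v \<Rightarrow> 'v) \<Rightarrow> ('g \<Rightarrow> 'a::metric_space) measure \<Rightarrow> ereal"
  where "doubly_quenched_entropy V \<sigma> P =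
    Sup {cov_rate (V \<circ> n) m | (n :: nat \<Rightarrow> nat) m.
      strict_mono n \<and> (\<forall>i. m i \<in> model_measures (V (n i))) \<and>
      doubly_quenched_converges (V \<circ> n) (\<sigma> \<circ> n) m P}"

text \<open>In \<open>ereal\<close> one has \<open>\<infinity> + (-\<infinity>) = \<infinity>\<close>; here a summand \<open>-\<infinity>\<close> makes the sum \<open>-\<infinity>\<close>.\<close>

definition entropy_plus :: "ereal \<Rightarrow> ereal \<Rightarrow> ereal"
  where "entropy_plus a b = (if a = -\<infinity> \<or> b = -\<infinity> then -\<infinity> else a + b)"

end

theory Submission
  imports Defs
begin

text \<open>Let \<open>\<mu>, \<nu>, \<lambda>\<close> be presented as processes over compact alphabets \<open>A\<close>, \<open>B\<close>, \<open>C\<close>. The coordinate maps of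
the joining make the first two processes factors of the third, and jointly they generate it: there
are measurable \<open>\<alpha> : C\<^sup>G \<rightarrow> A\<close>, \<open>\<beta> : C\<^sup>G \<rightarrow> B\<close> whose stationary codes push \<open>\<lambda>\<close> to \<open>\<mu>\<close> and \<open>\<nu>\<close>, and a measurable
\<open>\<psi>\<close> that recovers the letter of \<open>C\<close> at the identity from the two coded configurations almost surely
(\<open>joining_generates\<close>). Given measures \<open>m\<^sub>i\<close> on \<open>C\<close>-models that quenched converge to \<open>\<lambda>\<close>, the aim is to code
them into measures \<open>m1\<^sub>i\<close>, \<open>m2\<^sub>i\<close> that quenched converge to \<open>\<mu>\<close> and \<open>\<nu>\<close> without losing covering
numbers. The inequality then holds before suprema are taken, and since covering rates are never
negative, the case of an empty supremum on the right-hand side cannot arise unless the left-hand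
side is empty too.

A measurable map such as \<open>\<phi> = (\<alpha>, \<beta>)\<close> cannot be applied to models directly, and since the target
alphabet may be totally disconnected, \<open>\<phi>\<close> need not be a limit of continuous maps. It is a limit in
measure of \<^emph>\<open>local rules\<close>: maps that depend on finitely many coordinates and are continuous almost
everywhere (\<open>local_rule_approx\<close>). Dependence on finitely many coordinates makes a rule commute with
the approximate action of \<open>\<sigma>\<close> up to a vanishing proportion of points; almost everywhere continuity lets
quenched convergence see it, because such functions are squeezed between continuous ones
(\<open>ae_continuous_sandwich\<close>). A diagonal choice of rules \<open>f\<^bsub>\<kappa>(i)\<^esub>\<close> with \<open>\<kappa>(i) \<rightarrow> \<infinity>\<close> slowly enough stays close
to every fixed rule \<open>f\<^sub>l\<close>, with an error that vanishes as \<open>l \<rightarrow> \<infinity>\<close> (\<open>exists_coding\<close>). From this single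
property follow the quenched convergence of the coded measures (\<open>coded_quenched_converges\<close>) and, by
applying it to the pair of rules \<open>f \<times> f\<close>, also the doubly quenched statement (\<open>pair_coding\<close>).

For the covering numbers, distances in \<open>C\<close> are tested by finitely many functions \<open>dist c\<close>. By density
of continuous functions in \<open>L\<^sup>1\<close> each \<open>dist c \<circ> \<psi>\<close> is nearly a continuous function of the coded
configuration, so for most models the Hamming distance is controlled by that of the codes
(\<open>codes_separate_models\<close>). Nets for the two codes, paired up, therefore yield a net for the original
models (\<open>cov_product_bound\<close>), whose size is the product of theirs.\<close>

abbreviation model_space :: "'v set \<Rightarrow> ('v \<Rightarrow> 'a::topological_space) measure"
  where "model_space V \<equiv> PiM V (\<lambda>_. borel)"

section \<open>Random measures converging to a constant\<close>

definition bounded_continuous :: "('z::topological_space \<Rightarrow> real) \<Rightarrow> bool"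
  where "bounded_continuous h \<longleftrightarrow> continuous_on UNIV h \<and> bounded (range h)"

lemma bounded_continuous_measurable:
  assumes "bounded_continuous h" shows "h \<in> borel_measurable borel"
  using assms by (auto simp: bounded_continuous_def intro: borel_measurable_continuous_onI)

lemma bounded_continuous_bound:
  assumes "bounded_continuous h"
  obtains B where "B > 0" "\<And>z. \<bar>h z\<bar> \<le> B"
proof -
  from assms obtain B where "B > 0" "\<forall>x\<in>range h. norm x \<le> B"
    by (auto simp: bounded_continuous_def bounded_pos)
  then show ?thesis by (intro that[of B]) auto
qed

lemma (in prob_space) integrable_bounded:
  fixes h :: "'a \<Rightarrow> real"
  assumes "h \<in> borel_measurable M" "\<And>x. x \<in> space M \<Longrightarrow> \<bar>h x\<bar> \<le> B"
  shows "integrable M h"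
  using assms by (intro integrable_const_bound[of _ B]) auto

lemma (in prob_space) abs_integral_le_bound:
  fixes h :: "'a \<Rightarrow> real"
  assumes "h \<in> borel_measurable M" "\<And>x. x \<in> space M \<Longrightarrow> \<bar>h x\<bar> \<le> B"
  shows "\<bar>\<integral>x. h x \<partial>M\<bar> \<le> B"
proof -
  have "\<bar>\<integral>x. h x \<partial>M\<bar> \<le> (\<integral>x. \<bar>h x\<bar> \<partial>M)" by simp
  also have "\<dots> \<le> (\<integral>x. B \<partial>M)"
    using assms by (intro integral_mono integrable_abs integrable_bounded[of _ B])
       (auto intro: order_trans[OF abs_ge_zero])
  finally show ?thesis by (simp add: prob_space)
qed

lemma prob_measuresD:
  assumes "P \<in> prob_measures"
  shows "prob_space P" "sets P = sets borel" "space P = UNIV"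
  using assms sets_eq_imp_space_eq[of P borel] by (auto simp: prob_measures_def)

lemma weak_star_subbasic:
  fixes h :: "'z::topological_space \<Rightarrow> real"
  assumes "bounded_continuous h" "open U"
  shows "openin weak_star {P \<in> prob_measures. integral\<^sup>L P h \<in> U}"
  unfolding weak_star_def using assms
  by (intro topology_generated_by_Basis) (auto simp: bounded_continuous_def)

text \<open>Quenched convergence has two halves. In one a vertex \<open>v\<close> is random and the measure is the law of the
pullback name at \<open>v\<close>; in the other the model is random and the measure is its empirical measure. Both
assert that random measures \<open>Q i\<close> converge in probability to the constant \<open>P\<close>, so both are instances of
this locale. The measurability of the events is essential: the measure of a set that is not measurable
is \<open>0\<close> by convention, which would spoil every lower bound.\<close>

locale random_measures =
  fixes \<Omega> :: "nat \<Rightarrow> 'w measure" and Q :: "nat \<Rightarrow> 'w \<Rightarrow> 'z::topological_space measure"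
    and P :: "'z measure"
  assumes prob: "\<And>i. prob_space (\<Omega> i)"
    and limit: "P \<in> prob_measures"
    and valued: "\<And>i w. w \<in> space (\<Omega> i) \<Longrightarrow> Q i w \<in> prob_measures"
    and events: "\<And>i U. openin weak_star U \<Longrightarrow> {w \<in> space (\<Omega> i). Q i w \<in> U} \<in> sets (\<Omega> i)"
    and mean_measurable: "\<And>i h. h \<in> borel_measurable borel \<Longrightarrow> bounded (range h)
      \<Longrightarrow> (\<lambda>w. \<integral>z. h z \<partial>Q i w :: real) \<in> borel_measurable (\<Omega> i)"
begin

definition converges :: bool
  where "converges \<longleftrightarrow> (\<forall>U. openin weak_star U \<and> P \<in> U \<longrightarrow>
    (\<lambda>i. measure (\<Omega> i) {w \<in> space (\<Omega> i). Q i w \<in> U}) \<longlonglongrightarrow> 1)"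

definition mean_error :: "('z \<Rightarrow> real) \<Rightarrow> nat \<Rightarrow> real"
  where "mean_error h i = (\<integral>w. \<bar>(\<integral>z. h z \<partial>Q i w) - (\<integral>z. h z \<partial>P)\<bar> \<partial>\<Omega> i)"

lemma deviation_bound:
  fixes h :: "'z \<Rightarrow> real"
  assumes "h \<in> borel_measurable borel" "\<And>z. \<bar>h z\<bar> \<le> B" "w \<in> space (\<Omega> i)"
  shows "\<bar>(\<integral>z. h z \<partial>Q i w) - (\<integral>z. h z \<partial>P)\<bar> \<le> 2 * B"
proof -
  have *: "\<bar>\<integral>z. h z \<partial>R\<bar> \<le> B" if "R \<in> prob_measures" for R
    using prob_measuresD[OF that] assms measurable_cong_sets[OF prob_measuresD(2)[OF that] refl, of borel]
    by (intro prob_space.abs_integral_le_bound) auto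
  from *[OF limit] *[OF valued[OF assms(3)]] show ?thesis by linarith
qed

lemma deviation_integrable:
  fixes h :: "'z \<Rightarrow> real"
  assumes "h \<in> borel_measurable borel" "\<And>z. \<bar>h z\<bar> \<le> B"
  shows "integrable (\<Omega> i) (\<lambda>w. \<bar>(\<integral>z. h z \<partial>Q i w) - (\<integral>z. h z \<partial>P)\<bar>)"
proof -
  have "bounded (range h)" using assms(2) by (intro boundedI[of _ B]) auto
  note [measurable] = mean_measurable[OF assms(1) this]
  show ?thesis
    using deviation_bound[OF assms] by (intro prob_space.integrable_bounded[OF prob, of _ _ "2*B"]) auto
qed

lemma mean_error_nonneg: "mean_error h i \<ge> 0"
  unfolding mean_error_def by simp

lemma mean_error_tendsto_0_if_converges:
  assumes "converges" "bounded_continuous h"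
  shows "mean_error h \<longlonglongrightarrow> 0"
proof (rule LIMSEQ_I)
  fix r :: real assume r: "r > 0"
  obtain B where B: "B > 0" "\<And>z. \<bar>h z\<bar> \<le> B" using bounded_continuous_bound[OF assms(2)] by blast
  note hm = bounded_continuous_measurable[OF assms(2)]
  define U where "U = {R \<in> prob_measures. integral\<^sup>L R h \<in> ball (integral\<^sup>L P h) (r/2)}"
  have U: "openin weak_star U" "P \<in> U"
    using weak_star_subbasic[OF assms(2), of "ball (integral\<^sup>L P h) (r/2)"] limit r by (auto simp: U_def)
  define p where "p i = measure (\<Omega> i) {w \<in> space (\<Omega> i). Q i w \<in> U}" for i
  have "p \<longlonglongrightarrow> 1" using assms(1) U unfolding converges_def p_def[abs_def] by blast
  then have "eventually (\<lambda>i. p i > 1 - r / (4*B)) sequentially"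
    using r B by (intro order_tendstoD) auto
  moreover have "mean_error h i < r" if "p i > 1 - r / (4*B)" for i
  proof -
    interpret prob_space "\<Omega> i" by (rule prob)
    let ?A = "{w \<in> space (\<Omega> i). Q i w \<in> U}"
    have A[measurable]: "?A \<in> sets (\<Omega> i)" using events[OF U(1)] .
    have I0: "integrable (\<Omega> i) (indicator (space (\<Omega> i) - ?A) :: _ \<Rightarrow> real)"
      using A by (intro integrable_real_indicator) (auto simp: emeasure_eq_measure)
    have I: "integrable (\<Omega> i) (\<lambda>w. r/2 + 2*B * indicator (space (\<Omega> i) - ?A) w)"
      using I0 by simp
    have "mean_error h i \<le> (\<integral>w. r/2 + 2*B * indicator (space (\<Omega> i) - ?A) w \<partial>\<Omega> i)"
      unfolding mean_error_def
    proof (intro integral_mono deviation_integrable[OF hm B(2)] I)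
      fix w assume w: "w \<in> space (\<Omega> i)"
      show "\<bar>(\<integral>z. h z \<partial>Q i w) - (\<integral>z. h z \<partial>P)\<bar> \<le> r/2 + 2*B * indicator (space (\<Omega> i) - ?A) w"
      proof (cases "Q i w \<in> U")
        case True then show ?thesis using w by (auto simp: U_def dist_real_def abs_minus_commute)
      next
        case False then show ?thesis using w deviation_bound[OF hm B(2) w] r by (auto simp: indicator_def)
      qed
    qed
    also have "\<dots> = r/2 + 2*B * (1 - p i)"
      using I0 by (simp add: prob_space p_def prob_compl[OF A])
    also have "\<dots> < r" using that B r by (simp add: field_simps)
    finally show ?thesis .
  qed
  ultimately show "\<exists>no. \<forall>n\<ge>no. norm (mean_error h n - 0) < r"
    by (auto simp: eventually_sequentially mean_error_nonneg)
qed

text \<open>Convergence extends from continuous test functions to those squeezed between continuous functions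
of almost equal mean, as for Riemann integrable functions: the means of \<open>h\<close> lie between those of \<open>h1\<close>
and \<open>h2\<close>.\<close>

lemma mean_error_tendsto_0_if_sandwiched:
  assumes conv: "converges" and h: "h \<in> borel_measurable borel" "\<And>z. \<bar>h z\<bar> \<le> B"
    and sandwich: "\<And>\<eta>. \<eta> > 0 \<Longrightarrow> \<exists>h1 h2. bounded_continuous h1 \<and> bounded_continuous h2 \<and>
      (\<forall>z. h1 z \<le> h z \<and> h z \<le> h2 z) \<and> (\<integral>z. h2 z - h1 z \<partial>P) < \<eta>"
  shows "mean_error h \<longlonglongrightarrow> 0"
proof (rule LIMSEQ_I)
  fix r :: real assume r: "r > 0"
  from sandwich[of "r/2"] r obtain h1 h2 where h1: "bounded_continuous h1" and h2: "bounded_continuous h2"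
    and le: "\<And>z. h1 z \<le> h z" "\<And>z. h z \<le> h2 z" and gap: "(\<integral>z. h2 z - h1 z \<partial>P) < r/2" by auto
  obtain B1 where B1: "\<And>z. \<bar>h1 z\<bar> \<le> B1" using bounded_continuous_bound[OF h1] by blast
  obtain B2 where B2: "\<And>z. \<bar>h2 z\<bar> \<le> B2" using bounded_continuous_bound[OF h2] by blast
  note m1 = bounded_continuous_measurable[OF h1] and m2 = bounded_continuous_measurable[OF h2]
  have int: "integrable R h1" "integrable R h2" "integrable R h" if "R \<in> prob_measures" for R
  proof -
    interpret R: prob_space R by (rule prob_measuresD[OF that])
    note meas = measurable_cong_sets[OF prob_measuresD(2)[OF that] refl, of borel]
    show "integrable R h1" by (rule R.integrable_bounded[of _ B1]) (simp_all add: meas m1 B1)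
    show "integrable R h2" by (rule R.integrable_bounded[of _ B2]) (simp_all add: meas m2 B2)
    show "integrable R h" by (rule R.integrable_bounded[of _ B]) (simp_all add: meas h)
  qed
  have bound: "mean_error h i \<le> mean_error h1 i + mean_error h2 i + (\<integral>z. h2 z - h1 z \<partial>P)" for i
  proof -
    interpret prob_space "\<Omega> i" by (rule prob)
    let ?d = "\<lambda>f w. \<bar>(\<integral>z. f z \<partial>Q i w) - (\<integral>z. f z \<partial>P)\<bar>"
    have I: "integrable (\<Omega> i) (?d h1)" "integrable (\<Omega> i) (?d h2)" "integrable (\<Omega> i) (?d h)"
      using deviation_integrable[OF m1 B1] deviation_integrable[OF m2 B2] deviation_integrable[OF h] by auto
    have "mean_error h i \<le> (\<integral>w. ?d h1 w + ?d h2 w + (\<integral>z. h2 z - h1 z \<partial>P) \<partial>\<Omega> i)"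
      unfolding mean_error_def
    proof (intro integral_mono Bochner_Integration.integrable_add I)
      fix w assume "w \<in> space (\<Omega> i)"
      note R = valued[OF this]
      have "(\<integral>z. h1 z \<partial>R) \<le> (\<integral>z. h z \<partial>R)" "(\<integral>z. h z \<partial>R) \<le> (\<integral>z. h2 z \<partial>R)" if "R \<in> prob_measures" for R
        using int[OF that] le by (auto intro: integral_mono)
      note this[OF R] this[OF limit]
      moreover have "(\<integral>z. h2 z - h1 z \<partial>P) = (\<integral>z. h2 z \<partial>P) - (\<integral>z. h1 z \<partial>P)"
        using int[OF limit] by simp
      ultimately show "?d h w \<le> ?d h1 w + ?d h2 w + (\<integral>z. h2 z - h1 z \<partial>P)" by linarith
    qed auto
    also have "\<dots> = mean_error h1 i + mean_error h2 i + (\<integral>z. h2 z - h1 z \<partial>P)"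
      using I by (simp add: mean_error_def prob_space)
    finally show ?thesis .
  qed
  have "(\<lambda>i. mean_error h1 i + mean_error h2 i + (\<integral>z. h2 z - h1 z \<partial>P)) \<longlonglongrightarrow> 0 + 0 + (\<integral>z. h2 z - h1 z \<partial>P)"
    by (intro tendsto_intros mean_error_tendsto_0_if_converges conv h1 h2)
  then have "eventually (\<lambda>i. mean_error h1 i + mean_error h2 i + (\<integral>z. h2 z - h1 z \<partial>P) < r) sequentially"
    by (rule order_tendstoD) (use gap r in simp)
  then obtain no where "\<And>i. i \<ge> no \<Longrightarrow> mean_error h1 i + mean_error h2 i + (\<integral>z. h2 z - h1 z \<partial>P) < r"
    unfolding eventually_sequentially by blast
  then have "mean_error h i < r" if "i \<ge> no" for i using bound[of i] that by force
  then show "\<exists>no. \<forall>n\<ge>no. norm (mean_error h n - 0) < r"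
    by (auto simp: mean_error_nonneg)
qed

text \<open>Markov's inequality deals with the subbasic neighbourhoods, and the sets that
  receive asymptotically full measure are stable under finite intersections and enlargement.\<close>

lemma converges_if_mean_error_tendsto_0:
  assumes lim: "\<And>h. bounded_continuous h \<Longrightarrow> mean_error h \<longlonglongrightarrow> 0"
  shows "converges"
proof -
  define p where "p U i = measure (\<Omega> i) {w \<in> space (\<Omega> i). Q i w \<in> U}" for U i
  have p1: "p U i \<le> 1" for U i unfolding p_def using prob_space.prob_le_1[OF prob] by blast
  have mono: "p U i \<le> p U' i" if "openin weak_star U'" "U \<subseteq> U'" for U U' i
    unfolding p_def using that events[OF that(1), of i] prob_space.finite_measure[OF prob, of i]
    by (intro finite_measure.finite_measure_mono) auto
  have squeeze: "p U \<longlonglongrightarrow> 1" if "\<And>i. lo i \<le> p U i" "lo \<longlonglongrightarrow> 1" for lo U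
    by (rule tendsto_sandwich[OF _ _ that(2) tendsto_const]) (simp_all add: that(1) p1)
  let ?S = "{{R \<in> prob_measures. integral\<^sup>L R f \<in> U} | (f :: 'z \<Rightarrow> real) U.
       continuous_on UNIV f \<and> bounded (range f) \<and> open U}"
  have gen: "openin weak_star U \<longleftrightarrow> generate_topology_on ?S U" for U
    by (simp add: weak_star_def openin_topology_generated_by_iff)
  have "P \<in> U \<longrightarrow> p U \<longlonglongrightarrow> 1" if "generate_topology_on ?S U" for U
    using that
  proof induction
    case (Int a b)
    have op: "openin weak_star a" "openin weak_star b"
      using Int.hyps unfolding gen by blast+
    show ?case
    proof
      assume "P \<in> a \<inter> b"
      then have l: "p a \<longlonglongrightarrow> 1" "p b \<longlonglongrightarrow> 1" using Int.IH by auto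
      have "p a i + p b i - 1 \<le> p (a \<inter> b) i" for i
      proof -
        interpret prob_space "\<Omega> i" by (rule prob)
        let ?A = "{w \<in> space (\<Omega> i). Q i w \<in> a}" and ?B = "{w \<in> space (\<Omega> i). Q i w \<in> b}"
        have AB: "?A \<in> events" "?B \<in> events" using events op by auto
        have "p (a \<inter> b) i = prob (?A \<inter> ?B)" unfolding p_def by (rule arg_cong[of _ _ prob]) blast
        moreover have "prob (?A \<union> ?B) = prob ?A + prob ?B - prob (?A \<inter> ?B)"
          by (rule measure_Un3) (use AB in \<open>simp_all add: fmeasurable_eq_sets\<close>)
        moreover have "prob (?A \<union> ?B) \<le> 1" by simp
        ultimately show ?thesis by (simp add: p_def)
      qed
      moreover have "(\<lambda>i. p a i + p b i - 1) \<longlonglongrightarrow> 1" 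
        using l by (auto intro!: tendsto_eq_intros)
      ultimately show "p (a \<inter> b) \<longlonglongrightarrow> 1"
        by (rule squeeze)
    qed
  next
    case (UN K)
    show ?case
    proof
      assume "P \<in> \<Union>K"
      then obtain k where k: "k \<in> K" "P \<in> k" by auto
      then have l: "p k \<longlonglongrightarrow> 1" using UN.IH by auto
      have "openin weak_star (\<Union>K)"
        using UN.hyps by (intro openin_Union) (simp add: gen)
      then have "p k i \<le> p (\<Union>K) i" for i using k by (intro mono) auto
      then show "p (\<Union>K) \<longlonglongrightarrow> 1"
        using l by (rule squeeze)
    qed
  next
    case (Basis s)
    then obtain h U where s: "s = {R \<in> prob_measures. integral\<^sup>L R h \<in> U}" "open U" and h: "bounded_continuous h"
      by (auto simp: bounded_continuous_def)
    show ?case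
    proof
      assume "P \<in> s"
      then obtain r where r: "r > 0" "ball (integral\<^sup>L P h) r \<subseteq> U"
        using s open_contains_ball by blast
      obtain B where B: "\<And>z. \<bar>h z\<bar> \<le> B" using bounded_continuous_bound[OF h] by blast
      note hm = bounded_continuous_measurable[OF h]
      have "1 - mean_error h i / r \<le> p s i" for i
      proof -
        interpret prob_space "\<Omega> i" by (rule prob)
        let ?A = "{w \<in> space (\<Omega> i). Q i w \<in> s}"
        have op: "openin weak_star s" unfolding s(1) by (rule weak_star_subbasic[OF h s(2)])
        have A: "?A \<in> events" by (rule events[OF op])
        have "1 - p s i = prob (space (\<Omega> i) - ?A)" unfolding p_def using prob_compl[OF A] by simp
        also have "\<dots> \<le> prob {w \<in> space (\<Omega> i). \<bar>(\<integral>z. h z \<partial>Q i w) - (\<integral>z. h z \<partial>P)\<bar> \<ge> r}"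
        proof (rule finite_measure_mono)
          show "space (\<Omega> i) - ?A \<subseteq> {w \<in> space (\<Omega> i). \<bar>(\<integral>z. h z \<partial>Q i w) - (\<integral>z. h z \<partial>P)\<bar> \<ge> r}"
          proof clarsimp
            fix w assume w: "w \<in> space (\<Omega> i)" "Q i w \<notin> s"
            then have "integral\<^sup>L (Q i w) h \<notin> ball (integral\<^sup>L P h) r" using s r valued[OF w(1)] by auto
            then show "r \<le> \<bar>(\<integral>z. h z \<partial>Q i w) - (\<integral>z. h z \<partial>P)\<bar>"
              by (auto simp: dist_real_def abs_minus_commute)
          qed
          show "{w \<in> space (\<Omega> i). \<bar>(\<integral>z. h z \<partial>Q i w) - (\<integral>z. h z \<partial>P)\<bar> \<ge> r} \<in> events"
            using borel_measurable_integrable[OF deviation_integrable[OF hm B, of i]] by measurable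
        qed
        also have "\<dots> \<le> mean_error h i / r"
          unfolding mean_error_def
          using integral_Markov_inequality_measure[OF deviation_integrable[OF hm B, of i], of "space (\<Omega> i)" r] r
          by auto
        finally show ?thesis by simp
      qed
      moreover have "(\<lambda>i. 1 - mean_error h i / r) \<longlonglongrightarrow> 1"
        using lim[OF h] r by (auto intro!: tendsto_eq_intros)
      ultimately show "p s \<longlonglongrightarrow> 1"
        by (rule squeeze)
    qed
  qed simp
  then show ?thesis
    unfolding converges_def p_def[abs_def] gen by blast
qed

end

section \<open>Almost everywhere continuous functions\<close>

text \<open>The least majorant of \<open>h\<close> with Lipschitz constant \<open>n\<close>. These majorants decrease to the upper
semicontinuous envelope of \<open>h\<close>, hence to \<open>h\<close> at its points of continuity.\<close>

definition upper_envelope :: "('z::metric_space \<Rightarrow> real) \<Rightarrow> nat \<Rightarrow> 'z \<Rightarrow> real"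
  where "upper_envelope h n x = (SUP y. h y - real n * dist x y)"

lemma upper_envelope:
  fixes h :: "'z::metric_space \<Rightarrow> real"
  assumes "\<And>z. \<bar>h z\<bar> \<le> B"
  shows le_upper_envelope: "h x \<le> upper_envelope h n x"
    and abs_upper_envelope: "\<bar>upper_envelope h n x\<bar> \<le> B"
    and bounded_continuous_upper_envelope: "bounded_continuous (upper_envelope h n)"
    and upper_envelope_tendsto: "isCont h x \<Longrightarrow> (\<lambda>n. upper_envelope h n x) \<longlonglongrightarrow> h x"
proof -
  have h: "h z \<le> B" "-B \<le> h z" for z using assms[of z] by auto
  have below: "h y - real n * dist x y \<le> B" for n x y
    using h(1)[of y] mult_nonneg_nonneg[of "real n" "dist x y", OF of_nat_0_le_iff zero_le_dist] by linarith
  have bdd: "bdd_above (range (\<lambda>y. h y - real n * dist x y))" for n x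
    by (intro bdd_aboveI2[of _ _ B] below)
  have ge: "h y - real n * dist x y \<le> upper_envelope h n x" for n x y
    unfolding upper_envelope_def by (rule cSUP_upper[OF _ bdd]) auto
  have le: "upper_envelope h n x \<le> c" if "\<And>y. h y - real n * dist x y \<le> c" for c n x
    unfolding upper_envelope_def by (rule cSUP_least) (use that in auto)
  show 1: "h x \<le> upper_envelope h n x" for x n using ge[of x n x] by simp
  have up: "upper_envelope h n x \<le> B" for n x
    by (rule le) (rule below)
  show 2: "\<bar>upper_envelope h n x\<bar> \<le> B" for n x
    using 1[of x n] h(2)[of x] up[of n x] by auto
  have lip: "upper_envelope h n x \<le> upper_envelope h n y + real n * dist x y" for n x y
  proof (rule le)
    fix z
    have "real n * dist y z \<le> real n * (dist x y + dist x z)"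
      by (intro mult_left_mono) (auto simp: dist_commute[of x y] dist_triangle)
    then show "h z - real n * dist x z \<le> upper_envelope h n y + real n * dist x y"
      using ge[of z n y] by (simp add: algebra_simps)
  qed
  have "n-lipschitz_on UNIV (upper_envelope h n)" for n
  proof (intro lipschitz_onI)
    fix x y :: 'z
    show "dist (upper_envelope h n x) (upper_envelope h n y) \<le> real n * dist x y"
      using lip[of n x y] lip[of n y x] by (simp add: dist_real_def abs_le_iff dist_commute)
  qed simp
  then show "bounded_continuous (upper_envelope h n)" for n
    unfolding bounded_continuous_def using 2
    by (auto intro!: lipschitz_on_continuous_on boundedI[of _ B])
  show "(\<lambda>n. upper_envelope h n x) \<longlonglongrightarrow> h x" if "isCont h x"
  proof (rule LIMSEQ_I)
    fix e :: real assume e: "e > 0"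
    have "\<exists>r>0. \<forall>y. dist y x < r \<longrightarrow> dist (h y) (h x) < e/2"
      using that[unfolded continuous_at_eps_delta, rule_format, of "e/2"] e half_gt_zero by blast
    then obtain r where r: "r > 0" "\<And>y. dist y x < r \<Longrightarrow> dist (h y) (h x) < e/2" by blast
    have "upper_envelope h n x < h x + e" if n: "real n \<ge> 2 * B / r" for n
    proof -
      have "upper_envelope h n x \<le> h x + e/2"
      proof (rule le)
        fix y
        show "h y - real n * dist x y \<le> h x + e/2"
        proof (cases "dist x y < r")
          case True
          moreover have "real n * dist x y \<ge> 0" by simp
          moreover have "\<bar>h y - h x\<bar> < e/2"
            using r(2)[of y] True unfolding dist_commute[of y x] dist_real_def by blast
          ultimately show ?thesis by linarith
        next
          case False
          then have "real n * r \<le> real n * dist x y" by (intro mult_left_mono) auto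
          moreover have "2 * B \<le> real n * r" using n r by (simp add: field_simps)
          ultimately show ?thesis using h(1)[of y] h(2)[of x] e by linarith
        qed
      qed
      then show ?thesis using e by simp
    qed
    moreover have "real n \<ge> 2 * B / r" if "n \<ge> nat \<lceil>2 * B / r\<rceil>" for n
      using that by linarith
    ultimately have "\<bar>upper_envelope h n x - h x\<bar> < e" if "n \<ge> nat \<lceil>2 * B / r\<rceil>" for n
      using that 1[of x n] by (smt (verit))
    then show "\<exists>no. \<forall>n\<ge>no. norm (upper_envelope h n x - h x) < e"
      unfolding real_norm_def by blast
  qed
qed

text \<open>The Lipschitz envelopes of \<open>h\<close> and of \<open>- h\<close> sandwich \<open>h\<close> and meet at every continuity point, so dominated
convergence closes the gap in the mean.\<close>

lemma ae_continuous_sandwich: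
  fixes h :: "'z::metric_space \<Rightarrow> real"
  assumes P: "P \<in> prob_measures" and h: "h \<in> borel_measurable borel" "\<And>z. \<bar>h z\<bar> \<le> B"
    and cont: "AE z in P. isCont h z" and \<eta>: "\<eta> > 0"
  shows "\<exists>h1 h2. bounded_continuous h1 \<and> bounded_continuous h2 \<and>
      (\<forall>z. h1 z \<le> h z \<and> h z \<le> h2 z) \<and> (\<integral>z. h2 z - h1 z \<partial>P) < \<eta>"
proof -
  define g where "g z = - h z" for z
  have g: "\<And>z. \<bar>g z\<bar> \<le> B" using h by (simp add: g_def)
  interpret prob_space P by (rule prob_measuresD[OF P])
  define D where "D n z = upper_envelope h n z + upper_envelope g n z" for n z
  note bc = bounded_continuous_upper_envelope[of h B, OF h(2)] bounded_continuous_upper_envelope[of g B, OF g]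
  have [measurable]: "upper_envelope h n \<in> borel_measurable P" "upper_envelope g n \<in> borel_measurable P" for n
    using bc[THEN bounded_continuous_measurable] measurable_cong_sets[OF prob_measuresD(2)[OF P] refl, of borel] by auto
  have "(\<lambda>n. \<integral>z. D n z \<partial>P) \<longlonglongrightarrow> (\<integral>z. 0 \<partial>P)"
  proof (rule integral_dominated_convergence[where w="\<lambda>_. 2 * B"])
    show "AE z in P. (\<lambda>n. D n z) \<longlonglongrightarrow> 0" using cont
    proof eventually_elim
      case (elim z)
      then have "isCont g z" by (auto simp: g_def[abs_def] intro!: continuous_intros)
      with elim have "(\<lambda>n. D n z) \<longlonglongrightarrow> h z + g z"
        unfolding D_def by (intro tendsto_add upper_envelope_tendsto[of _ B] h g)
      then show ?case by (simp add: g_def)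
    qed
    show "AE z in P. norm (D n z) \<le> 2 * B" for n
      unfolding D_def using abs_upper_envelope[of h B n, OF h(2)] abs_upper_envelope[of g B n, OF g]
      by (intro AE_I2) (smt (verit) real_norm_def)
  qed (auto simp: D_def[abs_def])
  then have "eventually (\<lambda>n. (\<integral>z. D n z \<partial>P) < \<eta>) sequentially"
    using \<eta> by (intro order_tendstoD) auto
  then obtain n where n: "(\<integral>z. D n z \<partial>P) < \<eta>" by (auto simp: eventually_sequentially)
  have "bounded_continuous (\<lambda>z. - upper_envelope g n z)"
    using bc(2)[of n] unfolding bounded_continuous_def
    by (auto intro!: continuous_intros simp: bounded_iff)
  moreover have "- upper_envelope g n z \<le> h z" for z
    using le_upper_envelope[of g B z n, OF g] by (simp add: g_def)
  moreover have "h z \<le> upper_envelope h n z" for z by (rule le_upper_envelope[of h B, OF h(2)])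
  ultimately show ?thesis
    using n bc(1)[of n] by (intro exI[of _ "\<lambda>z. - upper_envelope g n z"] exI[of _ "upper_envelope h n"]) (auto simp: D_def)
qed

section \<open>Quenched convergence tested on functions\<close>

definition vavg :: "'v set \<Rightarrow> ('v \<Rightarrow> real) \<Rightarrow> real"
  where "vavg V f = (\<Sum>v\<in>V. f v) / real (card V)"

text \<open>The index type may be uncountable; only boxes over the finite set \<open>V\<close> with sides from a countable base
are used, and there are countably many of them.\<close>

lemma open_finite_product_measurable:
  fixes U :: "('v \<Rightarrow> 'a::second_countable_topology) set"
  assumes V: "finite V" and U: "openin (product_topology (\<lambda>_. euclidean) V) U"
  shows "U \<in> sets (model_space V)"
proof -
  obtain B :: "'a set set" where B: "countable B" "topological_basis B"
    using ex_countable_basis by auto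
  define \<X> where "\<X> = {X \<in> PiE V (\<lambda>_. B). PiE V X \<subseteq> U}"
  have "countable \<X>"
    unfolding \<X>_def by (rule countable_subset[OF _ countable_PiE[OF V]]) (use B in auto)
  moreover have "PiE V X \<in> sets (model_space V)" if "X \<in> \<X>" for X
    using that B(2) by (intro sets_PiM_I_finite V) (auto simp: \<X>_def PiE_iff topological_basis_open)
  moreover have "U = (\<Union>X\<in>\<X>. PiE V X)"
  proof (intro equalityI subsetI)
    fix x assume x: "x \<in> U"
    have "\<exists>O'. (\<forall>i\<in>V. openin euclidean (O' i)) \<and> x \<in> PiE V O' \<and> PiE V O' \<subseteq> U"
      using U[unfolded openin_product_topology_alt, rule_format, OF x] by blast
    then obtain O' where O': "\<And>i. i \<in> V \<Longrightarrow> open (O' i)" "x \<in> PiE V O'" "PiE V O' \<subseteq> U"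
      by (metis open_openin)
    have "\<exists>X\<in>B. x i \<in> X \<and> X \<subseteq> O' i" if "i \<in> V" for i
      using topological_basisE[OF B(2) O'(1)[OF that], of "x i"] O'(2) that by (metis PiE_mem)
    then obtain X where X: "\<And>i. i \<in> V \<Longrightarrow> X i \<in> B \<and> x i \<in> X i \<and> X i \<subseteq> O' i" by metis
    have "PiE V (restrict X V) \<subseteq> PiE V O'" using X by (intro PiE_mono) simp
    then have "restrict X V \<in> \<X>" using X O'(3) by (auto simp: \<X>_def)
    moreover have "x \<in> PiE V (restrict X V)" using X O'(2) by (auto simp: PiE_iff)
    ultimately show "x \<in> (\<Union>X\<in>\<X>. PiE V X)" by blast
  qed (auto simp: \<X>_def)
  ultimately show ?thesis using sets.countable_UN''[of \<X> "PiE V"] by simp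
qed

lemma pullback_name_measurable:
  fixes V :: "'v set" and \<tau> :: "'g::countable \<Rightarrow> 'v \<Rightarrow> 'v"
  assumes "\<And>g. \<tau> g permutes V" "v \<in> V"
  shows "pullback_name \<tau> v \<in> measurable (model_space V) (borel :: ('g \<Rightarrow> 'a::second_countable_topology) measure)"
  unfolding pullback_name_def
proof (rule measurable_coordinatewise_then_product)
  fix g
  have "\<tau> g v \<in> V" using assms permutes_in_image[OF assms(1)] by simp
  then show "(\<lambda>x. x (\<tau> g v)) \<in> measurable (model_space V) (borel :: 'a measure)" by simp
qed

lemma empirical_integral:
  fixes h :: "('g::countable \<Rightarrow> 'a::second_countable_topology) \<Rightarrow> real"
  assumes "finite V" "h \<in> borel_measurable borel"
  shows "(\<integral>z. h z \<partial>empirical V \<tau> x) = vavg V (\<lambda>v. h (pullback_name \<tau> v x))"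
  unfolding empirical_def vavg_def using assms
  by (subst integral_distr) (auto simp: integral_uniform_count_measure measurable_def space_uniform_count_measure sets_uniform_count_measure)

lemma empirical_in_prob_measures:
  assumes "finite V" "V \<noteq> {}" shows "empirical V \<tau> x \<in> prob_measures"
  unfolding empirical_def prob_measures_def using prob_space_uniform_count_measure[OF assms]
  by (auto intro!: prob_space.prob_space_distr simp: measurable_def space_uniform_count_measure sets_uniform_count_measure)

text \<open>The empirical measure depends weak-star continuously on the model, because the mean of a continuous
function is a finite average of its values at the pullback names. The good models of an open set are
therefore open in the model space.\<close>

lemma good_models_measurable:
  fixes U :: "('g::countable \<Rightarrow> 'a::second_countable_topology) measure set"
  assumes V: "finite V" "V \<noteq> {}" and \<tau>: "\<And>g. \<tau> g permutes V" and U: "openin weak_star U"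
  shows "good_models U V \<tau> \<in> sets (model_space V)"
proof -
  let ?X = "product_topology (\<lambda>_. euclidean :: 'a topology) V"
  have "continuous_map ?X weak_star (empirical V \<tau>)"
    unfolding weak_star_def
  proof (rule continuous_on_generated_topo)
    fix S :: "('g \<Rightarrow> 'a) measure set"
    assume "S \<in> {{P \<in> prob_measures. integral\<^sup>L P f \<in> U} |(f :: ('g \<Rightarrow> 'a) \<Rightarrow> real) U.
      continuous_on UNIV f \<and> bounded (range f) \<and> open U}"
    then obtain f :: "('g \<Rightarrow> 'a) \<Rightarrow> real" and O' :: "real set"
      where S: "S = {P \<in> prob_measures. integral\<^sup>L P f \<in> O'}"
        and f: "continuous_on UNIV f" "bounded (range f)" "open O'"
      unfolding mem_Collect_eq by (elim exE conjE) (rule that, assumption+)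
    then have fm: "f \<in> borel_measurable borel" by (intro borel_measurable_continuous_onI)
    have "continuous_map ?X euclidean (pullback_name \<tau> v)" if "v \<in> V" for v
      unfolding euclidean_product_topology[symmetric] pullback_name_def
      using that \<tau> by (intro continuous_map_componentwise_UNIV[THEN iffD2] allI continuous_map_product_projection)
        (simp add: permutes_in_image)
    then have "continuous_map ?X euclidean (f \<circ> pullback_name \<tau> v)" if "v \<in> V" for v
      using that f(1) by (intro continuous_map_compose[where X'=euclidean]) auto
    then have "continuous_map ?X euclideanreal (\<lambda>x. vavg V (\<lambda>v. f (pullback_name \<tau> v x)))"
      unfolding vavg_def using V by (intro continuous_intros) (auto simp: o_def)
    then have "openin ?X {x \<in> topspace ?X. vavg V (\<lambda>v. f (pullback_name \<tau> v x)) \<in> O'}"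
      by (rule openin_continuous_map_preimage) (use f(3) in \<open>simp only: open_openin\<close>)
    also have "{x \<in> topspace ?X. vavg V (\<lambda>v. f (pullback_name \<tau> v x)) \<in> O'} =
      empirical V \<tau> -` S \<inter> topspace ?X" unfolding S
      using empirical_in_prob_measures[OF V] empirical_integral[OF V(1) fm] by auto
    finally show "openin ?X (empirical V \<tau> -` S \<inter> topspace ?X)" .
  next
    let ?S = "{{P \<in> prob_measures. integral\<^sup>L P f \<in> U} |(f :: ('g \<Rightarrow> 'a) \<Rightarrow> real) U.
      continuous_on UNIV f \<and> bounded (range f) \<and> open U}"
    have "prob_measures \<in> ?S"
      by (rule CollectI, rule exI[of _ "\<lambda>_. 0"], rule exI[of _ UNIV]) simp
    then show "empirical V \<tau> ` topspace ?X \<subseteq> \<Union>?S"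
      using empirical_in_prob_measures[OF V] by (intro image_subsetI UnionI)
  qed
  then have "openin ?X {x \<in> topspace ?X. empirical V \<tau> x \<in> U}"
    using U by (rule openin_continuous_map_preimage)
  then have "{x \<in> topspace ?X. empirical V \<tau> x \<in> U} \<in> sets (model_space V)"
    by (rule open_finite_product_measurable[OF V(1)])
  then show ?thesis by (simp add: good_models_def space_PiM)
qed

text \<open>What the sequences of measures in the definition of the entropies have in common, apart from their
convergence.\<close>

definition model_sequence :: "(nat \<Rightarrow> 'v set) \<Rightarrow> (nat \<Rightarrow> 'g \<Rightarrow> 'v \<Rightarrow> 'v) \<Rightarrow> (nat \<Rightarrow> ('v \<Rightarrow> 'a::topological_space) measure) \<Rightarrow> bool"
  where "model_sequence W \<tau> m \<longleftrightarrow> (\<forall>i. finite (W i) \<and> W i \<noteq> {} \<and> (\<forall>g. \<tau> i g permutes W i) \<and> m i \<in> model_measures (W i))"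

lemma model_sequenceD:
  assumes "model_sequence W \<tau> m"
  shows "finite (W i)" "W i \<noteq> {}" "\<tau> i g permutes W i" "prob_space (m i)"
    "sets (m i) = sets (model_space (W i))" "space (m i) = space (model_space (W i))"
    "real (card (W i)) > 0"
  using assms sets_eq_imp_space_eq[of "m i" "model_space (W i)"]
  by (auto simp: model_sequence_def model_measures_def card_gt_0_iff)

lemma pullback_name_measurable_model:
  fixes \<tau> :: "nat \<Rightarrow> 'g::countable \<Rightarrow> 'v \<Rightarrow> 'v" and m :: "nat \<Rightarrow> ('v \<Rightarrow> 'a::second_countable_topology) measure"
  assumes "model_sequence W \<tau> m" "v \<in> W i"
  shows "pullback_name (\<tau> i) v \<in> measurable (m i) borel"
  using pullback_name_measurable[of "\<tau> i" "W i" v] model_sequenceD[OF assms(1)] assms(2)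
    measurable_cong_sets[OF model_sequenceD(5)[OF assms(1)] refl] by blast

definition local_limit where
  "local_limit W \<tau> m P h \<longleftrightarrow>
    (\<lambda>i. vavg (W i) (\<lambda>v. \<bar>(\<integral>x. h (pullback_name (\<tau> i) v x) \<partial>m i) - (\<integral>z. h z \<partial>P)\<bar>)) \<longlonglongrightarrow> (0::real)"

definition empirical_limit where
  "empirical_limit W \<tau> m P h \<longleftrightarrow>
    (\<lambda>i. \<integral>x. \<bar>vavg (W i) (\<lambda>v. h (pullback_name (\<tau> i) v x)) - (\<integral>z. h z \<partial>P)\<bar> \<partial>m i) \<longlonglongrightarrow> (0::real)"

context
  fixes W :: "nat \<Rightarrow> 'v set" and \<tau> :: "nat \<Rightarrow> 'g::countable \<Rightarrow> 'v \<Rightarrow> 'v"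
    and m :: "nat \<Rightarrow> ('v \<Rightarrow> 'a::second_countable_topology) measure" and P :: "('g \<Rightarrow> 'a) measure"
  assumes models: "model_sequence W \<tau> m" and P: "P \<in> prob_measures"
begin

lemma local_random_measures:
  "random_measures (\<lambda>i. uniform_count_measure (W i)) (\<lambda>i v. distr (m i) borel (pullback_name (\<tau> i) v)) P"
proof (rule random_measures.intro)
  show "prob_space (uniform_count_measure (W i))" for i
    using model_sequenceD[OF models] by (intro prob_space_uniform_count_measure)
  fix i v assume "v \<in> space (uniform_count_measure (W i))"
  then show "distr (m i) borel (pullback_name (\<tau> i) v) \<in> prob_measures"
    using model_sequenceD(4)[OF models] pullback_name_measurable_model[OF models]
    by (auto simp: prob_measures_def space_uniform_count_measure intro!: prob_space.prob_space_distr)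
qed (auto simp: P measurable_def space_uniform_count_measure sets_uniform_count_measure)

lemma empirical_random_measures: "random_measures m (\<lambda>i. empirical (W i) (\<tau> i)) P"
proof (rule random_measures.intro)
  note D = model_sequenceD[OF models]
  show "prob_space (m i)" for i by (rule D(4))
  show "{w \<in> space (m i). empirical (W i) (\<tau> i) w \<in> U} \<in> sets (m i)" if "openin weak_star U" for i U
    using good_models_measurable[OF D(1)[of i] D(2)[of i] D(3)[of i] that] D(5)[of i] by (simp add: good_models_def D(6))
  fix i and h :: "('g \<Rightarrow> 'a) \<Rightarrow> real" assume h[measurable]: "h \<in> borel_measurable borel"
  have [measurable]: "pullback_name (\<tau> i) v \<in> measurable (m i) borel" if "v \<in> W i" for v
    using that by (rule pullback_name_measurable_model[OF models])
  show "(\<lambda>w. integral\<^sup>L (empirical (W i) (\<tau> i) w) h) \<in> borel_measurable (m i)"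
    unfolding empirical_integral[OF D(1) h] vavg_def by (intro borel_measurable_divide borel_measurable_sum) auto
next
  show "empirical (W i) (\<tau> i) w \<in> prob_measures" for i w
    by (rule empirical_in_prob_measures[OF model_sequenceD(1,2)[OF models]])
qed (rule P)

interpretation loc: random_measures "\<lambda>i. uniform_count_measure (W i)" "\<lambda>i v. distr (m i) borel (pullback_name (\<tau> i) v)" P
  by (rule local_random_measures)
interpretation emp: random_measures m "\<lambda>i. empirical (W i) (\<tau> i)" P
  by (rule empirical_random_measures)

lemma local_limit_iff:
  assumes "h \<in> borel_measurable borel"
  shows "local_limit W \<tau> m P h \<longleftrightarrow> loc.mean_error h \<longlonglongrightarrow> 0"
proof -
  have "loc.mean_error h i = vavg (W i) (\<lambda>v. \<bar>(\<integral>x. h (pullback_name (\<tau> i) v x) \<partial>m i) - (\<integral>z. h z \<partial>P)\<bar>)" for i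
    using assms pullback_name_measurable_model[OF models] model_sequenceD[OF models]
    by (simp add: loc.mean_error_def integral_uniform_count_measure vavg_def integral_distr cong: sum.cong)
  then have "loc.mean_error h = (\<lambda>i. vavg (W i) (\<lambda>v. \<bar>(\<integral>x. h (pullback_name (\<tau> i) v x) \<partial>m i) - (\<integral>z. h z \<partial>P)\<bar>))"
    by (rule ext)
  then show ?thesis by (simp add: local_limit_def)
qed

lemma empirical_limit_iff:
  assumes "h \<in> borel_measurable borel"
  shows "empirical_limit W \<tau> m P h \<longleftrightarrow> emp.mean_error h \<longlonglongrightarrow> 0"
  by (simp add: empirical_limit_def emp.mean_error_def[abs_def] empirical_integral[OF model_sequenceD(1)[OF models] assms])

lemma quenched_converges_iff_random: "quenched_converges W \<tau> m P \<longleftrightarrow> loc.converges \<and> emp.converges"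
proof -
  have "proportion (W i) p = measure (uniform_count_measure (W i)) {v \<in> space (uniform_count_measure (W i)). p v}" for i p
    using model_sequenceD[OF models]
    by (simp add: proportion_def measure_uniform_count_measure space_uniform_count_measure)
  then show ?thesis
    unfolding quenched_converges_def loc.converges_def emp.converges_def good_models_def model_sequenceD(6)[OF models]
    by simp blast
qed

lemma quenched_converges_iff:
  "quenched_converges W \<tau> m P \<longleftrightarrow>
    (\<forall>h. bounded_continuous h \<longrightarrow> local_limit W \<tau> m P h \<and> empirical_limit W \<tau> m P h)"
proof -
  have "loc.converges \<longleftrightarrow> (\<forall>h. bounded_continuous h \<longrightarrow> local_limit W \<tau> m P h)"
    using loc.mean_error_tendsto_0_if_converges loc.converges_if_mean_error_tendsto_0
    by (auto simp: local_limit_iff bounded_continuous_measurable)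
  moreover have "emp.converges \<longleftrightarrow> (\<forall>h. bounded_continuous h \<longrightarrow> empirical_limit W \<tau> m P h)"
    using emp.mean_error_tendsto_0_if_converges emp.converges_if_mean_error_tendsto_0
    by (auto simp: empirical_limit_iff bounded_continuous_measurable)
  ultimately show ?thesis unfolding quenched_converges_iff_random by blast
qed

lemma quenched_converges_sandwiched:
  assumes "quenched_converges W \<tau> m P" and h: "h \<in> borel_measurable borel" "\<And>z. \<bar>h z\<bar> \<le> B"
    and sandwich: "\<And>\<eta>. \<eta> > 0 \<Longrightarrow> \<exists>h1 h2. bounded_continuous h1 \<and> bounded_continuous h2 \<and>
      (\<forall>z. h1 z \<le> h z \<and> h z \<le> h2 z) \<and> (\<integral>z. h2 z - h1 z \<partial>P) < \<eta>"
  shows "local_limit W \<tau> m P h" "empirical_limit W \<tau> m P h"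
  using loc.mean_error_tendsto_0_if_sandwiched[OF _ h sandwich] emp.mean_error_tendsto_0_if_sandwiched[OF _ h sandwich]
    assms(1) by (simp_all add: local_limit_iff[OF h(1)] empirical_limit_iff[OF h(1)] quenched_converges_iff_random)

end

text \<open>This is what makes discontinuous codes admissible: quenched convergence tests every bounded function
whose discontinuities form a null set.\<close>

lemma quenched_converges_ae_continuous:
  fixes W :: "nat \<Rightarrow> 'v set" and \<tau> :: "nat \<Rightarrow> 'g::countable \<Rightarrow> 'v \<Rightarrow> 'v"
    and m :: "nat \<Rightarrow> ('v \<Rightarrow> 'a::{metric_space, second_countable_topology}) measure"
  assumes "model_sequence W \<tau> m" "P \<in> prob_measures" "quenched_converges W \<tau> m P"
    "h \<in> borel_measurable borel" "\<And>z. \<bar>h z\<bar> \<le> B" "AE z in P. isCont h z"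
  shows "local_limit W \<tau> m P h" "empirical_limit W \<tau> m P h"
  using quenched_converges_sandwiched[OF assms(1-5) ae_continuous_sandwich[OF assms(2,4,5,6)]] by auto

section \<open>Approximation of measurable maps by local rules\<close>

lemma inner_regular_approx:
  fixes P :: "'z::{complete_space, second_countable_topology} measure"
  assumes P: "P \<in> prob_measures" and A: "A \<in> sets borel" and e: "e > 0"
  obtains K where "compact K" "K \<subseteq> A" "measure P K > measure P A - e"
proof (cases "measure P A - e < 0")
  case True
  then show ?thesis by (intro that[of "{}"]) auto
next
  case False
  interpret prob_space P by (rule prob_measuresD[OF P])
  have "ennreal (measure P A - e) < emeasure P A"
    using False e by (simp add: emeasure_eq_measure ennreal_less_iff)
  also have "emeasure P A = (SUP K\<in>{K. K \<subseteq> A \<and> compact K}. emeasure P K)"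
    using prob_measuresD[OF P] A by (intro inner_regular) auto
  finally obtain K where "K \<subseteq> A" "compact K" "ennreal (measure P A - e) < emeasure P K"
    by (auto simp: less_SUP_iff)
  then show ?thesis using False by (intro that[of K]) (auto simp: emeasure_eq_measure ennreal_less_iff)
qed

text \<open>By induction on integrable functions; only indicators need an idea. A set and its complement contain
compact sets that exhaust almost all of the mass, and a Urysohn function separates these two.\<close>

lemma bounded_continuous_dense_L1:
  fixes P :: "'z::{complete_space, second_countable_topology} measure" and f :: "'z \<Rightarrow> real"
  assumes P: "P \<in> prob_measures" and f: "integrable P f" and \<eta>: "\<eta> > 0"
  shows "\<exists>p. bounded_continuous p \<and> (\<integral>z. \<bar>f z - p z\<bar> \<partial>P) < \<eta>"
proof -
  interpret prob_space P by (rule prob_measuresD[OF P])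
  note [simp] = prob_measuresD(2,3)[OF P]
  have bc_int: "integrable P p" if p: "bounded_continuous p" for p
  proof -
    obtain B where "\<And>z. \<bar>p z\<bar> \<le> B" using bounded_continuous_bound[OF p] by blast
    then show ?thesis using bounded_continuous_measurable[OF p]
      by (intro integrable_bounded[of _ B]) (simp_all add: measurable_cong_sets[OF prob_measuresD(2)[OF P] refl])
  qed
  from f have "\<forall>\<eta>>0. \<exists>p. bounded_continuous p \<and> (\<integral>z. \<bar>f z - p z\<bar> \<partial>P) < \<eta>"
  proof (induction rule: integrable_induct)
    case (base A c)
    show ?case
    proof (intro allI impI)
      fix \<eta> :: real assume \<eta>: "\<eta> > 0"
      define e where "e = \<eta> / (4 * (\<bar>c\<bar> + 1))"
      have e: "e > 0" using \<eta> by (simp add: e_def)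
      have A: "A \<in> sets borel" using base by simp
      obtain K where K: "compact K" "K \<subseteq> A" "measure P K > measure P A - e"
        by (rule inner_regular_approx[OF P A e])
      obtain K' where K': "compact K'" "K' \<subseteq> - A" "measure P K' > measure P (- A) - e"
        by (rule inner_regular_approx[OF P _ e, of "- A"]) (use A in auto)
      have disj: "K \<inter> K' = {}" using K K' by auto
      have closed: "closedin euclidean K" "closedin euclidean K'"
        using K(1) K'(1) by (simp_all add: compact_imp_closed flip: closed_closedin)
      obtain p :: "'z \<Rightarrow> real" where p: "continuous_map euclidean (top_of_set {0..1}) p" "p ` K' \<subseteq> {0}" "p ` K \<subseteq> {1}"
        using Urysohn_lemma[OF metrizable_imp_normal_space[OF metrizable_space_euclidean] closed(2,1), of 0 1] disj
        by (auto simp: disjnt_def)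
      have pK: "p x = 1" if "x \<in> K" for x using p(3) that by auto
      have pK': "p x = 0" if "x \<in> K'" for x using p(2) that by auto
      have p01: "0 \<le> p x" "p x \<le> 1" for x
        using p(1) by (auto simp: continuous_map_in_subtopology)
      have p_cont: "continuous_on UNIV p"
        using p(1) by (auto simp: continuous_map_in_subtopology)
      have "bounded_continuous (\<lambda>x. c * p x)"
        unfolding bounded_continuous_def using p_cont p01
        by (auto intro!: continuous_intros boundedI[of _ "\<bar>c\<bar>"] simp: abs_mult mult_left_le)
      moreover have "(\<integral>z. \<bar>indicator A z *\<^sub>R c - c * p z\<bar> \<partial>P) < \<eta>"
      proof -
        have sets: "K \<in> sets P" "K' \<in> sets P" "A \<in> sets P"
          using K K' base by (auto intro: borel_compact)
        have mA: "measure P (- A) = 1 - measure P A"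
          using prob_compl[of A] sets by (simp add: Compl_eq_Diff_UNIV)
        have mU: "measure P (- (K \<union> K')) = 1 - (measure P K + measure P K')"
          using prob_compl[of "K \<union> K'"] sets disj by (simp add: Compl_eq_Diff_UNIV finite_measure_Union)
        have iU: "integrable P (indicator (- (K \<union> K')) :: 'z \<Rightarrow> real)"
          using sets by (intro integrable_real_indicator) (auto simp: emeasure_eq_measure)
        have "(\<integral>z. \<bar>indicator A z *\<^sub>R c - c * p z\<bar> \<partial>P) \<le> (\<integral>z. \<bar>c\<bar> * indicator (- (K \<union> K')) z \<partial>P)"
        proof (rule integral_mono')
          show "integrable P (\<lambda>z. \<bar>c\<bar> * indicator (- (K \<union> K')) z)" using iU by simp
          fix z
          show "\<bar>indicator A z *\<^sub>R c - c * p z\<bar> \<le> \<bar>c\<bar> * indicator (- (K \<union> K')) z"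
          proof (cases "z \<in> K \<union> K'")
            case True then show ?thesis using pK pK' K(2) K'(2) by (auto simp: indicator_def)
          next
            case False
            have "\<bar>indicator A z - p z\<bar> \<le> 1" using p01[of z] by (auto simp: indicator_def)
            then have "\<bar>c\<bar> * \<bar>indicator A z - p z\<bar> \<le> \<bar>c\<bar> * 1" by (rule mult_left_mono) simp
            then show ?thesis using False by (simp add: abs_mult[symmetric] algebra_simps)
          qed
        qed simp
        also have "\<dots> = \<bar>c\<bar> * (1 - (measure P K + measure P K'))"
          using mU by simp
        also have "\<dots> \<le> (\<bar>c\<bar> + 1) * (2 * e)"
        proof (intro mult_mono)
          show "0 \<le> 1 - (measure P K + measure P K')" using measure_nonneg[of P "- (K \<union> K')"] mU by linarith
        qed (use K(3) K'(3) mA in linarith)+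
        also have "\<dots> < \<eta>" using \<eta> by (simp add: e_def field_simps add_pos_nonneg)
        finally show ?thesis .
      qed
      ultimately show "\<exists>p. bounded_continuous p \<and> (\<integral>z. \<bar>indicator A z *\<^sub>R c - p z\<bar> \<partial>P) < \<eta>" by blast
    qed
  next
    case (add f g)
    show ?case
    proof (intro allI impI)
      fix \<eta> :: real assume "\<eta> > 0"
      with add.IH obtain p q where pq: "bounded_continuous p" "(\<integral>z. \<bar>f z - p z\<bar> \<partial>P) < \<eta>/2"
        "bounded_continuous q" "(\<integral>z. \<bar>g z - q z\<bar> \<partial>P) < \<eta>/2" by (meson half_gt_zero)
      have "bounded_continuous (\<lambda>z. p z + q z)"
        using pq by (auto simp: bounded_continuous_def intro!: continuous_intros bounded_plus_comp)
      moreover have "(\<integral>z. \<bar>f z + g z - (p z + q z)\<bar> \<partial>P) \<le> (\<integral>z. \<bar>f z - p z\<bar> + \<bar>g z - q z\<bar> \<partial>P)"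
        using add.hyps pq bc_int by (intro integral_mono) auto
      moreover have "\<dots> = (\<integral>z. \<bar>f z - p z\<bar> \<partial>P) + (\<integral>z. \<bar>g z - q z\<bar> \<partial>P)"
        using add.hyps pq bc_int by (intro Bochner_Integration.integral_add) auto
      ultimately show "\<exists>p. bounded_continuous p \<and> (\<integral>z. \<bar>f z + g z - p z\<bar> \<partial>P) < \<eta>"
        using pq by (intro exI[of _ "\<lambda>z. p z + q z"]) linarith
    qed
  next
    case (lim f s)
    show ?case
    proof (intro allI impI)
      fix \<eta> :: real assume \<eta>: "\<eta> > 0"
      have "(\<lambda>i. \<integral>z. \<bar>f z - s i z\<bar> \<partial>P) \<longlonglongrightarrow> (\<integral>z. 0 \<partial>P)"
      proof (rule integral_dominated_convergence[where w="\<lambda>z. 3 * \<bar>f z\<bar>"])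
        show "AE z in P. (\<lambda>i. \<bar>f z - s i z\<bar>) \<longlonglongrightarrow> 0"
        proof (intro AE_I2)
          fix z assume "z \<in> space P"
          from lim.hyps(2)[OF this] have "(\<lambda>i. \<bar>f z - s i z\<bar>) \<longlonglongrightarrow> \<bar>f z - f z\<bar>"
            by (intro tendsto_intros)
          then show "(\<lambda>i. \<bar>f z - s i z\<bar>) \<longlonglongrightarrow> 0" by simp
        qed
        show "AE z in P. norm \<bar>f z - s i z\<bar> \<le> 3 * \<bar>f z\<bar>" for i
          using lim.hyps(3)[of _ i] by (intro AE_I2) (smt (verit) real_norm_def)
      qed (use lim.hyps in \<open>auto intro: borel_measurable_integrable\<close>)
      then have "eventually (\<lambda>i. (\<integral>z. \<bar>f z - s i z\<bar> \<partial>P) < \<eta>/2) sequentially"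
        using \<eta> by (intro order_tendstoD) auto
      then obtain i where i: "(\<integral>z. \<bar>f z - s i z\<bar> \<partial>P) < \<eta>/2" by (auto simp: eventually_sequentially)
      obtain p where p: "bounded_continuous p" "(\<integral>z. \<bar>s i z - p z\<bar> \<partial>P) < \<eta>/2"
        using lim.IH[of i] \<eta> by (meson half_gt_zero)
      have "(\<integral>z. \<bar>f z - p z\<bar> \<partial>P) \<le> (\<integral>z. \<bar>f z - s i z\<bar> + \<bar>s i z - p z\<bar> \<partial>P)"
        using lim.hyps p bc_int by (intro integral_mono) auto
      also have "\<dots> = (\<integral>z. \<bar>f z - s i z\<bar> \<partial>P) + (\<integral>z. \<bar>s i z - p z\<bar> \<partial>P)"
        using lim.hyps p bc_int by (intro Bochner_Integration.integral_add) auto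
      finally show "\<exists>p. bounded_continuous p \<and> (\<integral>z. \<bar>f z - p z\<bar> \<partial>P) < \<eta>"
        using i p by (intro exI[of _ p]) linarith
    qed
  qed
  with \<eta> show ?thesis by blast
qed

lemma compact_UNIV_fun:
  assumes "compact (UNIV :: 'a::topological_space set)"
  shows "compact (UNIV :: ('i \<Rightarrow> 'a) set)"
proof -
  have "compactin (product_topology (\<lambda>_::'i. euclidean :: 'a topology) UNIV) (PiE UNIV (\<lambda>_. UNIV))"
    unfolding compactin_PiE using assms by simp
  then show ?thesis by (simp add: euclidean_product_topology)
qed

lemma compact_UNIV_Times:
  assumes "compact (UNIV :: 'a::topological_space set)" "compact (UNIV :: 'b::topological_space set)"
  shows "compact (UNIV :: ('a \<times> 'b) set)"
  using compact_Times[OF assms] by (simp add: UNIV_Times_UNIV)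

text \<open>A modulus of continuity that is linear in finitely many coordinates, so that it can be averaged.
Configurations close in the relevant coordinates are close in the product metric, where \<open>w\<close> is uniformly
continuous; if one of these coordinates differs by more, the linear term alone exceeds the
oscillation of \<open>w\<close>.\<close>

lemma bounded_continuous_modulus:
  fixes w :: "('g::countable \<Rightarrow> 'd::metric_space) \<Rightarrow> real"
  assumes comp: "compact (UNIV :: 'd set)" and w: "bounded_continuous w" and \<eta>: "\<eta> > 0"
  obtains F C where "finite F" "C \<ge> 0" "\<And>y y'. \<bar>w y - w y'\<bar> \<le> \<eta> + C * (\<Sum>g\<in>F. dist (y g) (y' g))"
proof -
  obtain B where B: "B > 0" "\<And>y. \<bar>w y\<bar> \<le> B" using bounded_continuous_bound[OF w] by blast
  have "uniformly_continuous_on UNIV w"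
    using w compact_UNIV_fun[OF comp] by (intro compact_uniformly_continuous) (auto simp: bounded_continuous_def)
  then obtain e where e: "e > 0" "\<And>y y'. dist y y' < e \<Longrightarrow> \<bar>w y - w y'\<bar> < \<eta>"
    using \<eta> unfolding uniformly_continuous_on_def by (auto simp: dist_real_def)
  obtain N where N: "(1/2 :: real) ^ N < e / 2"
    using real_arch_pow_inv[of "e/2" "1/2"] e by auto
  define F :: "'g set" where "F = from_nat ` {..N}"
  have fin: "finite F" by (simp add: F_def)
  have "\<bar>w y - w y'\<bar> \<le> \<eta> + 8 * B / e * (\<Sum>g\<in>F. dist (y g) (y' g))" (is "_ \<le> _ + _ * ?S") for y y'
  proof (cases "\<forall>g\<in>F. dist (y g) (y' g) < e / 4")
    case True
    have S: "{dist (y (from_nat n)) (y' (from_nat n)) |n. n \<le> N} = (\<lambda>g. dist (y g) (y' g)) ` F"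
      by (auto simp: F_def)
    have "Max ((\<lambda>g. dist (y g) (y' g)) ` F) < e / 4"
      using True by (subst Max_less_iff) (auto simp: F_def)
    then have "dist y y' < e"
      using dist_fun_le_dist_first_terms[of y y' N] N unfolding S by linarith
    then have "\<bar>w y - w y'\<bar> < \<eta>" by (rule e)
    moreover have "8 * B / e * ?S \<ge> 0" using B e by (intro mult_nonneg_nonneg sum_nonneg) auto
    ultimately show ?thesis by linarith
  next
    case False
    then obtain g where g: "g \<in> F" "dist (y g) (y' g) \<ge> e / 4" by force
    have "?S \<ge> dist (y g) (y' g)" using g(1) fin by (intro member_le_sum) auto
    then have "?S \<ge> e / 4" using g by linarith
    then have "8 * B / e * ?S \<ge> 8 * B / e * (e / 4)" using B e by (intro mult_left_mono) auto
    then have "8 * B / e * ?S \<ge> 2 * B" using e by simp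
    moreover have "\<bar>w y - w y'\<bar> \<le> 2 * B" using B(2)[of y] B(2)[of y'] by linarith
    ultimately show ?thesis using \<eta> by linarith
  qed
  with fin show ?thesis using B e by (intro that[of F "8 * B / e"]) auto
qed

text \<open>Block codes of a kind that survive passage to models: finitely many coordinates are moved correctly
by a sofic approximation up to few errors, and almost everywhere continuity keeps the rule visible to
weak-star convergence. Continuity everywhere would be too much to ask when the target is disconnected.\<close>

definition local_rule :: "('g::countable \<Rightarrow> 'c::metric_space) measure \<Rightarrow> (('g \<Rightarrow> 'c) \<Rightarrow> 'd::topological_space) \<Rightarrow> bool"
  where "local_rule P f \<longleftrightarrow> f \<in> borel_measurable borel \<and>
    (\<exists>F. finite F \<and> (\<forall>z z'. (\<forall>g\<in>F. z g = z' g) \<longrightarrow> f z = f z')) \<and> (AE z in P. isCont f z)"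

lemma finitely_many_coordinates_approx:
  fixes p :: "('g::countable \<Rightarrow> 'c::metric_space) \<Rightarrow> real"
  assumes "compact (UNIV :: 'c set)" "bounded_continuous p" "e > 0"
  obtains q F where "continuous_on UNIV q" "finite F" "\<And>z z'. (\<forall>g\<in>F. z g = z' g) \<Longrightarrow> q z = q z'"
    "\<And>z. \<bar>p z - q z\<bar> \<le> e"
proof -
  obtain F C where F: "finite F" "C \<ge> 0" "\<And>y y'. \<bar>p y - p y'\<bar> \<le> e + C * (\<Sum>g\<in>F. dist (y g) (y' g))"
    using bounded_continuous_modulus[OF assms] by blast
  define c :: "('g \<Rightarrow> 'c) \<Rightarrow> ('g \<Rightarrow> 'c)" where "c z = (\<lambda>g. if g \<in> F then z g else undefined)" for z
  have "continuous_on UNIV (\<lambda>z. c z g)" for g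
    by (cases "g \<in> F") (auto simp: c_def)
  then have "continuous_on UNIV c" by (intro continuous_on_coordinatewise_then_product)
  then have "continuous_on UNIV (\<lambda>z. p (c z))"
    using assms(2) by (intro continuous_on_compose2[of UNIV p UNIV c]) (auto simp: bounded_continuous_def)
  moreover have "p (c z) = p (c z')" if "\<forall>g\<in>F. z g = z' g" for z z'
  proof -
    have "c z = c z'" using that by (auto simp: c_def)
    then show ?thesis by simp
  qed
  moreover have "\<bar>p z - p (c z)\<bar> \<le> e" for z
    using F(3)[of z "c z"] by (simp add: c_def)
  ultimately show ?thesis using F(1) by (intro that[of "\<lambda>z. p (c z)" F]) auto
qed

text \<open>The law of \<open>q\<close> has countably many atoms, so a shift by all but countably many \<open>t\<close> keeps \<open>q\<close> off the
integers almost surely.\<close>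

lemma generic_threshold:
  fixes q :: "'z \<Rightarrow> real"
  assumes "prob_space P" and q: "q \<in> borel_measurable P" and "a < b"
  obtains t where "a < t" "t < b" "AE z in P. q z + t \<notin> \<int>"
proof -
  interpret prob_space P by fact
  interpret D: prob_space "distr P borel q" by (rule prob_space_distr[OF q])
  define N where "N = {x. measure (distr P borel q) {x} \<noteq> 0}"
  have "countable N" unfolding N_def by (rule D.countable_support)
  then have "countable ((\<lambda>(k, x). of_int k - x) ` (UNIV \<times> N) :: real set)"
    by (intro countable_image countable_SIGMA) auto
  then have "\<exists>t\<in>{a<..<b}. t \<notin> (\<lambda>(k, x). of_int k - x) ` (UNIV \<times> N)"
    using open_minus_countable[of "(\<lambda>(k, x). of_int k - x) ` (UNIV \<times> N)" "{a<..<b}"] \<open>a < b\<close>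
    by auto
  then obtain t where t: "a < t" "t < b" "\<And>k x. x \<in> N \<Longrightarrow> t \<noteq> of_int k - x" by force
  have "AE z in P. q z + t \<noteq> of_int k" for k :: int
  proof -
    have "of_int k - t \<notin> N" using t(3)[of "of_int k - t" k] by auto
    then have "measure (distr P borel q) {of_int k - t} = 0" by (simp add: N_def)
    then have "AE x in distr P borel q. x \<notin> {of_int k - t}"
      by (intro AE_not_in) (simp add: D.emeasure_eq_measure null_sets_def)
    then have "AE z in P. q z \<notin> {of_int k - t}" by (rule AE_distrD[OF q])
    then show ?thesis by eventually_elim auto
  qed
  then have "AE z in P. \<forall>k::int. q z + t \<noteq> of_int k" by (simp add: AE_all_countable)
  then have "AE z in P. q z + t \<notin> \<int>" by eventually_elim (auto elim: Ints_cases)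
  then show ?thesis using t by (intro that[of t]) auto
qed

lemma isCont_comp_floor:
  fixes a :: "int \<Rightarrow> 'd::topological_space" and q :: "'z::t2_space \<Rightarrow> real"
  assumes "isCont q z" "q z \<notin> \<int>"
  shows "isCont (\<lambda>z. a \<lfloor>q z\<rfloor>) z"
proof -
  have "eventually (\<lambda>x. \<lfloor>q x\<rfloor> = \<lfloor>q z\<rfloor>) (at z)"
    using eventually_floor_eq[of q "q z" "at z"] assms by (auto simp: isCont_def)
  then have "eventually (\<lambda>x. a \<lfloor>q x\<rfloor> = a \<lfloor>q z\<rfloor>) (at z)" by eventually_elim simp
  then show ?thesis unfolding isCont_def by (rule tendsto_eventually)
qed

lemma bounded_dist_if_compact_UNIV:
  assumes "compact (UNIV :: 'd::metric_space set)"
  obtains B where "B > 0" "\<And>x y::'d. dist x y \<le> B"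
proof -
  have "dist x y \<le> diameter (UNIV :: 'd set)" for x y :: 'd
    by (rule diameter_bounded_bound) (use assms in \<open>auto simp: compact_imp_bounded\<close>)
  then show ?thesis
    by (intro that[of "max 1 (diameter (UNIV :: 'd set))"]) (auto intro: max.coboundedI2)
qed

text \<open>Replace \<open>\<phi>\<close> by the index \<open>s\<close> of a near point in a finite net, approximate the real-valued \<open>s\<close> in \<open>L\<^sup>1\<close> by a
continuous function \<open>q\<close> of finitely many coordinates, and round \<open>q\<close> back to an index. Rounding is
discontinuous only where the shifted \<open>q\<close> is an integer, which a generic shift makes a null event.\<close>

lemma local_rule_approx:
  fixes P :: "('g::countable \<Rightarrow> 'c::polish_space) measure" and \<phi> :: "('g \<Rightarrow> 'c) \<Rightarrow> 'd::{metric_space, second_countable_topology}"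
  assumes C: "compact (UNIV :: 'c set)" and D: "compact (UNIV :: 'd set)" and P: "P \<in> prob_measures"
    and \<phi>: "\<phi> \<in> borel_measurable borel" and \<eta>: "\<eta> > 0"
  obtains f where "local_rule P f" "(\<integral>z. dist (f z) (\<phi> z) \<partial>P) < \<eta>"
proof -
  interpret prob_space P by (rule prob_measuresD[OF P])
  note [simp] = prob_measuresD(2,3)[OF P]
  note meas = measurable_cong_sets[OF prob_measuresD(2)[OF P] refl]
  obtain B where B: "B > 0" "\<And>x y::'d. dist x y \<le> B" using bounded_dist_if_compact_UNIV[OF D] by blast
  obtain k where k: "finite k" "(UNIV :: 'd set) \<subseteq> (\<Union>x\<in>k. ball x (\<eta>/4))"
    using D \<eta> unfolding compact_eq_totally_bounded by (meson divide_pos_pos zero_less_numeral)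
  obtain xs where xs: "set xs = k" using finite_list[OF k(1)] by blast
  have ex: "\<exists>j. j < length xs \<and> dist (xs ! j) y < \<eta>/4" for y
  proof -
    have "y \<in> (\<Union>x\<in>set xs. ball x (\<eta>/4))" using k(2) xs by blast
    then obtain x where "x \<in> set xs" "dist x y < \<eta>/4" by auto
    then show ?thesis by (metis in_set_conv_nth)
  qed
  define s where "s z = (LEAST j. j < length xs \<and> dist (xs ! j) (\<phi> z) < \<eta>/4)" for z
  have s: "s z < length xs" "dist (xs ! s z) (\<phi> z) < \<eta>/4" for z
    using LeastI_ex[OF ex[of "\<phi> z"]] by (auto simp: s_def)
  have s_meas: "s \<in> measurable borel (count_space UNIV)"
    unfolding s_def using \<phi> by measurable
  have s_int: "integrable P (\<lambda>z. real (s z))"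
    using s(1) s_meas by (intro integrable_bounded[of _ "real (length xs)"]) (auto simp: meas less_imp_le)
  define e where "e = \<eta> / (16 * B)"
  have e: "e > 0" using \<eta> B by (simp add: e_def)
  obtain p where p: "bounded_continuous p" "(\<integral>z. \<bar>real (s z) - p z\<bar> \<partial>P) < e"
    using bounded_continuous_dense_L1[OF P s_int e] by blast
  obtain q F where q: "continuous_on UNIV q" "finite F" "\<And>z z'. (\<forall>g\<in>F. z g = z' g) \<Longrightarrow> q z = q z'"
    "\<And>z. \<bar>p z - q z\<bar> \<le> e"
    using finitely_many_coordinates_approx[OF C p(1) e] by blast
  have q_meas: "q \<in> borel_measurable borel" using q(1) by (rule borel_measurable_continuous_onI)
  obtain t where t: "1/4 < t" "t < 3/4" "AE z in P. q z + t \<notin> \<int>"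
    using generic_threshold[OF prob_space_axioms, of q "1/4" "3/4"] q_meas by (auto simp: meas)
  define a where "a i = xs ! nat i" for i :: int
  define f where "f z = a \<lfloor>q z + t\<rfloor>" for z
  \<comment> \<open>Since \<open>t\<close> lies between \<open>1/4\<close> and \<open>3/4\<close>, the floor returns the index \<open>s z\<close> whenever \<open>q z\<close> is within \<open>1/4\<close> of it.\<close>
  have f_meas: "f \<in> borel_measurable borel"
  proof -
    have "(\<lambda>z. \<lfloor>q z + t\<rfloor>) \<in> measurable borel (count_space UNIV)" using q_meas by measurable
    then show ?thesis unfolding f_def by (rule measurable_compose) simp
  qed
  have "AE z in P. isCont f z" using t(3)
  proof eventually_elim
    case (elim z)
    have "isCont q z" using q(1) by (simp add: continuous_on_eq_continuous_at)
    then show ?case unfolding f_def using elim by (intro isCont_comp_floor) auto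
  qed
  moreover have "\<forall>z z'. (\<forall>g\<in>F. z g = z' g) \<longrightarrow> f z = f z'"
    using q(3) by (auto simp: f_def) metis
  ultimately have "local_rule P f" using f_meas q(2) by (auto simp: local_rule_def)
  moreover have "(\<integral>z. dist (f z) (\<phi> z) \<partial>P) < \<eta>"
  proof -
    obtain B' where B': "\<And>z. \<bar>p z\<bar> \<le> B'" using bounded_continuous_bound[OF p(1)] by blast
    have ip: "integrable P (\<lambda>z. \<bar>real (s z) - p z\<bar>)"
      using s_int integrable_bounded[of p B'] B' bounded_continuous_measurable[OF p(1)] by (simp add: meas)
    have "(\<integral>z. dist (f z) (\<phi> z) \<partial>P) \<le> (\<integral>z. \<eta>/4 + 4 * B * (\<bar>real (s z) - p z\<bar> + e) \<partial>P)"
    proof (rule integral_mono')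
      show "integrable P (\<lambda>z. \<eta>/4 + 4 * B * (\<bar>real (s z) - p z\<bar> + e))" using ip by simp
      fix z
      show "dist (f z) (\<phi> z) \<le> \<eta>/4 + 4 * B * (\<bar>real (s z) - p z\<bar> + e)"
      proof (cases "\<bar>real (s z) - q z\<bar> < 1/4")
        case True
        then have "\<lfloor>q z + t\<rfloor> = int (s z)" using t(1,2) by (intro floor_unique) (simp only: of_int_of_nat_eq, linarith)+
        then have "dist (f z) (\<phi> z) < \<eta>/4" using s(2)[of z] by (simp add: f_def a_def)
        moreover have "4 * B * (\<bar>real (s z) - p z\<bar> + e) \<ge> 0" using B e by simp
        ultimately show ?thesis by linarith
      next
        \<comment> \<open>Rounding may fail here, but then the error of \<open>p\<close> already outweighs the diameter bound \<open>B\<close>.\<close>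
        case False
        then have "\<bar>real (s z) - p z\<bar> + e \<ge> 1/4" using q(4)[of z] by linarith
        then have "4 * B * (\<bar>real (s z) - p z\<bar> + e) \<ge> 4 * B * (1/4)" using B by (intro mult_left_mono) auto
        then show ?thesis using B(2)[of "f z" "\<phi> z"] \<eta> by linarith
      qed
    qed (use B e \<eta> in \<open>auto intro!: add_nonneg_nonneg mult_nonneg_nonneg\<close>)
    also have "\<dots> = \<eta>/4 + 4 * B * ((\<integral>z. \<bar>real (s z) - p z\<bar> \<partial>P) + e)"
      using ip by (simp add: prob_space[simplified])
    also have "\<dots> < \<eta>/4 + 4 * B * (e + e)" using p(2) B by simp
    also have "\<dots> \<le> \<eta>" using B \<eta> by (simp add: e_def field_simps)
    finally show ?thesis .
  qed
  ultimately show ?thesis by (rule that)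
qed

section \<open>Coding models by local rules\<close>

lemma vavg_mono: "(\<And>v. v \<in> V \<Longrightarrow> f v \<le> g v) \<Longrightarrow> vavg V f \<le> vavg V g"
  unfolding vavg_def by (intro divide_right_mono sum_mono) auto

lemma vavg_nonneg: "(\<And>v. v \<in> V \<Longrightarrow> f v \<ge> 0) \<Longrightarrow> vavg V f \<ge> 0"
  unfolding vavg_def by (intro divide_nonneg_nonneg sum_nonneg) auto

lemma vavg_add: "vavg V (\<lambda>v. f v + g v) = vavg V f + vavg V g"
  unfolding vavg_def by (simp add: sum.distrib add_divide_distrib)

lemma vavg_cmult: "vavg V (\<lambda>v. c * f v) = c * vavg V f"
  unfolding vavg_def by (simp add: sum_distrib_left)

lemma vavg_sum: "vavg V (\<lambda>v. \<Sum>g\<in>F. f g v) = (\<Sum>g\<in>F. vavg V (f g))"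
  unfolding vavg_def by (subst sum.swap) (simp add: sum_divide_distrib)

lemma vavg_const: "real (card V) > 0 \<Longrightarrow> vavg V (\<lambda>v. c) = c"
  unfolding vavg_def by simp

lemma vavg_cong: "(\<And>v. v \<in> V \<Longrightarrow> f v = g v) \<Longrightarrow> vavg V f = vavg V g"
  unfolding vavg_def by (simp cong: sum.cong)

lemma vavg_permutes:
  assumes "p permutes V" shows "vavg V (\<lambda>v. f (p v)) = vavg V f"
  unfolding vavg_def using sum.permute[OF assms, of f] by (simp add: o_def)

lemma vavg_indicator: "finite V \<Longrightarrow> vavg V (\<lambda>v. if p v then 1 else 0) = proportion V p"
  unfolding vavg_def proportion_def by (simp add: sum.If_cases Int_def)

lemma abs_vavg_le: "\<bar>vavg V f\<bar> \<le> vavg V (\<lambda>v. \<bar>f v\<bar>)"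
  unfolding vavg_def by (simp add: divide_right_mono abs_divide)

lemma tendsto_fun:
  fixes l :: "'i \<Rightarrow> 'a::topological_space"
  assumes "\<And>i. ((\<lambda>x. f x i) \<longlongrightarrow> l i) F"
  shows "(f \<longlongrightarrow> l) F"
proof -
  have "limitin (product_topology (\<lambda>_. euclidean) UNIV) f l F"
    using assms by (simp add: limitin_componentwise)
  then show ?thesis by (simp add: euclidean_product_topology)
qed

lemma shift_measurable [measurable]:
  "shift g \<in> (borel :: ('g::{group_add,countable} \<Rightarrow> 'a::second_countable_topology) measure) \<rightarrow>\<^sub>M borel"
  unfolding shift_def by (intro measurable_coordinatewise_then_product) simp

lemma continuous_shift: "continuous_on UNIV (shift g :: ('g::group_add \<Rightarrow> 'a::topological_space) \<Rightarrow> _)"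
  unfolding shift_def by (intro continuous_on_coordinatewise_then_product) simp

definition code_map :: "'v set \<Rightarrow> ('g \<Rightarrow> 'v \<Rightarrow> 'v) \<Rightarrow> (('g \<Rightarrow> 'c) \<Rightarrow> 'd) \<Rightarrow> ('v \<Rightarrow> 'c) \<Rightarrow> ('v \<Rightarrow> 'd)"
  where "code_map V \<tau> f x = (\<lambda>v\<in>V. f (pullback_name \<tau> v x))"

definition stationary_code :: "(('g::group_add \<Rightarrow> 'c) \<Rightarrow> 'd) \<Rightarrow> ('g \<Rightarrow> 'c) \<Rightarrow> ('g \<Rightarrow> 'd)"
  where "stationary_code f z = (\<lambda>g. f (shift g z))"

lemma stationary_code_measurable:
  fixes f :: "('g::{group_add,countable} \<Rightarrow> 'c::second_countable_topology) \<Rightarrow> 'd::second_countable_topology"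
  assumes [measurable]: "f \<in> borel_measurable borel"
  shows "stationary_code f \<in> borel_measurable borel"
  unfolding stationary_code_def by (intro measurable_coordinatewise_then_product) measurable

lemma code_map_measurable:
  fixes \<tau> :: "nat \<Rightarrow> 'g::countable \<Rightarrow> 'v \<Rightarrow> 'v" and m :: "nat \<Rightarrow> ('v \<Rightarrow> 'c::second_countable_topology) measure"
    and f :: "('g \<Rightarrow> 'c) \<Rightarrow> 'd::topological_space"
  assumes "model_sequence W \<tau> m" and [measurable]: "f \<in> borel_measurable borel"
  shows "code_map (W i) (\<tau> i) f \<in> measurable (m i) (model_space (W i))"
  unfolding code_map_def
proof (rule measurable_restrict)
  fix v assume "v \<in> W i"
  note [measurable] = pullback_name_measurable_model[OF assms(1) this]
  show "(\<lambda>x. f (pullback_name (\<tau> i) v x)) \<in> borel_measurable (m i)" by measurable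
qed

lemma pullback_code_map:
  assumes "\<tau> g v \<in> V"
  shows "pullback_name \<tau> v (code_map V \<tau> f x) g = f (pullback_name \<tau> (\<tau> g v) x)"
  using assms by (simp add: pullback_name_def code_map_def)

definition defect :: "('g::group_add \<Rightarrow> 'v \<Rightarrow> 'v) \<Rightarrow> 'g set \<Rightarrow> 'g set \<Rightarrow> 'v \<Rightarrow> bool"
  where "defect \<tau> E F v \<longleftrightarrow> (\<exists>h\<in>E. \<exists>g\<in>F. \<tau> h (\<tau> g v) \<noteq> \<tau> (h + g) v)"

text \<open>A union bound over the finitely many pairs in \<open>E \<times> F\<close>.\<close>

lemma defect_proportion_tendsto_0:
  assumes "sofic_approximation W \<tau>" "finite E" "finite F"
  shows "(\<lambda>i. proportion (W i) (defect (\<tau> i) E F)) \<longlonglongrightarrow> 0"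
proof -
  have W: "finite (W i)" "W i \<noteq> {}" for i using assms(1) by (auto simp: sofic_approximation_def)
  define q where "q i h g = 1 - proportion (W i) (\<lambda>v. \<tau> i h (\<tau> i g v) = \<tau> i (h + g) v)" for i h g
  have q: "q i h g = proportion (W i) (\<lambda>v. \<tau> i h (\<tau> i g v) \<noteq> \<tau> i (h + g) v)" for i h g
  proof -
    let ?A = "{v \<in> W i. \<tau> i h (\<tau> i g v) = \<tau> i (h + g) v}"
    have "{v \<in> W i. \<tau> i h (\<tau> i g v) \<noteq> \<tau> i (h + g) v} = W i - ?A" by auto
    then have "real (card {v \<in> W i. \<tau> i h (\<tau> i g v) \<noteq> \<tau> i (h + g) v}) = real (card (W i)) - real (card ?A)"
      using W[of i] by (simp add: card_Diff_subset of_nat_diff card_mono)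
    then show ?thesis using W[of i] by (simp add: q_def proportion_def diff_divide_distrib)
  qed
  have "(\<lambda>i. q i h g) \<longlonglongrightarrow> 1 - 1" for h g
    unfolding q_def using assms(1) by (intro tendsto_intros) (simp add: sofic_approximation_def)
  then have lim: "(\<lambda>i. \<Sum>h\<in>E. \<Sum>g\<in>F. q i h g) \<longlonglongrightarrow> 0"
    by (intro tendsto_null_sum) simp
  have "proportion (W i) (defect (\<tau> i) E F) \<le> (\<Sum>h\<in>E. \<Sum>g\<in>F. q i h g)" for i
  proof -
    have "proportion (W i) (defect (\<tau> i) E F) = vavg (W i) (\<lambda>v. if defect (\<tau> i) E F v then 1 else 0)"
      using vavg_indicator[OF W(1)] by metis
    also have "\<dots> \<le> vavg (W i) (\<lambda>v. \<Sum>h\<in>E. \<Sum>g\<in>F. if \<tau> i h (\<tau> i g v) \<noteq> \<tau> i (h + g) v then 1 else 0)"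
    proof (rule vavg_mono)
      fix v
      let ?b = "\<lambda>h g. (if \<tau> i h (\<tau> i g v) \<noteq> \<tau> i (h + g) v then 1 else 0 :: real)"
      show "(if defect (\<tau> i) E F v then 1 else 0) \<le> (\<Sum>h\<in>E. \<Sum>g\<in>F. ?b h g)"
      proof (cases "defect (\<tau> i) E F v")
        case True
        then obtain h g where hg: "h \<in> E" "g \<in> F" "?b h g = 1" by (auto simp: defect_def)
        have "?b h g \<le> (\<Sum>g\<in>F. ?b h g)" using hg assms by (intro member_le_sum) auto
        also have "\<dots> \<le> (\<Sum>h\<in>E. \<Sum>g\<in>F. ?b h g)"
          using hg assms by (intro member_le_sum[of h E "\<lambda>h. \<Sum>g\<in>F. ?b h g"] sum_nonneg) auto
        finally show ?thesis using hg by simp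
      qed (auto intro!: sum_nonneg)
    qed
    also have "\<dots> = (\<Sum>h\<in>E. \<Sum>g\<in>F. q i h g)"
      unfolding vavg_sum q using vavg_indicator[OF W(1)] by simp
    finally show ?thesis .
  qed
  then show ?thesis
    by (intro tendsto_sandwich[OF _ _ tendsto_const lim]) (auto simp: proportion_def)
qed

text \<open>The rules \<open>f l\<close> approximate \<open>\<phi>\<close> in the limit process, and the rule \<open>r i\<close> used on the \<open>i\<close>-th model space
stays close to each of them along the sequence. The assumption \<open>tracking\<close> bounds expected
Hamming distances between codes of the same random model, a form that passes to pairs of models.\<close>

locale coding =
  fixes W :: "nat \<Rightarrow> 'v set" and \<tau> :: "nat \<Rightarrow> 'g::{group_add,countable} \<Rightarrow> 'v \<Rightarrow> 'v"
    and m :: "nat \<Rightarrow> ('v \<Rightarrow> 'c::{metric_space,second_countable_topology}) measure" and P :: "('g \<Rightarrow> 'c) measure"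
    and \<phi> :: "('g \<Rightarrow> 'c) \<Rightarrow> 'd::{metric_space,second_countable_topology}"
    and f :: "nat \<Rightarrow> ('g \<Rightarrow> 'c) \<Rightarrow> 'd" and r :: "nat \<Rightarrow> ('g \<Rightarrow> 'c) \<Rightarrow> 'd"
  assumes models: "model_sequence W \<tau> m" and sofic: "sofic_approximation W \<tau>"
    and P: "P \<in> prob_measures" and invariant: "\<And>g. distr P borel (shift g) = P"
    and compact_alphabet: "compact (UNIV :: 'd set)"
    and \<phi>_measurable [measurable]: "\<phi> \<in> borel_measurable borel"
    and rules: "\<And>l. local_rule P (f l)"
    and rules_tendsto: "(\<lambda>l. \<integral>z. dist (f l z) (\<phi> z) \<partial>P) \<longlonglongrightarrow> 0"
    and r_measurable [measurable]: "\<And>i. r i \<in> borel_measurable borel"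
    and tracking: "\<And>\<eta>. \<eta> > 0 \<Longrightarrow> \<exists>l0. \<forall>l\<ge>l0. \<forall>\<^sub>F i in sequentially.
      vavg (W i) (\<lambda>v. \<integral>x. dist (r i (pullback_name (\<tau> i) v x)) (f l (pullback_name (\<tau> i) v x)) \<partial>m i) < \<eta>"
begin

abbreviation name :: "nat \<Rightarrow> 'v \<Rightarrow> ('v \<Rightarrow> 'z) \<Rightarrow> 'g \<Rightarrow> 'z"
  where "name i \<equiv> pullback_name (\<tau> i)"

abbreviation code :: "nat \<Rightarrow> ('v \<Rightarrow> 'c) \<Rightarrow> ('v \<Rightarrow> 'd)"
  where "code i \<equiv> code_map (W i) (\<tau> i) (r i)"

abbreviation rule_error :: "(('g \<Rightarrow> 'd) \<Rightarrow> real) \<Rightarrow> nat \<Rightarrow> real"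
  where "rule_error w l \<equiv> \<integral>z. \<bar>w (stationary_code (f l) z) - w (stationary_code \<phi> z)\<bar> \<partial>P"

abbreviation code_error :: "(('g \<Rightarrow> 'd) \<Rightarrow> real) \<Rightarrow> nat \<Rightarrow> nat \<Rightarrow> real"
  where "code_error w l i \<equiv> vavg (W i) (\<lambda>v. \<integral>x. \<bar>w (name i v (code i x)) - w (stationary_code (f l) (name i v x))\<bar> \<partial>m i)"

lemma f_measurable [measurable]: "f l \<in> borel_measurable borel"
  using rules by (simp add: local_rule_def)

lemmas P_measurable = measurable_cong_sets[OF prob_measuresD(2)[OF P] refl]

lemma P_integrable:
  fixes h :: "('g \<Rightarrow> 'c) \<Rightarrow> real"
  assumes "h \<in> borel_measurable borel" "\<And>z. \<bar>h z\<bar> \<le> B"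
  shows "integrable P h"
  using assms by (intro prob_space.integrable_bounded[OF prob_measuresD(1)[OF P]]) (auto simp: P_measurable)

lemma model_integrable:
  fixes h :: "('g \<Rightarrow> 'c) \<Rightarrow> real"
  assumes [measurable]: "h \<in> borel_measurable borel" and "\<And>z. \<bar>h z\<bar> \<le> B" and v: "v \<in> W i"
  shows "integrable (m i) (\<lambda>x. h (name i v x))"
proof -
  note [measurable] = pullback_name_measurable_model[OF models v]
  show ?thesis using assms(2) by (intro prob_space.integrable_bounded[OF model_sequenceD(4)[OF models]]) measurable
qed

lemma pushed_integrable:
  fixes w :: "('g \<Rightarrow> 'd) \<Rightarrow> real"
  assumes "bounded_continuous w" and v: "v \<in> W i"
  shows "integrable (m i) (\<lambda>x. w (name i v (code i x)))"
proof -
  obtain B where B: "\<And>z. \<bar>w z\<bar> \<le> B" using bounded_continuous_bound[OF assms(1)] by blast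
  have "name i v \<in> measurable (model_space (W i)) (borel :: ('g \<Rightarrow> 'd) measure)"
    using v model_sequenceD[OF models] by (intro pullback_name_measurable)
  note [measurable] = this code_map_measurable[OF models r_measurable[of i], of i] bounded_continuous_measurable[OF assms(1)]
  show ?thesis using B by (intro prob_space.integrable_bounded[OF model_sequenceD(4)[OF models]]) measurable
qed

lemma stationary_code_w_measurable:
  fixes w :: "('g \<Rightarrow> 'd) \<Rightarrow> real" and k :: "('g \<Rightarrow> 'c) \<Rightarrow> 'd"
  assumes "bounded_continuous w" and "k \<in> borel_measurable borel"
  shows "(\<lambda>z. w (stationary_code k z)) \<in> borel_measurable borel"
  using measurable_compose[OF stationary_code_measurable[OF assms(2)] bounded_continuous_measurable[OF assms(1)]] .

text \<open>Two approximations in one: \<open>r i\<close> is replaced by a fixed rule \<open>f l\<close> at the cost of the tracking error,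
and coding the model is interchanged with coding its pullback name, which changes nothing at vertices
where \<open>\<tau> i\<close> is multiplicative on the coordinates involved.\<close>

lemma code_comparison:
  fixes w :: "('g \<Rightarrow> 'd) \<Rightarrow> real"
  assumes w: "bounded_continuous w" and \<eta>: "\<eta> > 0"
  shows "\<exists>l0. \<forall>l\<ge>l0. \<forall>\<^sub>F i in sequentially.
    code_error w l i < \<eta>"
proof -
  obtain B where B: "B > 0" "\<And>z. \<bar>w z\<bar> \<le> B" using bounded_continuous_bound[OF w] by blast
  obtain D where D: "D > 0" "\<And>x y::'d. dist x y \<le> D" using bounded_dist_if_compact_UNIV[OF compact_alphabet] by blast
  obtain F C where F: "finite F" "C \<ge> 0" "\<And>y y'. \<bar>w y - w y'\<bar> \<le> \<eta>/4 + C * (\<Sum>g\<in>F. dist (y g) (y' g))"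
    using bounded_continuous_modulus[OF compact_alphabet w, of "\<eta>/4"] \<eta> by auto
  \<comment> \<open>Each of the \<open>card F\<close> coordinates contributes the same tracking error, as \<open>\<tau> i g\<close> permutes the vertices.\<close>
  define e where "e = \<eta> / (4 * (C * card F + 1))"
  have CF: "C * card F \<ge> 0" using F by simp
  then have e: "e > 0" using \<eta> by (simp add: e_def add_nonneg_pos)
  define \<rho> where "\<rho> l i v = (\<integral>x. dist (r i (name i v x)) (f l (name i v x)) \<partial>m i)" for l i v
  obtain l0 where l0: "\<And>l. l \<ge> l0 \<Longrightarrow> \<forall>\<^sub>F i in sequentially. vavg (W i) (\<rho> l i) < e"
    using tracking[OF e] unfolding \<rho>_def by blast
  show ?thesis
  proof (intro exI allI impI)
    fix l assume "l \<ge> l0"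
    from rules[of l] obtain E where E: "finite E" "\<And>z z'. (\<forall>g\<in>E. z g = z' g) \<Longrightarrow> f l z = f l z'"
      by (auto simp: local_rule_def)
    define p where "p i = proportion (W i) (defect (\<tau> i) E F)" for i
    have "p \<longlonglongrightarrow> 0" unfolding p_def by (rule defect_proportion_tendsto_0[OF sofic E(1) F(1)])
    then have "\<forall>\<^sub>F i in sequentially. p i < \<eta> / (8 * B)"
      using \<eta> B by (intro order_tendstoD) auto
    with l0[OF \<open>l \<ge> l0\<close>] show "\<forall>\<^sub>F i in sequentially.
      code_error w l i < \<eta>"
    proof eventually_elim
      case (elim i)
      interpret prob_space "m i" by (rule model_sequenceD(4)[OF models])
      let ?d = "\<lambda>v x. dist (r i (name i v x)) (f l (name i v x))"
      let ?b = "\<lambda>v. if defect (\<tau> i) E F v then 1 else 0 :: real"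
      have d_int: "integrable (m i) (?d v)" if "v \<in> W i" for v
        using D(2) by (intro model_integrable[OF _ _ that, of "\<lambda>z. dist (r i z) (f l z)" D]) auto
      have in_W: "\<tau> i g v \<in> W i" if "v \<in> W i" for g v
        using that permutes_in_image[OF model_sequenceD(3)[OF models]] by blast
      have pointwise: "\<bar>w (name i v (code i x)) - w (stationary_code (f l) (name i v x))\<bar>
          \<le> \<eta>/4 + C * (\<Sum>g\<in>F. ?d (\<tau> i g v) x) + 2 * B * ?b v" if v: "v \<in> W i" for v x
      proof (cases "defect (\<tau> i) E F v")
        case True
        have "C * (\<Sum>g\<in>F. ?d (\<tau> i g v) x) \<ge> 0" using F(2) by (intro mult_nonneg_nonneg sum_nonneg) auto
        then show ?thesis
          using True B(2)[of "name i v (code i x)"] B(2)[of "stationary_code (f l) (name i v x)"] \<eta>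
          by simp
      next
        case False
        have "dist (name i v (code i x) g) (stationary_code (f l) (name i v x) g) = ?d (\<tau> i g v) x"
          if g: "g \<in> F" for g
        proof -
          have "f l (shift g (name i v x)) = f l (name i (\<tau> i g v) x)"
            using False g by (intro E(2)) (auto simp: shift_def pullback_name_def defect_def)
          then show ?thesis using in_W[OF v] by (simp add: pullback_code_map stationary_code_def)
        qed
        then show ?thesis
          using F(3)[of "name i v (code i x)" "stationary_code (f l) (name i v x)"] False by simp
      qed
      have "code_error w l i
        \<le> vavg (W i) (\<lambda>v. \<eta>/4 + C * (\<Sum>g\<in>F. \<rho> l i (\<tau> i g v)) + 2 * B * ?b v)"
      proof (rule vavg_mono)
        fix v assume v: "v \<in> W i"
        have I: "integrable (m i) (\<lambda>x. \<Sum>g\<in>F. ?d (\<tau> i g v) x)"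
          using d_int in_W[OF v] by (intro Bochner_Integration.integrable_sum) auto
        have "(\<integral>x. \<bar>w (name i v (code i x)) - w (stationary_code (f l) (name i v x))\<bar> \<partial>m i)
          \<le> (\<integral>x. \<eta>/4 + C * (\<Sum>g\<in>F. ?d (\<tau> i g v) x) + 2 * B * ?b v \<partial>m i)"
        proof (rule integral_mono)
          show "integrable (m i) (\<lambda>x. \<bar>w (name i v (code i x)) - w (stationary_code (f l) (name i v x))\<bar>)"
            using pushed_integrable[OF w v] model_integrable[OF stationary_code_w_measurable[OF w f_measurable] B(2) v, of l]
            by (intro integrable_abs Bochner_Integration.integrable_diff)
        qed (use I pointwise[OF v] in auto)
        also have "\<dots> = \<eta>/4 + C * (\<Sum>g\<in>F. \<rho> l i (\<tau> i g v)) + 2 * B * ?b v"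
          using I d_int in_W[OF v] by (simp add: prob_space \<rho>_def Bochner_Integration.integral_sum)
        finally show "(\<integral>x. \<bar>w (name i v (code i x)) - w (stationary_code (f l) (name i v x))\<bar> \<partial>m i)
          \<le> \<eta>/4 + C * (\<Sum>g\<in>F. \<rho> l i (\<tau> i g v)) + 2 * B * ?b v" .
      qed
      also have "\<dots> = \<eta>/4 + C * (\<Sum>g\<in>F. vavg (W i) (\<lambda>v. \<rho> l i (\<tau> i g v))) + 2 * B * p i"
        unfolding vavg_add vavg_cmult vavg_sum vavg_const[OF model_sequenceD(7)[OF models]] p_def
          vavg_indicator[OF model_sequenceD(1)[OF models]] ..
      also have "\<dots> = \<eta>/4 + C * card F * vavg (W i) (\<rho> l i) + 2 * B * p i"
        by (simp add: vavg_permutes[OF model_sequenceD(3)[OF models]])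
      also have "\<dots> \<le> \<eta>/4 + C * card F * e + 2 * B * p i"
        using mult_left_mono[OF less_imp_le[OF elim(1)] CF] by simp
      also have "C * card F * e \<le> \<eta>/4"
      proof -
        have "C * card F * e \<le> (C * card F + 1) * e" using e by (intro mult_right_mono) auto
        also have "\<dots> = \<eta>/4"
        proof -
          have "4 * (C * card F) + 4 \<noteq> 0" using CF by linarith
          then show ?thesis by (simp add: e_def field_simps)
        qed
        finally show ?thesis .
      qed
      also have "2 * B * p i < \<eta>/2"
      proof -
        have "8 * (B * p i) < \<eta>" using elim(2) B by (simp add: field_simps)
        then show ?thesis using \<eta> by linarith
      qed
      finally show ?case using \<eta> by simp
    qed
  qed
qed

lemma stationary_code_ae_continuous:
  fixes w :: "('g \<Rightarrow> 'd) \<Rightarrow> real"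
  assumes w: "bounded_continuous w"
  shows "AE z in P. isCont (\<lambda>z. w (stationary_code (f l) z)) z"
proof -
  have "AE z in distr P borel (shift g). isCont (f l) z" for g
    using rules[of l] unfolding invariant local_rule_def by blast
  then have "AE z in P. isCont (f l) (shift g z)" for g
    by (rule AE_distrD[rotated]) (simp add: P_measurable)
  then have "AE z in P. \<forall>g. isCont (f l) (shift g z)" by (simp add: AE_all_countable)
  then show ?thesis
  proof eventually_elim
    case (elim z)
    have "isCont (\<lambda>z. f l (shift g z)) z" for g
    proof (rule isCont_o2[of z "shift g" "f l"])
      show "isCont (shift g) z" 
        using continuous_on_eq_continuous_at[OF open_UNIV] continuous_shift by blast
    qed (use elim in auto)
    then have "isCont (stationary_code (f l)) z"
      unfolding stationary_code_def isCont_def by (intro tendsto_fun)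
    moreover have "isCont w (stationary_code (f l) z)"
      using w by (simp add: bounded_continuous_def continuous_on_eq_continuous_at)
    ultimately show ?case using isCont_o2[of z "stationary_code (f l)" w] by blast
  qed
qed

lemma stationary_code_L1_tendsto:
  fixes w :: "('g \<Rightarrow> 'd) \<Rightarrow> real"
  assumes w: "bounded_continuous w"
  shows "rule_error w \<longlonglongrightarrow> 0"
proof (rule LIMSEQ_I)
  fix \<eta> :: real assume \<eta>: "\<eta> > 0"
  interpret prob_space P by (rule prob_measuresD[OF P])
  obtain B where B: "B > 0" "\<And>z. \<bar>w z\<bar> \<le> B" using bounded_continuous_bound[OF w] by blast
  obtain D where D: "D > 0" "\<And>x y::'d. dist x y \<le> D" using bounded_dist_if_compact_UNIV[OF compact_alphabet] by blast
  obtain F C where F: "finite F" "C \<ge> 0" "\<And>y y'. \<bar>w y - w y'\<bar> \<le> \<eta>/2 + C * (\<Sum>g\<in>F. dist (y g) (y' g))"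
    using bounded_continuous_modulus[OF compact_alphabet w, of "\<eta>/2"] \<eta> by auto
  have bound: "rule_error w l
      \<le> \<eta>/2 + C * card F * (\<integral>z. dist (f l z) (\<phi> z) \<partial>P)" for l
  proof -
    let ?d = "\<lambda>z. dist (f l z) (\<phi> z)"
    have d: "?d \<in> borel_measurable borel" by measurable
    have I: "integrable P (\<lambda>z. ?d (shift g z))" for g
    proof (rule P_integrable)
      show "(\<lambda>z. ?d (shift g z)) \<in> borel_measurable borel" by measurable
      show "\<bar>?d (shift g z)\<bar> \<le> D" for z using D by simp
    qed
    have "rule_error w l
      \<le> (\<integral>z. \<eta>/2 + C * (\<Sum>g\<in>F. ?d (shift g z)) \<partial>P)"
    proof (rule integral_mono)
      show "integrable P (\<lambda>z. \<bar>w (stationary_code (f l) z) - w (stationary_code \<phi> z)\<bar>)"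
        using stationary_code_w_measurable[OF w] B
        by (intro integrable_abs Bochner_Integration.integrable_diff P_integrable[of _ B]) auto
      show "\<bar>w (stationary_code (f l) z) - w (stationary_code \<phi> z)\<bar> \<le> \<eta>/2 + C * (\<Sum>g\<in>F. ?d (shift g z))" for z
        using F(3)[of "stationary_code (f l) z" "stationary_code \<phi> z"] by (simp add: stationary_code_def)
    qed (use I in auto)
    also have "\<dots> = \<eta>/2 + C * (\<Sum>g\<in>F. \<integral>z. ?d (shift g z) \<partial>P)"
      using I by (simp add: prob_space Bochner_Integration.integral_sum)
    also have "\<dots> = \<eta>/2 + C * card F * (\<integral>z. ?d z \<partial>P)"
      using integral_distr[of "shift _" P borel ?d] d by (simp add: invariant P_measurable)
    finally show ?thesis .
  qed
  have "(\<lambda>l. \<eta>/2 + C * card F * (\<integral>z. dist (f l z) (\<phi> z) \<partial>P)) \<longlonglongrightarrow> \<eta>/2 + C * card F * 0"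
    by (intro tendsto_intros rules_tendsto)
  then have "\<forall>\<^sub>F l in sequentially. \<eta>/2 + C * card F * (\<integral>z. dist (f l z) (\<phi> z) \<partial>P) < \<eta>"
    by (rule order_tendstoD) (use \<eta> in simp)
  then have "\<forall>\<^sub>F l in sequentially. rule_error w l < \<eta>"
    by eventually_elim (rule le_less_trans[OF bound])
  then show "\<exists>no. \<forall>n\<ge>no. norm ((\<integral>z. \<bar>w (stationary_code (f n) z) - w (stationary_code \<phi> z)\<bar> \<partial>P) - 0) < \<eta>"
    by (simp add: eventually_sequentially)
qed


lemma rule_limits:
  fixes w :: "('g \<Rightarrow> 'd) \<Rightarrow> real"
  assumes "quenched_converges W \<tau> m P" and w: "bounded_continuous w"
  shows "local_limit W \<tau> m P (\<lambda>z. w (stationary_code (f l) z))"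
    "empirical_limit W \<tau> m P (\<lambda>z. w (stationary_code (f l) z))"
proof -
  obtain B where B: "\<And>z. \<bar>w z\<bar> \<le> B" using bounded_continuous_bound[OF w] by blast
  note * = quenched_converges_ae_continuous[OF models P assms(1) stationary_code_w_measurable[OF w f_measurable] B
      stationary_code_ae_continuous[OF w]]
  show "local_limit W \<tau> m P (\<lambda>z. w (stationary_code (f l) z))" by (rule *(1))
  show "empirical_limit W \<tau> m P (\<lambda>z. w (stationary_code (f l) z))" by (rule *(2))
qed

definition coded :: "nat \<Rightarrow> ('v \<Rightarrow> 'd) measure"
  where "coded i = distr (m i) (model_space (W i)) (code i)"

lemma coded_models: "model_sequence W \<tau> coded"
  using model_sequenceD[OF models] code_map_measurable[OF models r_measurable]
  by (auto simp: model_sequence_def model_measures_def coded_def intro: prob_space.prob_space_distr)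

lemma coded_process: "distr P borel (stationary_code \<phi>) \<in> prob_measures"
  using prob_measuresD(1)[OF P] stationary_code_measurable[OF \<phi>_measurable]
  by (auto simp: prob_measures_def P_measurable intro: prob_space.prob_space_distr)

lemma eventually_close:
  fixes w :: "('g \<Rightarrow> 'd) \<Rightarrow> real"
  assumes w: "bounded_continuous w" and \<eta>: "\<eta> > 0"
  obtains l where "\<forall>\<^sub>F i in sequentially.
    code_error w l i < \<eta>"
    "rule_error w l < \<eta>"
proof -
  obtain l0 where l0: "\<And>l. l \<ge> l0 \<Longrightarrow> \<forall>\<^sub>F i in sequentially.
    code_error w l i < \<eta>"
    using code_comparison[OF w \<eta>] by blast
  have "\<forall>\<^sub>F l in sequentially. rule_error w l < \<eta>"
    by (rule order_tendstoD(2)[OF stationary_code_L1_tendsto[OF w] \<eta>])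
  then have "\<forall>\<^sub>F l in sequentially. l \<ge> l0 \<and> rule_error w l < \<eta>"
    using eventually_ge_at_top[of l0] by eventually_elim simp
  then obtain l where "l \<ge> l0" "rule_error w l < \<eta>"
    by (auto simp: eventually_sequentially)
  then show ?thesis using l0 by (intro that[of l])
qed

lemma mean_difference:
  fixes w :: "('g \<Rightarrow> 'd) \<Rightarrow> real"
  assumes w: "bounded_continuous w"
  shows "\<bar>(\<integral>z. w (stationary_code (f l) z) \<partial>P) - (\<integral>y. w y \<partial>distr P borel (stationary_code \<phi>))\<bar>
    \<le> rule_error w l"
proof -
  obtain B where B: "\<And>z. \<bar>w z\<bar> \<le> B" using bounded_continuous_bound[OF w] by blast
  have I: "integrable P (\<lambda>z. w (stationary_code (f l) z))" "integrable P (\<lambda>z. w (stationary_code \<phi> z))"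
    using stationary_code_w_measurable[OF w] B by (auto intro: P_integrable[of _ B])
  have "(\<integral>y. w y \<partial>distr P borel (stationary_code \<phi>)) = (\<integral>z. w (stationary_code \<phi> z) \<partial>P)"
    using stationary_code_measurable[OF \<phi>_measurable] bounded_continuous_measurable[OF w]
    by (intro integral_distr) (auto simp: P_measurable)
  then show ?thesis using I integral_abs_bound[of P "\<lambda>z. w (stationary_code (f l) z) - w (stationary_code \<phi> z)"]
    by simp
qed

text \<open>A continuous test function on the coded model is compared with the almost everywhere continuous
function \<open>w \<circ> stationary_code (f l)\<close> of the original model, for which convergence is known. The vertex
average and the expectation over models are both bounded by the same comparison error.\<close>

theorem coded_quenched_converges:
  assumes q: "quenched_converges W \<tau> m P"
  shows "quenched_converges W \<tau> coded (distr P borel (stationary_code \<phi>))"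
  unfolding quenched_converges_iff[OF coded_models coded_process]
proof (intro allI impI)
  fix w :: "('g \<Rightarrow> 'd) \<Rightarrow> real" assume w: "bounded_continuous w"
  obtain B where B: "\<And>z. \<bar>w z\<bar> \<le> B" using bounded_continuous_bound[OF w] by blast
  define h where "h l z = w (stationary_code (f l) z)" for l z
  define J where "J = (\<integral>y. w y \<partial>distr P borel (stationary_code \<phi>))"
  define H where "H l = (\<integral>z. h l z \<partial>P)" for l
  define \<Delta> where "\<Delta> l i = vavg (W i) (\<lambda>v. \<integral>x. \<bar>w (name i v (code i x)) - h l (name i v x)\<bar> \<partial>m i)" for l i
  have pw: "w \<circ> name i v \<in> borel_measurable (model_space (W i))" if "v \<in> W i" for i v
    using that model_sequenceD[OF models] bounded_continuous_measurable[OF w]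
    by (intro measurable_comp[OF pullback_name_measurable]) auto
  have I: "integrable (m i) (\<lambda>x. w (name i v (code i x)))" "integrable (m i) (\<lambda>x. h l (name i v x))"
    if "v \<in> W i" for i v l
    using pushed_integrable[OF w that] model_integrable[OF stationary_code_w_measurable[OF w f_measurable] B that]
    by (auto simp: h_def)
  have pick: "\<exists>l. (\<forall>\<^sub>F i in sequentially. \<Delta> l i < \<eta>) \<and> \<bar>H l - J\<bar> < \<eta>" if pos: "\<eta> > 0" for \<eta>
  proof -
    obtain l where l: "\<forall>\<^sub>F i in sequentially. \<Delta> l i < \<eta>"
      "rule_error w l < \<eta>"
      using eventually_close[OF w pos] unfolding \<Delta>_def h_def by blast
    then have "\<bar>H l - J\<bar> < \<eta>" using mean_difference[OF w, of l] by (simp add: H_def J_def h_def)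
    with l show ?thesis by blast
  qed
  have squeeze: "a \<longlonglongrightarrow> 0" if nonneg: "\<And>i. a i \<ge> 0" and lim: "\<And>l. b l \<longlonglongrightarrow> 0"
    and le: "\<And>l i. a i \<le> \<Delta> l i + b l i + \<bar>H l - J\<bar>" for a :: "nat \<Rightarrow> real" and b
  proof (rule LIMSEQ_I)
    fix \<eta> :: real assume \<eta>: "\<eta> > 0"
    obtain l where l: "\<forall>\<^sub>F i in sequentially. \<Delta> l i < \<eta>/3" "\<bar>H l - J\<bar> < \<eta>/3"
      using pick[of "\<eta>/3"] \<eta> by auto
    have "\<forall>\<^sub>F i in sequentially. b l i < \<eta>/3" using lim[of l] \<eta> by (intro order_tendstoD) auto
    with l(1) have "\<forall>\<^sub>F i in sequentially. a i < \<eta>"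
    proof eventually_elim
      case (elim i)
      then show ?case using le[of i l] l(2) by linarith
    qed
    then show "\<exists>no. \<forall>n\<ge>no. norm (a n - 0) < \<eta>" using nonneg by (simp add: eventually_sequentially)
  qed
  have "local_limit W \<tau> coded (distr P borel (stationary_code \<phi>)) w"
    unfolding local_limit_def
  proof (rule squeeze)
    show "(\<lambda>i. vavg (W i) (\<lambda>v. \<bar>(\<integral>x. h l (name i v x) \<partial>m i) - H l\<bar>)) \<longlonglongrightarrow> 0" for l
      using rule_limits(1)[OF q w, of l] by (simp add: local_limit_def h_def H_def)
    fix l i
    have "vavg (W i) (\<lambda>v. \<bar>(\<integral>x. w (name i v x) \<partial>coded i) - J\<bar>) \<le>
      vavg (W i) (\<lambda>v. (\<integral>x. \<bar>w (name i v (code i x)) - h l (name i v x)\<bar> \<partial>m i) +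
        \<bar>(\<integral>x. h l (name i v x) \<partial>m i) - H l\<bar> + \<bar>H l - J\<bar>)"
    proof (rule vavg_mono)
      fix v assume v: "v \<in> W i"
      have "(\<integral>x. w (name i v x) \<partial>coded i) = (\<integral>x. w (name i v (code i x)) \<partial>m i)"
        unfolding coded_def using pw[OF v] code_map_measurable[OF models r_measurable]
        by (subst integral_distr) (auto simp: o_def)
      moreover have "\<bar>(\<integral>x. w (name i v (code i x)) \<partial>m i) - (\<integral>x. h l (name i v x) \<partial>m i)\<bar>
        \<le> (\<integral>x. \<bar>w (name i v (code i x)) - h l (name i v x)\<bar> \<partial>m i)"
        using I[OF v] integral_abs_bound[of "m i" "\<lambda>x. w (name i v (code i x)) - h l (name i v x)"] by simp
      ultimately show "\<bar>(\<integral>x. w (name i v x) \<partial>coded i) - J\<bar> \<le>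
        (\<integral>x. \<bar>w (name i v (code i x)) - h l (name i v x)\<bar> \<partial>m i) + \<bar>(\<integral>x. h l (name i v x) \<partial>m i) - H l\<bar> + \<bar>H l - J\<bar>"
        by linarith
    qed
    then show "vavg (W i) (\<lambda>v. \<bar>(\<integral>x. w (name i v x) \<partial>coded i) - (\<integral>y. w y \<partial>distr P borel (stationary_code \<phi>))\<bar>) \<le>
      \<Delta> l i + vavg (W i) (\<lambda>v. \<bar>(\<integral>x. h l (name i v x) \<partial>m i) - H l\<bar>) + \<bar>H l - J\<bar>"
      by (simp add: vavg_add vavg_const[OF model_sequenceD(7)[OF models]] \<Delta>_def J_def)
  qed (auto intro: vavg_nonneg)
  moreover have "empirical_limit W \<tau> coded (distr P borel (stationary_code \<phi>)) w"
    unfolding empirical_limit_def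
  proof (rule squeeze)
    show "(\<lambda>i. \<integral>x. \<bar>vavg (W i) (\<lambda>v. h l (name i v x)) - H l\<bar> \<partial>m i) \<longlonglongrightarrow> 0" for l
      using rule_limits(2)[OF q w, of l] by (simp add: empirical_limit_def h_def H_def)
    fix l i
    interpret prob_space "m i" by (rule model_sequenceD(4)[OF models])
    have int_avg: "integrable (m i) (\<lambda>x. vavg (W i) (\<lambda>v. k v x))" if "\<And>v. v \<in> W i \<Longrightarrow> integrable (m i) (k v)" for k
      unfolding vavg_def using that by (intro integrable_divide Bochner_Integration.integrable_sum)
    have swap: "(\<integral>x. vavg (W i) (\<lambda>v. k v x) \<partial>m i) = vavg (W i) (\<lambda>v. \<integral>x. k v x \<partial>m i)"
      if "\<And>v. v \<in> W i \<Longrightarrow> integrable (m i) (k v)" for k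
      unfolding vavg_def using that by (simp add: Bochner_Integration.integral_sum)
    have "(\<integral>x. \<bar>vavg (W i) (\<lambda>v. w (name i v x)) - J\<bar> \<partial>coded i) =
      (\<integral>x. \<bar>vavg (W i) (\<lambda>v. w (name i v (code i x))) - J\<bar> \<partial>m i)"
      unfolding coded_def
    proof (rule integral_distr[OF code_map_measurable[OF models r_measurable]])
      note [measurable] = pw[unfolded o_def]
      show "(\<lambda>x. \<bar>vavg (W i) (\<lambda>v. w (name i v x)) - J\<bar>) \<in> borel_measurable (model_space (W i))"
        unfolding vavg_def by measurable
    qed
    also have "\<dots> \<le> (\<integral>x. vavg (W i) (\<lambda>v. \<bar>w (name i v (code i x)) - h l (name i v x)\<bar>) +
      \<bar>vavg (W i) (\<lambda>v. h l (name i v x)) - H l\<bar> + \<bar>H l - J\<bar> \<partial>m i)"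
    proof (rule integral_mono)
      fix x
      have "\<bar>vavg (W i) (\<lambda>v. w (name i v (code i x))) - vavg (W i) (\<lambda>v. h l (name i v x))\<bar>
        \<le> vavg (W i) (\<lambda>v. \<bar>w (name i v (code i x)) - h l (name i v x)\<bar>)"
        using abs_vavg_le[of "W i" "\<lambda>v. w (name i v (code i x)) - h l (name i v x)"]
        by (simp add: vavg_def sum_subtractf diff_divide_distrib)
      then show "\<bar>vavg (W i) (\<lambda>v. w (name i v (code i x))) - J\<bar> \<le>
        vavg (W i) (\<lambda>v. \<bar>w (name i v (code i x)) - h l (name i v x)\<bar>) +
        \<bar>vavg (W i) (\<lambda>v. h l (name i v x)) - H l\<bar> + \<bar>H l - J\<bar>" by linarith
    qed (intro Bochner_Integration.integrable_add integrable_abs Bochner_Integration.integrable_diff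
        int_avg I integrable_const; assumption)+
    also have "\<dots> = \<Delta> l i + (\<integral>x. \<bar>vavg (W i) (\<lambda>v. h l (name i v x)) - H l\<bar> \<partial>m i) + \<bar>H l - J\<bar>"
      using I by (simp add: int_avg swap prob_space \<Delta>_def)
    finally show "(\<integral>x. \<bar>vavg (W i) (\<lambda>v. w (name i v x)) - (\<integral>y. w y \<partial>distr P borel (stationary_code \<phi>))\<bar> \<partial>coded i) \<le>
      \<Delta> l i + (\<integral>x. \<bar>vavg (W i) (\<lambda>v. h l (name i v x)) - H l\<bar> \<partial>m i) + \<bar>H l - J\<bar>"
      by (simp add: J_def)
  qed auto
  ultimately show "local_limit W \<tau> coded (distr P borel (stationary_code \<phi>)) w \<and>
    empirical_limit W \<tau> coded (distr P borel (stationary_code \<phi>)) w" ..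
qed

text \<open>A function \<open>u\<close> of the original process that is nearly a continuous function \<open>w\<close> of its code stays so on
models, with \<open>w\<close> evaluated on the coded model. The code comparison reduces this to the mean of an almost
everywhere continuous function.\<close>

lemma decoding:
  fixes w :: "('g \<Rightarrow> 'd) \<Rightarrow> real" and u :: "('g \<Rightarrow> 'c) \<Rightarrow> real"
  assumes q: "quenched_converges W \<tau> m P" and w: "bounded_continuous w" and u: "bounded_continuous u"
    and close: "(\<integral>z. \<bar>u z - w (stationary_code \<phi> z)\<bar> \<partial>P) < \<eta>"
  shows "\<forall>\<^sub>F i in sequentially.
    vavg (W i) (\<lambda>v. \<integral>x. \<bar>u (name i v x) - w (name i v (code i x))\<bar> \<partial>m i) < \<eta>"
proof -
  obtain B where B: "\<And>z. \<bar>w z\<bar> \<le> B" using bounded_continuous_bound[OF w] by blast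
  obtain B' where B': "\<And>z. \<bar>u z\<bar> \<le> B'" using bounded_continuous_bound[OF u] by blast
  define s where "s = \<eta> - (\<integral>z. \<bar>u z - w (stationary_code \<phi> z)\<bar> \<partial>P)"
  have s: "s > 0" using close by (simp add: s_def)
  obtain l where l: "\<forall>\<^sub>F i in sequentially.
      code_error w l i < s/3"
    "rule_error w l < s/3"
    using eventually_close[OF w, of "s/3"] s by auto
  define h where "h z = \<bar>u z - w (stationary_code (f l) z)\<bar>" for z
  note [measurable] = bounded_continuous_measurable[OF u] stationary_code_w_measurable[OF w]
  have h_meas: "h \<in> borel_measurable borel" unfolding h_def by measurable
  have h_bound: "\<bar>h z\<bar> \<le> B' + B" for z using B[of "stationary_code (f l) z"] B'[of z] by (simp add: h_def)
  have h_cont: "AE z in P. isCont h z" using stationary_code_ae_continuous[OF w, of l]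
  proof eventually_elim
    case (elim z)
    have "isCont u z" using u by (simp add: bounded_continuous_def continuous_on_eq_continuous_at)
    then show ?case unfolding h_def by (intro continuous_intros elim)
  qed
  have IP: "integrable P u" "integrable P (\<lambda>z. w (stationary_code (f l) z))" "integrable P (\<lambda>z. w (stationary_code \<phi> z))"
    by (rule P_integrable[OF bounded_continuous_measurable[OF u] B'])
      (rule P_integrable[OF stationary_code_w_measurable[OF w] B], measurable)+
  have "(\<integral>z. h z \<partial>P) \<le> (\<integral>z. \<bar>u z - w (stationary_code \<phi> z)\<bar> + \<bar>w (stationary_code (f l) z) - w (stationary_code \<phi> z)\<bar> \<partial>P)"
    unfolding h_def using IP by (intro integral_mono) auto
  also have "\<dots> < \<eta> - s + s/3" using IP l(2) by (simp add: s_def)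
  finally have hP: "(\<integral>z. h z \<partial>P) < \<eta> - 2/3 * s" by simp
  have "local_limit W \<tau> m P h"
    by (rule quenched_converges_ae_continuous[OF models P q h_meas h_bound h_cont])
  then have "\<forall>\<^sub>F i in sequentially. vavg (W i) (\<lambda>v. \<bar>(\<integral>x. h (name i v x) \<partial>m i) - (\<integral>z. h z \<partial>P)\<bar>) < s/3"
    unfolding local_limit_def using s by (intro order_tendstoD) auto
  with l(1) show ?thesis
  proof eventually_elim
    case (elim i)
    have "vavg (W i) (\<lambda>v. \<integral>x. \<bar>u (name i v x) - w (name i v (code i x))\<bar> \<partial>m i) \<le>
      vavg (W i) (\<lambda>v. (\<integral>x. \<bar>w (name i v (code i x)) - w (stationary_code (f l) (name i v x))\<bar> \<partial>m i) +
        \<bar>(\<integral>x. h (name i v x) \<partial>m i) - (\<integral>z. h z \<partial>P)\<bar> + (\<integral>z. h z \<partial>P))"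
    proof (rule vavg_mono)
      fix v assume v: "v \<in> W i"
      have I: "integrable (m i) (\<lambda>x. w (name i v (code i x)))" "integrable (m i) (\<lambda>x. w (stationary_code (f l) (name i v x)))"
        "integrable (m i) (\<lambda>x. u (name i v x))"
        using pushed_integrable[OF w v] model_integrable[OF stationary_code_w_measurable[OF w f_measurable] B v]
          model_integrable[OF bounded_continuous_measurable[OF u] B' v] by auto
      have "(\<integral>x. \<bar>u (name i v x) - w (name i v (code i x))\<bar> \<partial>m i) \<le>
        (\<integral>x. \<bar>w (name i v (code i x)) - w (stationary_code (f l) (name i v x))\<bar> + h (name i v x) \<partial>m i)"
        unfolding h_def using I by (intro integral_mono) auto
      also have "\<dots> = (\<integral>x. \<bar>w (name i v (code i x)) - w (stationary_code (f l) (name i v x))\<bar> \<partial>m i) + (\<integral>x. h (name i v x) \<partial>m i)"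
        unfolding h_def using I by (intro Bochner_Integration.integral_add) auto
      finally show "(\<integral>x. \<bar>u (name i v x) - w (name i v (code i x))\<bar> \<partial>m i) \<le>
        (\<integral>x. \<bar>w (name i v (code i x)) - w (stationary_code (f l) (name i v x))\<bar> \<partial>m i) +
        \<bar>(\<integral>x. h (name i v x) \<partial>m i) - (\<integral>z. h z \<partial>P)\<bar> + (\<integral>z. h z \<partial>P)" by linarith
    qed
    also have "\<dots> < \<eta>"
      unfolding vavg_add vavg_const[OF model_sequenceD(7)[OF models]] using elim hP by linarith
    finally show ?case .
  qed
qed

end

section \<open>A diagonal choice of local rules\<close>

lemma diagonal_choice:
  assumes "\<And>k. eventually (Q k) sequentially"
  obtains \<kappa> :: "nat \<Rightarrow> nat" where "filterlim \<kappa> at_top sequentially" "\<forall>\<^sub>F i in sequentially. Q (\<kappa> i) i"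
proof -
  obtain N where N: "\<And>k i. i \<ge> N k \<Longrightarrow> Q k i"
    using assms unfolding eventually_sequentially by metis
  define S where "S i = {k. k \<le> i \<and> N k \<le> i}" for i
  define \<kappa> where "\<kappa> i = Max (S i)" for i
  have fin: "finite (S i)" for i by (rule finite_subset[of _ "{..i}"]) (auto simp: S_def)
  have "Q (\<kappa> i) i" if "i \<ge> N 0" for i
  proof -
    have "0 \<in> S i" using that by (simp add: S_def)
    then have "\<kappa> i \<in> S i" unfolding \<kappa>_def using fin by (intro Max_in) auto
    then show ?thesis using N by (simp add: S_def)
  qed
  moreover have "\<kappa> i \<ge> k" if "i \<ge> max k (N k)" for i k
    unfolding \<kappa>_def using that fin by (intro Max_ge) (auto simp: S_def)
  ultimately show ?thesis
    by (intro that[of \<kappa>]) (unfold filterlim_at_top eventually_sequentially, blast+)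
qed

text \<open>For fixed \<open>k\<close> and \<open>l\<close> the function \<open>dist (f k) (f l)\<close> is almost everywhere continuous, so its average over
models converges to its mean, which is less than \<open>1/(k+1) + 1/(l+1)\<close>. Letting \<open>k\<close> grow slowly with \<open>i\<close>
keeps the averages below only slightly larger bounds for all \<open>l \<le> k\<close>.\<close>

lemma exists_coding:
  fixes W :: "nat \<Rightarrow> 'v set" and \<tau> :: "nat \<Rightarrow> 'g::{group_add,countable} \<Rightarrow> 'v \<Rightarrow> 'v"
    and m :: "nat \<Rightarrow> ('v \<Rightarrow> 'c::polish_space) measure" and P :: "('g \<Rightarrow> 'c) measure"
    and \<phi> :: "('g \<Rightarrow> 'c) \<Rightarrow> 'd::{metric_space,second_countable_topology}"
  assumes models: "model_sequence W \<tau> m" and sofic: "sofic_approximation W \<tau>"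
    and P: "P \<in> prob_measures" and invariant: "\<And>g. distr P borel (shift g) = P"
    and C: "compact (UNIV :: 'c set)" and D: "compact (UNIV :: 'd set)"
    and \<phi>: "\<phi> \<in> borel_measurable borel" and q: "quenched_converges W \<tau> m P"
  obtains f \<kappa> where "coding W \<tau> m P \<phi> f (\<lambda>i. f (\<kappa> i :: nat))"
proof -
  interpret prob_space P by (rule prob_measuresD[OF P])
  note meas = measurable_cong_sets[OF prob_measuresD(2)[OF P] refl]
  obtain B where B: "B > 0" "\<And>x y::'d. dist x y \<le> B" using bounded_dist_if_compact_UNIV[OF D] by blast
  have "\<exists>f. local_rule P f \<and> (\<integral>z. dist (f z) (\<phi> z) \<partial>P) < 1 / (real l + 1)" for l
    using local_rule_approx[OF C D P \<phi>, of "1 / (real l + 1)"] by (metis of_nat_0_le_iff add_nonneg_pos zero_less_divide_1_iff zero_less_one)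
  then obtain f where f: "\<And>l. local_rule P (f l)" "\<And>l. (\<integral>z. dist (f l z) (\<phi> z) \<partial>P) < 1 / (real l + 1)"
    by metis
  have fm [measurable]: "f l \<in> borel_measurable borel" for l using f(1) by (simp add: local_rule_def)
  note [measurable] = \<phi>
  have int: "integrable P (\<lambda>z. dist (a z) (b z))" if [measurable]: "a \<in> borel_measurable borel" "b \<in> borel_measurable borel"
    for a b :: "('g \<Rightarrow> 'c) \<Rightarrow> 'd"
  proof (rule integrable_bounded)
    show "(\<lambda>z. dist (a z) (b z)) \<in> borel_measurable P" unfolding meas by measurable
    show "\<bar>dist (a z) (b z)\<bar> \<le> B" for z using B by simp
  qed
  have cauchy: "(\<integral>z. dist (f k z) (f l z) \<partial>P) < 1 / (real k + 1) + 1 / (real l + 1)" for k l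
  proof -
    have "(\<integral>z. dist (f k z) (f l z) \<partial>P) \<le> (\<integral>z. dist (f k z) (\<phi> z) + dist (f l z) (\<phi> z) \<partial>P)"
      by (intro integral_mono Bochner_Integration.integrable_add int fm \<phi> dist_triangle2)
    also have "\<dots> = (\<integral>z. dist (f k z) (\<phi> z) \<partial>P) + (\<integral>z. dist (f l z) (\<phi> z) \<partial>P)"
      by (intro Bochner_Integration.integral_add int fm \<phi>)
    finally show ?thesis using f(2)[of k] f(2)[of l] by linarith
  qed
  define \<rho> where "\<rho> k l i = vavg (W i) (\<lambda>v. \<integral>x. dist (f k (pullback_name (\<tau> i) v x)) (f l (pullback_name (\<tau> i) v x)) \<partial>m i)" for k l i
  have ev: "\<forall>\<^sub>F i in sequentially. \<rho> k l i < 2 / (real k + 1) + 1 / (real l + 1)" for k l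
  proof -
    let ?h = "\<lambda>z. dist (f k z) (f l z)"
    have ae: "AE z in P. isCont ?h z"
    proof -
      have "AE z in P. isCont (f k) z" "AE z in P. isCont (f l) z" using f(1) by (auto simp: local_rule_def)
      then show ?thesis by eventually_elim (intro continuous_intros)
    qed
    have hm: "?h \<in> borel_measurable borel" by measurable
    have hb: "\<bar>?h z\<bar> \<le> B" for z using B by simp
    have "local_limit W \<tau> m P ?h"
      by (rule quenched_converges_ae_continuous(1)[OF models P q hm hb ae])
    then have "\<forall>\<^sub>F i in sequentially. vavg (W i) (\<lambda>v. \<bar>(\<integral>x. ?h (pullback_name (\<tau> i) v x) \<partial>m i) - (\<integral>z. ?h z \<partial>P)\<bar>) < 1 / (real k + 1)"
      unfolding local_limit_def by (rule order_tendstoD) (simp add: add_nonneg_pos)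
    then show ?thesis
    proof eventually_elim
      case (elim i)
      have "\<rho> k l i \<le> vavg (W i) (\<lambda>v. \<bar>(\<integral>x. ?h (pullback_name (\<tau> i) v x) \<partial>m i) - (\<integral>z. ?h z \<partial>P)\<bar> + (\<integral>z. ?h z \<partial>P))"
        unfolding \<rho>_def by (rule vavg_mono) linarith
      also have "\<dots> < 2 / (real k + 1) + 1 / (real l + 1)"
        unfolding vavg_add vavg_const[OF model_sequenceD(7)[OF models]] using elim cauchy[of k l] by simp
      finally show ?case .
    qed
  qed
  have all: "\<forall>\<^sub>F i in sequentially. \<forall>l\<in>{..k}. \<rho> k l i < 2 / (real k + 1) + 1 / (real l + 1)" for k
    by (intro eventually_ball_finite) (auto intro: ev)
  obtain \<kappa> where \<kappa>: "filterlim \<kappa> at_top sequentially"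
    "\<forall>\<^sub>F i in sequentially. \<forall>l\<in>{..\<kappa> i}. \<rho> (\<kappa> i) l i < 2 / (real (\<kappa> i) + 1) + 1 / (real l + 1)"
    by (rule diagonal_choice[OF all])
  have "coding W \<tau> m P \<phi> f (\<lambda>i. f (\<kappa> i))"
  proof (rule coding.intro)
    show "(\<lambda>l. \<integral>z. dist (f l z) (\<phi> z) \<partial>P) \<longlonglongrightarrow> 0"
    proof (rule tendsto_sandwich[OF _ _ tendsto_const])
      show "(\<lambda>l. 1 / (real l + 1)) \<longlonglongrightarrow> 0"
        using LIMSEQ_inverse_real_of_nat by (simp add: inverse_eq_divide add.commute)
    qed (use f(2) in \<open>auto intro!: always_eventually less_imp_le\<close>)
    fix \<eta> :: real assume \<eta>: "\<eta> > 0"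
    have small: "3 / (real l + 1) < \<eta>" if "l \<ge> nat \<lceil>3 / \<eta>\<rceil>" for l
    proof -
      have "3 / \<eta> < real l + 1" using that by linarith
      then show ?thesis using \<eta> by (simp add: field_simps)
    qed
    show "\<exists>l0. \<forall>l\<ge>l0. \<forall>\<^sub>F i in sequentially.
      vavg (W i) (\<lambda>v. \<integral>x. dist (f (\<kappa> i) (pullback_name (\<tau> i) v x)) (f l (pullback_name (\<tau> i) v x)) \<partial>m i) < \<eta>"
    proof (intro exI allI impI)
      fix l assume l: "l \<ge> nat \<lceil>3 / \<eta>\<rceil>"
      have "\<forall>\<^sub>F i in sequentially. \<kappa> i \<ge> l" using \<kappa>(1) by (simp add: filterlim_at_top)
      with \<kappa>(2) show "\<forall>\<^sub>F i in sequentially.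
        vavg (W i) (\<lambda>v. \<integral>x. dist (f (\<kappa> i) (pullback_name (\<tau> i) v x)) (f l (pullback_name (\<tau> i) v x)) \<partial>m i) < \<eta>"
      proof eventually_elim
        case (elim i)
        have "\<rho> (\<kappa> i) l i < 2 / (real (\<kappa> i) + 1) + 1 / (real l + 1)" using elim by simp
        moreover have "2 / (real (\<kappa> i) + 1) \<le> 2 / (real l + 1)" using elim(2) by (intro divide_left_mono) auto
        moreover have "2 / (real l + 1) + 1 / (real l + 1) = 3 / (real l + 1)" by (simp add: add_divide_distrib[symmetric])
        ultimately have "\<rho> (\<kappa> i) l i < \<eta>" using small[OF l] by linarith
        then show ?case by (simp add: \<rho>_def)
      qed
    qed
  qed (rule models sofic P invariant D \<phi> f(1) fm)+
  then show ?thesis by (rule that)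
qed

section \<open>Pairs of models and of processes\<close>

lemma (in prob_space) distr_pair_snd: "prob_space N \<Longrightarrow> distr (N \<Otimes>\<^sub>M M) M snd = M"
proof -
  assume "prob_space N"
  then interpret N: prob_space N .
  interpret pair_sigma_finite N M by unfold_locales
  interpret pair_sigma_finite M N by unfold_locales
  have "distr (N \<Otimes>\<^sub>M M) M snd = distr (distr (M \<Otimes>\<^sub>M N) (N \<Otimes>\<^sub>M M) (\<lambda>(x, y). (y, x))) M snd"
    by (subst pair_sigma_finite.distr_pair_swap[of N M]) (unfold_locales, simp)
  also have "\<dots> = distr (M \<Otimes>\<^sub>M N) M fst"
    by (subst distr_distr) (auto simp: o_def case_prod_beta')
  also have "\<dots> = M" by (rule N.distr_pair_fst)
  finally show ?thesis .
qed

lemma zip_model_measurable: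
  assumes "sets m = sets (PiM V (\<lambda>_. borel :: 'c::second_countable_topology measure))"
  shows "(\<lambda>(x, y). \<lambda>v\<in>V. (x v, y v)) \<in> measurable (m \<Otimes>\<^sub>M m) (PiM V (\<lambda>_. borel :: ('c \<times> 'c) measure))"
proof -
  have "(\<lambda>(x, y). \<lambda>v\<in>V. (x v, y v)) \<in>
      measurable (model_space V \<Otimes>\<^sub>M model_space V) (PiM V (\<lambda>_. (borel :: 'c measure) \<Otimes>\<^sub>M (borel :: 'c measure)))"
    by measurable
  then show ?thesis
    unfolding borel_prod measurable_cong_sets[OF sets_pair_measure_cong[OF assms assms] refl] .
qed

lemma zip_process_measurable:
  fixes P :: "('g::countable \<Rightarrow> 'c::second_countable_topology) measure"
  assumes "sets P = sets borel"
  shows "(\<lambda>(x, y). \<lambda>g. (x g, y g)) \<in> measurable (P \<Otimes>\<^sub>M P) borel"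
proof -
  have "(\<lambda>(x, y). \<lambda>g. (x g, y g)) \<in> measurable (borel \<Otimes>\<^sub>M borel) (borel :: ('g \<Rightarrow> 'c \<times> 'c) measure)"
    by (intro measurable_coordinatewise_then_product) (auto simp: case_prod_beta intro!: borel_measurable_Pair
        measurable_compose[OF measurable_fst measurable_product_coordinates]
        measurable_compose[OF measurable_snd measurable_product_coordinates])
  then show ?thesis unfolding measurable_cong_sets[OF sets_pair_measure_cong[OF assms assms] refl] .
qed


lemma pair_model_in_model_measures:
  fixes m :: "('v \<Rightarrow> 'c::second_countable_topology) measure"
  assumes "m \<in> model_measures V"
  shows "pair_model V m \<in> model_measures V"
proof -
  have m: "prob_space m" "sets m = sets (model_space V)" using assms by (auto simp: model_measures_def)
  interpret prob_space m by fact
  interpret pair_prob_space m m ..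
  show ?thesis
    unfolding model_measures_def pair_model_def using zip_model_measurable[OF m(2)] prob_space_distr by simp
qed

lemma pair_process_in_prob_measures:
  fixes P :: "('g::countable \<Rightarrow> 'c::second_countable_topology) measure"
  assumes "P \<in> prob_measures" shows "pair_process P \<in> prob_measures"
proof -
  interpret prob_space P by (rule prob_measuresD[OF assms])
  interpret pair_prob_space P P ..
  show ?thesis
    unfolding prob_measures_def pair_process_def
    using zip_process_measurable[OF prob_measuresD(2)[OF assms]] prob_space_distr by simp
qed

lemma pair_model_sequence:
  fixes m :: "nat \<Rightarrow> ('v \<Rightarrow> 'c::second_countable_topology) measure"
  assumes "model_sequence W \<tau> m" shows "model_sequence W \<tau> (\<lambda>i. pair_model (W i) (m i))"
  using assms pair_model_in_model_measures unfolding model_sequence_def by blast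

lemma pair_model_distr:
  fixes m :: "('v \<Rightarrow> 'c::second_countable_topology) measure"
    and H :: "('v \<Rightarrow> 'c) \<Rightarrow> ('v \<Rightarrow> 'd::second_countable_topology)"
  assumes m: "m \<in> model_measures V" and H: "H \<in> measurable m (model_space V)"
    and K: "K \<in> measurable (model_space V) (model_space V)"
    and eq: "\<And>x y. x \<in> space (model_space V) \<Longrightarrow> y \<in> space (model_space V) \<Longrightarrow>
      K (\<lambda>v\<in>V. (x v, y v)) = (\<lambda>v\<in>V. (H x v, H y v))"
  shows "pair_model V (distr m (model_space V) H) = distr (pair_model V m) (model_space V) K"
proof -
  have m': "prob_space m" "sets m = sets (model_space V)" using m by (auto simp: model_measures_def)
  note sp = sets_eq_imp_space_eq[OF m'(2)]
  interpret prob_space m by fact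
  interpret D: prob_space "distr m (model_space V) H" by (rule prob_space_distr[OF H])
  have pm: "distr m (model_space V) H \<Otimes>\<^sub>M distr m (model_space V) H =
      distr (m \<Otimes>\<^sub>M m) (model_space V \<Otimes>\<^sub>M model_space V) (\<lambda>(x, y). (H x, H y))"
    by (rule pair_measure_distr[OF H H]) unfold_locales
  have HH: "(\<lambda>(x, y). (H x, H y)) \<in> measurable (m \<Otimes>\<^sub>M m) (model_space V \<Otimes>\<^sub>M model_space V)"
    using H by measurable
  have "pair_model V (distr m (model_space V) H) =
      distr (m \<Otimes>\<^sub>M m) (model_space V) ((\<lambda>(x, y). \<lambda>v\<in>V. (x v, y v)) \<circ> (\<lambda>(x, y). (H x, H y)))"
    unfolding pair_model_def pm by (rule distr_distr[OF zip_model_measurable[OF refl] HH])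
  also have "\<dots> = distr (m \<Otimes>\<^sub>M m) (model_space V) (K \<circ> (\<lambda>(x, y). \<lambda>v\<in>V. (x v, y v)))"
    by (rule distr_cong) (auto simp: space_pair_measure sp eq)
  also have "\<dots> = distr (pair_model V m) (model_space V) K"
    unfolding pair_model_def by (rule distr_distr[symmetric, OF K zip_model_measurable[OF m'(2)]])
  finally show ?thesis .
qed

lemma pair_process_distr:
  fixes P :: "('g::countable \<Rightarrow> 'c::second_countable_topology) measure"
    and H :: "('g \<Rightarrow> 'c) \<Rightarrow> ('g \<Rightarrow> 'd::second_countable_topology)"
  assumes P: "P \<in> prob_measures" and H: "H \<in> borel_measurable borel" and K: "K \<in> borel_measurable borel"
    and eq: "\<And>x y. K (\<lambda>g. (x g, y g)) = (\<lambda>g. (H x g, H y g))"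
  shows "pair_process (distr P borel H) = distr (pair_process P) borel K"
proof -
  note P' = prob_measuresD[OF P]
  interpret prob_space P by fact
  have H: "H \<in> borel_measurable P" using H measurable_cong_sets[OF P'(2) refl] by blast
  interpret D: prob_space "distr P borel H" by (rule prob_space_distr[OF H])
  have pm: "distr P borel H \<Otimes>\<^sub>M distr P borel H = distr (P \<Otimes>\<^sub>M P) (borel \<Otimes>\<^sub>M borel) (\<lambda>(x, y). (H x, H y))"
    by (rule pair_measure_distr[OF H H]) unfold_locales
  have HH: "(\<lambda>(x, y). (H x, H y)) \<in> measurable (P \<Otimes>\<^sub>M P) (borel \<Otimes>\<^sub>M borel)"
    using H by measurable
  have "pair_process (distr P borel H) = distr (P \<Otimes>\<^sub>M P) borel ((\<lambda>(x, y). \<lambda>g. (x g, y g)) \<circ> (\<lambda>(x, y). (H x, H y)))"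
    unfolding pair_process_def pm by (rule distr_distr[OF zip_process_measurable[OF refl] HH])
  also have "\<dots> = distr (P \<Otimes>\<^sub>M P) borel (K \<circ> (\<lambda>(x, y). \<lambda>g. (x g, y g)))"
    by (rule distr_cong) (auto simp: eq)
  also have "\<dots> = distr (pair_process P) borel K"
    unfolding pair_process_def by (rule distr_distr[symmetric, OF K zip_process_measurable[OF P'(2)]])
  finally show ?thesis .
qed

definition letter_map :: "'v set \<Rightarrow> ('c \<Rightarrow> 'd) \<Rightarrow> ('v \<Rightarrow> 'c) \<Rightarrow> ('v \<Rightarrow> 'd)"
  where "letter_map V \<pi> x = (\<lambda>v\<in>V. \<pi> (x v))"

lemma letter_map_measurable:
  assumes [measurable]: "\<pi> \<in> borel_measurable borel"
  shows "letter_map V \<pi> \<in> measurable (model_space V) (model_space V)"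
  unfolding letter_map_def by measurable

lemma letter_map_pair_model:
  fixes m :: "('v \<Rightarrow> 'c::second_countable_topology) measure"
  assumes "m \<in> model_measures V"
  shows "distr (pair_model V m) (model_space V) (letter_map V fst) = m"
    and "distr (pair_model V m) (model_space V) (letter_map V snd) = m"
proof -
  have m': "prob_space m" "sets m = sets (model_space V)" using assms by (auto simp: model_measures_def)
  note sp = sets_eq_imp_space_eq[OF m'(2)]
  interpret prob_space m by fact
  have "fst \<in> borel_measurable (borel :: ('c \<times> 'c) measure)" "snd \<in> borel_measurable (borel :: ('c \<times> 'c) measure)"
    by (auto intro!: borel_measurable_continuous_onI continuous_intros)
  note lm = this[THEN letter_map_measurable]
  have "distr (pair_model V m) (model_space V) (letter_map V fst) = distr (m \<Otimes>\<^sub>M m) m fst"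
    unfolding pair_model_def
    by (subst distr_distr[OF lm(1) zip_model_measurable[OF m'(2)]])
      (rule distr_cong, auto simp: m'(2) letter_map_def space_pair_measure sp space_PiM PiE_def extensional_def fun_eq_iff)
  then show "distr (pair_model V m) (model_space V) (letter_map V fst) = m"
    by (simp add: distr_pair_fst)
  have "distr (pair_model V m) (model_space V) (letter_map V snd) = distr (m \<Otimes>\<^sub>M m) m snd"
    unfolding pair_model_def
    by (subst distr_distr[OF lm(2) zip_model_measurable[OF m'(2)]])
      (rule distr_cong, auto simp: m'(2) letter_map_def space_pair_measure sp space_PiM PiE_def extensional_def fun_eq_iff)
  then show "distr (pair_model V m) (model_space V) (letter_map V snd) = m"
    by (simp add: distr_pair_snd m'(1))
qed

lemma letter_process_measurable:
  fixes \<pi> :: "'c::second_countable_topology \<Rightarrow> 'd::second_countable_topology"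
  assumes "\<pi> \<in> borel_measurable borel"
  shows "(\<lambda>y (g::'g::countable). \<pi> (y g)) \<in> borel_measurable borel"
  by (intro measurable_coordinatewise_then_product measurable_compose[OF measurable_product_coordinates assms])

lemma letter_pair_process:
  fixes P :: "('g::countable \<Rightarrow> 'c::second_countable_topology) measure"
  assumes "P \<in> prob_measures"
  shows "distr (pair_process P) borel (\<lambda>z g. fst (z g)) = P"
    and "distr (pair_process P) borel (\<lambda>z g. snd (z g)) = P"
proof -
  note P' = prob_measuresD[OF assms]
  interpret prob_space P by fact
  have "fst \<in> borel_measurable (borel :: ('c \<times> 'c) measure)" "snd \<in> borel_measurable (borel :: ('c \<times> 'c) measure)"
    by (auto intro!: borel_measurable_continuous_onI continuous_intros)
  note lm = this[THEN letter_process_measurable]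
  have "distr (pair_process P) borel (\<lambda>z g. fst (z g)) = distr (P \<Otimes>\<^sub>M P) P fst"
    unfolding pair_process_def
    by (subst distr_distr[OF lm(1) zip_process_measurable[OF P'(2)]]) (rule distr_cong, auto simp: P'(2))
  then show "distr (pair_process P) borel (\<lambda>z g. fst (z g)) = P" by (simp add: distr_pair_fst)
  have "distr (pair_process P) borel (\<lambda>z g. snd (z g)) = distr (P \<Otimes>\<^sub>M P) P snd"
    unfolding pair_process_def
    by (subst distr_distr[OF lm(2) zip_process_measurable[OF P'(2)]]) (rule distr_cong, auto simp: P'(2))
  then show "distr (pair_process P) borel (\<lambda>z g. snd (z g)) = P" by (simp add: distr_pair_snd P'(1))
qed

text \<open>A continuous letter-to-letter map commutes exactly with pullback names, so it needs no approximation.\<close>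

lemma letter_map_quenched_converges:
  fixes W :: "nat \<Rightarrow> 'v set" and \<tau> :: "nat \<Rightarrow> 'g::countable \<Rightarrow> 'v \<Rightarrow> 'v"
    and m :: "nat \<Rightarrow> ('v \<Rightarrow> 'c::second_countable_topology) measure"
    and \<pi> :: "'c \<Rightarrow> 'd::second_countable_topology"
  assumes models: "model_sequence W \<tau> m" and P: "P \<in> prob_measures"
    and \<pi>: "continuous_on UNIV \<pi>" and q: "quenched_converges W \<tau> m P"
  shows "model_sequence W \<tau> (\<lambda>i. distr (m i) (model_space (W i)) (letter_map (W i) \<pi>))"
    and "distr P borel (\<lambda>y g. \<pi> (y g)) \<in> prob_measures"
    and "quenched_converges W \<tau> (\<lambda>i. distr (m i) (model_space (W i)) (letter_map (W i) \<pi>))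
      (distr P borel (\<lambda>y g. \<pi> (y g)))"
proof -
  let ?m = "\<lambda>i. distr (m i) (model_space (W i)) (letter_map (W i) \<pi>)"
  let ?\<Pi> = "\<lambda>(y :: 'g \<Rightarrow> 'c) g. \<pi> (y g)"
  let ?P = "distr P borel ?\<Pi>"
  note D = model_sequenceD[OF models]
  have \<pi>m: "\<pi> \<in> borel_measurable borel" using \<pi> by (rule borel_measurable_continuous_onI)
  have lm: "letter_map (W i) \<pi> \<in> measurable (m i) (model_space (W i))" for i
    using letter_map_measurable[OF \<pi>m, of "W i"] unfolding measurable_cong_sets[OF D(5) refl] .
  have pm: "?\<Pi> \<in> borel_measurable P"
    using letter_process_measurable[OF \<pi>m] unfolding measurable_cong_sets[OF prob_measuresD(2)[OF P] refl] .
  show models': "model_sequence W \<tau> ?m"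
    using D lm by (simp add: model_sequence_def model_measures_def prob_space.prob_space_distr)
  show P': "?P \<in> prob_measures"
    using prob_measuresD[OF P] pm by (simp add: prob_measures_def prob_space.prob_space_distr)
  show "quenched_converges W \<tau> ?m ?P"
    unfolding quenched_converges_iff[OF models' P']
  proof (intro allI impI)
    fix h :: "('g \<Rightarrow> 'd) \<Rightarrow> real" assume h: "bounded_continuous h"
    note hm = bounded_continuous_measurable[OF h]
    have cont: "continuous_on UNIV ?\<Pi>"
      by (intro continuous_on_coordinatewise_then_product continuous_on_compose2[OF \<pi>] continuous_on_product_coordinates) auto
    have "bounded_continuous (\<lambda>y. h (?\<Pi> y))"
      using h continuous_on_compose2[OF _ cont, of UNIV h] unfolding bounded_continuous_def
      by (auto elim: bounded_subset)
    then have lim: "local_limit W \<tau> m P (\<lambda>y. h (?\<Pi> y))" "empirical_limit W \<tau> m P (\<lambda>y. h (?\<Pi> y))"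
      using q unfolding quenched_converges_iff[OF models P] by blast+
    have mean: "(\<integral>y. h y \<partial>?P) = (\<integral>y. h (?\<Pi> y) \<partial>P)" by (rule integral_distr[OF pm hm])
    have pull: "pullback_name (\<tau> i) v (letter_map (W i) \<pi> x) = ?\<Pi> (pullback_name (\<tau> i) v x)" if "v \<in> W i" for i v x
      using that permutes_in_image[OF D(3)] by (auto simp: pullback_name_def letter_map_def)
    have hp: "(\<lambda>x. h (pullback_name (\<tau> i) v x)) \<in> borel_measurable (model_space (W i))" if "v \<in> W i" for i v
      using measurable_compose[OF pullback_name_measurable[OF D(3) that] hm] .
    have "(\<integral>x. h (pullback_name (\<tau> i) v x) \<partial>?m i) = (\<integral>x. h (?\<Pi> (pullback_name (\<tau> i) v x)) \<partial>m i)" if "v \<in> W i" for i v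
      using integral_distr[OF lm hp[OF that]] pull[OF that] by simp
    then have "local_limit W \<tau> ?m ?P h"
      using lim(1) unfolding local_limit_def mean by (simp cong: vavg_cong)
    moreover have "(\<integral>x. \<bar>vavg (W i) (\<lambda>v. h (pullback_name (\<tau> i) v x)) - c\<bar> \<partial>?m i) =
      (\<integral>x. \<bar>vavg (W i) (\<lambda>v. h (?\<Pi> (pullback_name (\<tau> i) v x))) - c\<bar> \<partial>m i)" for i c
    proof -
      have "(\<lambda>x. \<bar>vavg (W i) (\<lambda>v. h (pullback_name (\<tau> i) v x)) - c\<bar>) \<in> borel_measurable (model_space (W i))"
        unfolding vavg_def by (intro borel_measurable_abs borel_measurable_diff borel_measurable_divide borel_measurable_sum hp) auto
      from integral_distr[OF lm this] show ?thesis by (simp add: pull cong: vavg_cong)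
    qed
    then have "empirical_limit W \<tau> ?m ?P h"
      using lim(2) unfolding empirical_limit_def mean by simp
    ultimately show "local_limit W \<tau> ?m ?P h \<and> empirical_limit W \<tau> ?m ?P h" ..
  qed
qed

text \<open>Project the pairs to their first components.\<close>

lemma doubly_quenched_imp_quenched:
  fixes W :: "nat \<Rightarrow> 'v set" and \<tau> :: "nat \<Rightarrow> 'g::countable \<Rightarrow> 'v \<Rightarrow> 'v"
    and m :: "nat \<Rightarrow> ('v \<Rightarrow> 'c::second_countable_topology) measure"
  assumes models: "model_sequence W \<tau> m" and P: "P \<in> prob_measures"
    and "doubly_quenched_converges W \<tau> m P"
  shows "quenched_converges W \<tau> m P"
proof -
  have "continuous_on UNIV (fst :: 'c \<times> 'c \<Rightarrow> 'c)" by (intro continuous_intros)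
  from letter_map_quenched_converges(3)[OF pair_model_sequence[OF models] pair_process_in_prob_measures[OF P] this]
  show ?thesis
    using assms models by (simp add: doubly_quenched_converges_def letter_map_pair_model letter_pair_process model_sequence_def)
qed

lemma letter_map_doubly_quenched_converges:
  fixes W :: "nat \<Rightarrow> 'v set" and \<tau> :: "nat \<Rightarrow> 'g::countable \<Rightarrow> 'v \<Rightarrow> 'v"
    and m :: "nat \<Rightarrow> ('v \<Rightarrow> 'c::second_countable_topology) measure"
    and \<pi> :: "'c \<Rightarrow> 'd::second_countable_topology"
  assumes models: "model_sequence W \<tau> m" and P: "P \<in> prob_measures"
    and \<pi>: "continuous_on UNIV \<pi>" and dq: "doubly_quenched_converges W \<tau> m P"
  shows "doubly_quenched_converges W \<tau> (\<lambda>i. distr (m i) (model_space (W i)) (letter_map (W i) \<pi>))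
      (distr P borel (\<lambda>y g. \<pi> (y g)))"
proof -
  let ?\<pi>\<pi> = "map_prod \<pi> \<pi>"
  have cont: "continuous_on UNIV ?\<pi>\<pi>"
    unfolding map_prod_def case_prod_beta
    by (intro continuous_on_Pair continuous_on_compose2[OF \<pi>] continuous_on_fst continuous_on_snd continuous_on_id) auto
  have \<pi>m: "\<pi> \<in> borel_measurable borel" "?\<pi>\<pi> \<in> borel_measurable borel"
    using \<pi> cont by (auto intro: borel_measurable_continuous_onI)
  note D = model_sequenceD[OF models]
  have "pair_model (W i) (distr (m i) (model_space (W i)) (letter_map (W i) \<pi>)) =
    distr (pair_model (W i) (m i)) (model_space (W i)) (letter_map (W i) ?\<pi>\<pi>)" for i
  proof (rule pair_model_distr)
    show "m i \<in> model_measures (W i)" using models by (simp add: model_sequence_def)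
    show "letter_map (W i) \<pi> \<in> measurable (m i) (model_space (W i))"
      using letter_map_measurable[OF \<pi>m(1), of "W i"] unfolding measurable_cong_sets[OF D(5) refl] .
  qed (auto simp: letter_map_def intro!: letter_map_measurable[OF \<pi>m(2)])
  moreover have "pair_process (distr P borel (\<lambda>y g. \<pi> (y g))) = distr (pair_process P) borel (\<lambda>y g. ?\<pi>\<pi> (y g))"
    by (rule pair_process_distr[OF P]) (auto intro!: letter_process_measurable \<pi>m)
  ultimately show ?thesis
    using letter_map_quenched_converges(3)[OF pair_model_sequence[OF models] pair_process_in_prob_measures[OF P] cont] dq
    by (simp add: doubly_quenched_converges_def)
qed

section \<open>Coding pairs of models\<close>

definition pair_rule :: "(('g \<Rightarrow> 'c) \<Rightarrow> 'd) \<Rightarrow> ('g \<Rightarrow> 'c \<times> 'c) \<Rightarrow> 'd \<times> 'd"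
  where "pair_rule f z = (f (\<lambda>g. fst (z g)), f (\<lambda>g. snd (z g)))"

lemma dist_pair_rule_le:
  fixes a b :: "('g \<Rightarrow> 'c) \<Rightarrow> 'd::metric_space"
  shows "dist (pair_rule a z) (pair_rule b z) \<le>
    dist (a (\<lambda>g. fst (z g))) (b (\<lambda>g. fst (z g))) + dist (a (\<lambda>g. snd (z g))) (b (\<lambda>g. snd (z g)))"
  unfolding pair_rule_def dist_Pair_Pair by (rule sqrt_sum_squares_le_sum) auto

lemma unzip_measurable:
  "(\<lambda>(z :: 'g::countable \<Rightarrow> 'c::second_countable_topology \<times> 'c) g. fst (z g)) \<in> borel_measurable borel"
  "(\<lambda>(z :: 'g::countable \<Rightarrow> 'c::second_countable_topology \<times> 'c) g. snd (z g)) \<in> borel_measurable borel"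
  by (intro letter_process_measurable borel_measurable_continuous_onI continuous_intros)+

lemma unzip_random_variable:
  fixes R :: "('g::countable \<Rightarrow> 'c::second_countable_topology \<times> 'c) measure"
  assumes "R \<in> prob_measures"
  shows "(\<lambda>z g. fst (z g)) \<in> borel_measurable R" "(\<lambda>z g. snd (z g)) \<in> borel_measurable R"
  unfolding measurable_cong_sets[OF prob_measuresD(2)[OF assms] refl] by (rule unzip_measurable)+

lemma unzip_continuous:
  "continuous_on UNIV (\<lambda>(z :: 'g \<Rightarrow> 'c::topological_space \<times> 'c) g. fst (z g))"
  "continuous_on UNIV (\<lambda>(z :: 'g \<Rightarrow> 'c::topological_space \<times> 'c) g. snd (z g))"
  by (intro continuous_on_coordinatewise_then_product continuous_on_fst continuous_on_snd continuous_on_product_coordinates)+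

lemma pair_rule_measurable:
  fixes a :: "('g::countable \<Rightarrow> 'c::second_countable_topology) \<Rightarrow> 'd::second_countable_topology"
  assumes [measurable]: "a \<in> borel_measurable borel"
  shows "pair_rule a \<in> borel_measurable borel"
proof -
  note [measurable] = unzip_measurable
  have "(\<lambda>z. (a (\<lambda>g. fst (z g)), a (\<lambda>g. snd (z g)))) \<in> borel_measurable borel"
    by (intro borel_measurable_Pair) measurable
  then show ?thesis by (simp add: pair_rule_def[abs_def])
qed

lemma local_rule_pair_rule:
  fixes P :: "('g::countable \<Rightarrow> 'c::{metric_space,second_countable_topology}) measure"
    and f :: "('g \<Rightarrow> 'c) \<Rightarrow> 'd::second_countable_topology"
  assumes P: "P \<in> prob_measures" and f: "local_rule P f"
  shows "local_rule (pair_process P) (pair_rule f)"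
proof -
  obtain F where F: "finite F" "\<And>z z'. (\<forall>g\<in>F. z g = z' g) \<Longrightarrow> f z = f z'"
    using f unfolding local_rule_def by blast
  have fm: "f \<in> borel_measurable borel" using f by (simp add: local_rule_def)
  have "AE z in distr (pair_process P) borel (\<lambda>z g. fst (z g)). isCont f z"
    "AE z in distr (pair_process P) borel (\<lambda>z g. snd (z g)). isCont f z"
    unfolding letter_pair_process[OF P] using f by (simp_all add: local_rule_def)
  note ae = AE_distrD[OF unzip_random_variable(1)[OF pair_process_in_prob_measures[OF P]] this(1)]
    AE_distrD[OF unzip_random_variable(2)[OF pair_process_in_prob_measures[OF P]] this(2)]
  from ae have "AE z in pair_process P. isCont (pair_rule f) z"
  proof eventually_elim
    case (elim z)
    have "isCont (\<lambda>(z :: 'g \<Rightarrow> 'c \<times> 'c) g. fst (z g)) z" "isCont (\<lambda>(z :: 'g \<Rightarrow> 'c \<times> 'c) g. snd (z g)) z"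
      using unzip_continuous continuous_on_eq_continuous_at[OF open_UNIV] by blast+
    then have "isCont (\<lambda>z. f (\<lambda>g. fst (z g))) z" "isCont (\<lambda>z. f (\<lambda>g. snd (z g))) z"
      using elim isCont_o2[of z "\<lambda>(z :: 'g \<Rightarrow> 'c \<times> 'c) g. fst (z g)" f]
        isCont_o2[of z "\<lambda>(z :: 'g \<Rightarrow> 'c \<times> 'c) g. snd (z g)" f] by blast+
    then show ?case unfolding pair_rule_def by (intro continuous_Pair)
  qed
  moreover have "pair_rule f z = pair_rule f z'" if "\<forall>g\<in>F. z g = z' g" for z z'
    using F(2)[of "\<lambda>g. fst (z g)" "\<lambda>g. fst (z' g)"] F(2)[of "\<lambda>g. snd (z g)" "\<lambda>g. snd (z' g)"] that
    by (simp add: pair_rule_def)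
  ultimately show ?thesis
    unfolding local_rule_def using pair_rule_measurable[OF fm] F(1) by blast
qed

text \<open>The distance of two pairs is at most the sum of the distances of their components, and both
components are distributed like \<open>S\<close>, however they depend on each other.\<close>

lemma pair_rule_distance:
  fixes R :: "('g::countable \<Rightarrow> 'c::second_countable_topology \<times> 'c) measure"
    and a b :: "('g \<Rightarrow> 'c) \<Rightarrow> 'd::{metric_space,second_countable_topology}"
  assumes R: "R \<in> prob_measures"
    and marg: "distr R borel (\<lambda>z g. fst (z g)) = S" "distr R borel (\<lambda>z g. snd (z g)) = S"
    and [measurable]: "a \<in> borel_measurable borel" "b \<in> borel_measurable borel"
    and D: "\<And>x y::'d. dist x y \<le> D"
  shows "(\<integral>z. dist (pair_rule a z) (pair_rule b z) \<partial>R) \<le> 2 * (\<integral>z. dist (a z) (b z) \<partial>S)"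
proof -
  interpret prob_space R by (rule prob_measuresD[OF R])
  note unzip = unzip_random_variable[OF R]
  let ?d = "\<lambda>z. dist (a z) (b z)"
  have d: "?d \<in> borel_measurable borel" by measurable
  have eq: "(\<integral>z. ?d (\<lambda>g. fst (z g)) \<partial>R) = (\<integral>z. ?d z \<partial>S)" "(\<integral>z. ?d (\<lambda>g. snd (z g)) \<partial>R) = (\<integral>z. ?d z \<partial>S)"
    using integral_distr[OF unzip(1) d] integral_distr[OF unzip(2) d] by (simp_all add: marg)
  have I: "integrable R (\<lambda>z. ?d (\<lambda>g. fst (z g)))" "integrable R (\<lambda>z. ?d (\<lambda>g. snd (z g)))"
    by (rule integrable_bounded[of _ D], (rule measurable_compose[OF unzip(1) d] measurable_compose[OF unzip(2) d]), simp add: D)+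
  have "(\<integral>z. dist (pair_rule a z) (pair_rule b z) \<partial>R) \<le> (\<integral>z. ?d (\<lambda>g. fst (z g)) + ?d (\<lambda>g. snd (z g)) \<partial>R)"
    by (rule integral_mono') (use I dist_pair_rule_le in auto)
  also have "\<dots> = 2 * (\<integral>z. ?d z \<partial>S)" using I by (simp add: eq)
  finally show ?thesis .
qed

lemma pair_process_invariant:
  fixes P :: "('g::{group_add,countable} \<Rightarrow> 'c::second_countable_topology) measure"
  assumes "P \<in> prob_measures" "\<And>g. distr P borel (shift g) = P"
  shows "distr (pair_process P) borel (shift g) = pair_process P"
  using pair_process_distr[OF assms(1) shift_measurable shift_measurable, of g g] assms(2)
  by (simp add: shift_def)

context coding
begin

text \<open>All requirements on pairs are bounds on expected distances or almost sure statements, and both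
marginals of a pair are the original model or process; hence the same rules work, with twice the
error. The choice of rules made for single models thus also serves the doubly quenched setting.\<close>

lemma pair_coding:
  "coding W \<tau> (\<lambda>i. pair_model (W i) (m i)) (pair_process P) (pair_rule \<phi>) (\<lambda>l. pair_rule (f l)) (\<lambda>i. pair_rule (r i))"
proof (rule coding.intro)
  obtain D where D: "D > 0" "\<And>x y::'d. dist x y \<le> D" using bounded_dist_if_compact_UNIV[OF compact_alphabet] by blast
  show pair_models: "model_sequence W \<tau> (\<lambda>i. pair_model (W i) (m i))" by (rule pair_model_sequence[OF models])
  show "sofic_approximation W \<tau>" by (rule sofic)
  show PP: "pair_process P \<in> prob_measures" by (rule pair_process_in_prob_measures[OF P])
  show "distr (pair_process P) borel (shift g) = pair_process P" for g
    by (rule pair_process_invariant[OF P invariant])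
  show "compact (UNIV :: ('d \<times> 'd) set)" by (rule compact_UNIV_Times[OF compact_alphabet compact_alphabet])
  show "pair_rule \<phi> \<in> borel_measurable borel" "pair_rule (r i) \<in> borel_measurable borel" for i
    by (intro pair_rule_measurable \<phi>_measurable r_measurable)+
  show "local_rule (pair_process P) (pair_rule (f l))" for l by (rule local_rule_pair_rule[OF P rules])
  have le: "(\<integral>z. dist (pair_rule (f l) z) (pair_rule \<phi> z) \<partial>pair_process P) \<le> 2 * (\<integral>z. dist (f l z) (\<phi> z) \<partial>P)" for l
    by (rule pair_rule_distance[OF PP letter_pair_process[OF P] f_measurable \<phi>_measurable D(2)])
  show "(\<lambda>l. \<integral>z. dist (pair_rule (f l) z) (pair_rule \<phi> z) \<partial>pair_process P) \<longlonglongrightarrow> 0"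
  proof (rule tendsto_sandwich[OF _ _ tendsto_const])
    show "(\<lambda>l. 2 * (\<integral>z. dist (f l z) (\<phi> z) \<partial>P)) \<longlonglongrightarrow> 0" using tendsto_mult_left[OF rules_tendsto, of 2] by simp
  qed (use le in \<open>auto intro!: always_eventually\<close>)
  have le': "(\<integral>x. dist (pair_rule (r i) (pullback_name (\<tau> i) v x)) (pair_rule (f l) (pullback_name (\<tau> i) v x)) \<partial>pair_model (W i) (m i))
      \<le> 2 * (\<integral>x. dist (r i (pullback_name (\<tau> i) v x)) (f l (pullback_name (\<tau> i) v x)) \<partial>m i)" if v: "v \<in> W i" for i l v
  proof -
    let ?m = "pair_model (W i) (m i)" and ?pn = "\<lambda>x. pullback_name (\<tau> i) v x"
    have mi: "m i \<in> model_measures (W i)" using models by (simp add: model_sequence_def)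
    have pn: "?pn \<in> measurable (model_space (W i)) (borel :: ('g \<Rightarrow> 'c) measure)"
      by (rule pullback_name_measurable[OF model_sequenceD(3)[OF models] v])
    have pn2: "?pn \<in> borel_measurable ?m" by (rule pullback_name_measurable_model[OF pair_models v])
    have lm: "letter_map (W i) fst \<in> measurable ?m (model_space (W i))" "letter_map (W i) snd \<in> measurable ?m (model_space (W i))"
      unfolding measurable_cong_sets[OF model_sequenceD(5)[OF pair_models] refl]
      by (intro letter_map_measurable borel_measurable_continuous_onI continuous_intros)+
    have "(\<lambda>g. fst (?pn x g)) = ?pn (letter_map (W i) fst x)" "(\<lambda>g. snd (?pn x g)) = ?pn (letter_map (W i) snd x)"
      for x :: "'v \<Rightarrow> 'c \<times> 'c"
      using v permutes_in_image[OF model_sequenceD(3)[OF models]] by (auto simp: pullback_name_def letter_map_def)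
    then have marg: "distr (distr ?m borel ?pn) borel (\<lambda>z g. fst (z g)) = distr (m i) borel ?pn"
      "distr (distr ?m borel ?pn) borel (\<lambda>z g. snd (z g)) = distr (m i) borel ?pn"
      using distr_distr[OF unzip_measurable(1) pn2] distr_distr[OF unzip_measurable(2) pn2]
        distr_distr[OF pn lm(1)] distr_distr[OF pn lm(2)]
      by (simp_all add: o_def letter_map_pair_model[OF mi])
    have R: "distr ?m borel ?pn \<in> prob_measures"
      using model_sequenceD(4)[OF pair_models, of i] pn2 by (simp add: prob_measures_def prob_space.prob_space_distr)
    have "(\<integral>z. dist (pair_rule (r i) z) (pair_rule (f l) z) \<partial>distr ?m borel ?pn)
        \<le> 2 * (\<integral>z. dist (r i z) (f l z) \<partial>distr (m i) borel ?pn)"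
      by (rule pair_rule_distance[OF R marg r_measurable f_measurable D(2)])
    moreover have d1: "(\<lambda>z. dist (pair_rule (r i) z) (pair_rule (f l) z)) \<in> borel_measurable borel"
      by (intro borel_measurable_dist pair_rule_measurable r_measurable f_measurable)
    moreover have d2: "(\<lambda>z. dist (r i z) (f l z)) \<in> borel_measurable borel" by measurable
    ultimately show ?thesis
      using integral_distr[OF pn2 d1] integral_distr[OF pullback_name_measurable_model[OF models v] d2] by simp
  qed
  fix \<eta> :: real assume "\<eta> > 0"
  then obtain l0 where l0: "\<And>l. l \<ge> l0 \<Longrightarrow> \<forall>\<^sub>F i in sequentially.
      vavg (W i) (\<lambda>v. \<integral>x. dist (r i (pullback_name (\<tau> i) v x)) (f l (pullback_name (\<tau> i) v x)) \<partial>m i) < \<eta>/2"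
    using tracking[of "\<eta>/2"] by auto
  have "\<forall>\<^sub>F i in sequentially. vavg (W i) (\<lambda>v. \<integral>x. dist (pair_rule (r i) (pullback_name (\<tau> i) v x))
      (pair_rule (f l) (pullback_name (\<tau> i) v x)) \<partial>pair_model (W i) (m i)) < \<eta>" if "l \<ge> l0" for l
    using l0[OF that]
  proof eventually_elim
    case (elim i)
    have "vavg (W i) (\<lambda>v. \<integral>x. dist (pair_rule (r i) (pullback_name (\<tau> i) v x))
      (pair_rule (f l) (pullback_name (\<tau> i) v x)) \<partial>pair_model (W i) (m i))
      \<le> vavg (W i) (\<lambda>v. 2 * (\<integral>x. dist (r i (pullback_name (\<tau> i) v x)) (f l (pullback_name (\<tau> i) v x)) \<partial>m i))"
      by (rule vavg_mono[OF le'])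
    then show ?case using elim unfolding vavg_cmult by linarith
  qed
  then show "\<exists>l0. \<forall>l\<ge>l0. \<forall>\<^sub>F i in sequentially. vavg (W i) (\<lambda>v. \<integral>x. dist (pair_rule (r i) (pullback_name (\<tau> i) v x))
      (pair_rule (f l) (pullback_name (\<tau> i) v x)) \<partial>pair_model (W i) (m i)) < \<eta>" by blast
qed

theorem coded_doubly_quenched_converges:
  assumes "doubly_quenched_converges W \<tau> m P"
  shows "doubly_quenched_converges W \<tau> coded (distr P borel (stationary_code \<phi>))"
proof -
  interpret pair: coding W \<tau> "\<lambda>i. pair_model (W i) (m i)" "pair_process P" "pair_rule \<phi>" "\<lambda>l. pair_rule (f l)" "\<lambda>i. pair_rule (r i)"
    by (rule pair_coding)
  have "pair_model (W i) (coded i) = pair.coded i" for i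
    unfolding coded_def pair.coded_def
  proof (rule pair_model_distr)
    show "m i \<in> model_measures (W i)" using models by (simp add: model_sequence_def)
    show "code_map (W i) (\<tau> i) (r i) \<in> measurable (m i) (model_space (W i))"
      by (rule code_map_measurable[OF models r_measurable])
    show "code_map (W i) (\<tau> i) (pair_rule (r i)) \<in> measurable (model_space (W i)) (model_space (W i))"
      using code_map_measurable[OF pair.models pair.r_measurable, of i i]
      unfolding measurable_cong_sets[OF model_sequenceD(5)[OF pair.models] refl] .
    fix x y :: "'v \<Rightarrow> 'c"
    have "(\<lambda>g. fst (pullback_name (\<tau> i) v (\<lambda>v\<in>W i. (x v, y v)) g)) = pullback_name (\<tau> i) v x"
      "(\<lambda>g. snd (pullback_name (\<tau> i) v (\<lambda>v\<in>W i. (x v, y v)) g)) = pullback_name (\<tau> i) v y" if "v \<in> W i" for v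
      using that permutes_in_image[OF model_sequenceD(3)[OF models]] by (auto simp: pullback_name_def)
    then show "code_map (W i) (\<tau> i) (pair_rule (r i)) (\<lambda>v\<in>W i. (x v, y v)) =
      (\<lambda>v\<in>W i. (code_map (W i) (\<tau> i) (r i) x v, code_map (W i) (\<tau> i) (r i) y v))"
      by (auto simp: code_map_def pair_rule_def)
  qed
  moreover have "pair_process (distr P borel (stationary_code \<phi>)) = distr (pair_process P) borel (stationary_code (pair_rule \<phi>))"
    by (rule pair_process_distr[OF P stationary_code_measurable[OF \<phi>_measurable] stationary_code_measurable[OF pair.\<phi>_measurable]])
      (simp add: stationary_code_def pair_rule_def shift_def)
  ultimately show ?thesis
    using pair.coded_quenched_converges assms by (simp add: doubly_quenched_converges_def)
qed

end

section \<open>Covering numbers\<close>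

lemma hamming_dist_vavg: "hamming_dist V x y = vavg V (\<lambda>v. dist (x v) (y v))"
  by (simp add: hamming_dist_def vavg_def)

lemma hamming_ball_measurable:
  fixes m :: "('v \<Rightarrow> 'a::{metric_space,second_countable_topology}) measure"
  assumes m: "m \<in> model_measures V" and F: "finite F"
  shows "{y \<in> space m. \<exists>z\<in>F. hamming_dist V z y < \<delta>} \<in> sets m"
proof -
  have s: "sets m = sets (model_space V)" using m by (simp add: model_measures_def)
  have "(\<lambda>y. hamming_dist V z y) \<in> borel_measurable (model_space V)" for z :: "'v \<Rightarrow> 'a"
    unfolding hamming_dist_def
    by (intro borel_measurable_divide borel_measurable_sum borel_measurable_const borel_measurable_dist measurable_component_singleton)
  then have [measurable]: "(\<lambda>y. hamming_dist V z y) \<in> borel_measurable m" for z :: "'v \<Rightarrow> 'a"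
    unfolding measurable_cong_sets[OF s refl] .
  have "{y \<in> space m. \<exists>z\<in>F. hamming_dist V z y < \<delta>} = (\<Union>z\<in>F. {y \<in> space m. hamming_dist V z y < \<delta>})" by auto
  also have "\<dots> \<in> sets m" using F by (intro sets.finite_UN) (auto, measurable)
  finally show ?thesis .
qed

lemma finite_hamming_net:
  assumes C: "compact (UNIV :: 'a::metric_space set)" and V: "finite V" "V \<noteq> {}" and \<delta>: "\<delta> > 0"
 obtains F :: "('v \<Rightarrow> 'a::metric_space) set" where "finite F" "F \<subseteq> PiE V (\<lambda>_. UNIV)" "\<And>y. \<exists>z\<in>F. hamming_dist V z y < \<delta>"
proof -
  obtain K where K: "finite K" "(UNIV :: 'a set) \<subseteq> (\<Union>x\<in>K. ball x \<delta>)"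
    using C \<delta> unfolding compact_eq_totally_bounded by meson
  have "\<exists>z\<in>PiE V (\<lambda>_. K). hamming_dist V z y < \<delta>" for y
  proof -
    have "\<exists>x\<in>K. dist x (y v) < \<delta>" for v
    proof -
      have "y v \<in> (\<Union>x\<in>K. ball x \<delta>)" using K(2) by blast
      then show ?thesis by auto
    qed
    then obtain z where z: "\<And>v. z v \<in> K" "\<And>v. dist (z v) (y v) < \<delta>" by metis
    have "(\<Sum>v\<in>V. dist (z v) (y v)) < (\<Sum>v\<in>V. \<delta>)" using V z(2) by (intro sum_strict_mono) auto
    then have "hamming_dist V (restrict z V) y < \<delta>"
      using V by (simp add: hamming_dist_def field_simps card_gt_0_iff cong: sum.cong)
    moreover have "restrict z V \<in> PiE V (\<lambda>_. K)" using z by auto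
    ultimately show ?thesis by blast
  qed
  then show ?thesis using K V by (intro that[of "PiE V (\<lambda>_. K)"]) (auto intro: finite_PiE)
qed

lemma cov_attained:
  fixes m :: "('v \<Rightarrow> 'a::{metric_space,second_countable_topology}) measure"
  assumes C: "compact (UNIV :: 'a set)" and V: "finite V" "V \<noteq> {}" and m: "m \<in> model_measures V"
    and pos: "\<epsilon> > 0" "\<delta> > 0"
  obtains F where "finite F" "F \<subseteq> space m" "card F = cov \<epsilon> \<delta> m (hamming_dist V)"
    "measure m {y \<in> space m. \<exists>z\<in>F. hamming_dist V z y < \<delta>} > 1 - \<epsilon>"
proof -
  have m': "prob_space m" "sets m = sets (model_space V)" using m by (auto simp: model_measures_def)
  interpret prob_space m by fact
  have sp: "space m = PiE V (\<lambda>_. UNIV)" using sets_eq_imp_space_eq[OF m'(2)] by (simp add: space_PiM)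
  obtain F :: "('v \<Rightarrow> 'a) set" where F: "finite F" "F \<subseteq> PiE V (\<lambda>_. UNIV)" "\<And>y. \<exists>z\<in>F. hamming_dist V z y < \<delta>"
    using finite_hamming_net[OF C V pos(2)] by metis
  then have "{y \<in> space m. \<exists>z\<in>F. hamming_dist V z y < \<delta>} = space m" by auto
  then have "\<exists>k. \<exists>F. finite F \<and> F \<subseteq> space m \<and> card F = k \<and>
      measure m {y \<in> space m. \<exists>z\<in>F. hamming_dist V z y < \<delta>} > 1 - \<epsilon>"
    using F pos by (intro exI[of _ "card F"] exI[of _ F]) (simp add: sp[symmetric] prob_space)
  from LeastI_ex[OF this] show ?thesis using that unfolding cov_def by blast
qed

lemma cov_le_card:
  assumes "finite F" "F \<subseteq> space m" "measure m {y \<in> space m. \<exists>z\<in>F. d z y < \<delta>} > 1 - \<epsilon>"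
  shows "cov \<epsilon> \<delta> m d \<le> card F"
  unfolding cov_def using assms by (intro Least_le) blast

text \<open>Take nets for the two images and, for every pair of net points, one model of \<open>G\<close> near both, if there is
any. The chosen models form a net: any other model of \<open>G\<close> near the same pair has images within \<open>2 * \<delta>\<close> of
the images of the chosen one. Three exceptional sets of mass less than \<open>\<epsilon>\<close> are lost.\<close>

lemma cov_product_bound:
  fixes m :: "('v \<Rightarrow> 'c::{metric_space,second_countable_topology}) measure"
    and p :: "('v \<Rightarrow> 'c) \<Rightarrow> ('v \<Rightarrow> 'a::{metric_space,second_countable_topology})"
    and q :: "('v \<Rightarrow> 'c) \<Rightarrow> ('v \<Rightarrow> 'b::{metric_space,second_countable_topology})"
  assumes C: "compact (UNIV :: 'a set)" "compact (UNIV :: 'b set)" and V: "finite V" "V \<noteq> {}"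
    and m: "m \<in> model_measures V"
    and p: "p \<in> measurable m (model_space V)" and q: "q \<in> measurable m (model_space V)"
    and G: "G \<in> sets m" "measure m G > 1 - \<epsilon>" and pos: "\<epsilon> > 0" "\<delta> > 0" and \<epsilon>': "3 * \<epsilon> \<le> \<epsilon>'"
    and separated: "\<And>x x'. x \<in> G \<Longrightarrow> x' \<in> G \<Longrightarrow> hamming_dist V (p x) (p x') < 2 * \<delta> \<Longrightarrow>
      hamming_dist V (q x) (q x') < 2 * \<delta> \<Longrightarrow> hamming_dist V x x' < \<delta>'"
  shows "cov \<epsilon>' \<delta>' m (hamming_dist V) \<le>
    cov \<epsilon> \<delta> (distr m (model_space V) p) (hamming_dist V) * cov \<epsilon> \<delta> (distr m (model_space V) q) (hamming_dist V)"
proof -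
  let ?p = "distr m (model_space V) p" and ?q = "distr m (model_space V) q"
  have m': "prob_space m" "sets m = sets (model_space V)" using m by (auto simp: model_measures_def)
  interpret prob_space m by fact
  have pq: "?p \<in> model_measures V" "?q \<in> model_measures V"
    using p q by (auto simp: model_measures_def intro: prob_space_distr)
  obtain A where A: "finite A" "card A = cov \<epsilon> \<delta> ?p (hamming_dist V)"
    "measure ?p {y \<in> space ?p. \<exists>z\<in>A. hamming_dist V z y < \<delta>} > 1 - \<epsilon>"
    by (rule cov_attained[OF C(1) V pq(1) pos])
  obtain B where B: "finite B" "card B = cov \<epsilon> \<delta> ?q (hamming_dist V)"
    "measure ?q {y \<in> space ?q. \<exists>z\<in>B. hamming_dist V z y < \<delta>} > 1 - \<epsilon>"
    by (rule cov_attained[OF C(2) V pq(2) pos])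
  define S where "S = {x \<in> space m. \<exists>z\<in>A. hamming_dist V z (p x) < \<delta>}"
  define T where "T = {x \<in> space m. \<exists>z\<in>B. hamming_dist V z (q x) < \<delta>}"
  have "S = p -` {y \<in> space ?p. \<exists>z\<in>A. hamming_dist V z y < \<delta>} \<inter> space m"
    using measurable_space[OF p] by (auto simp: S_def)
  then have S: "S \<in> events" "prob S > 1 - \<epsilon>"
    using hamming_ball_measurable[OF pq(1) A(1), of \<delta>] A(3) p by (auto simp: measure_distr intro: measurable_sets)
  have "T = q -` {y \<in> space ?q. \<exists>z\<in>B. hamming_dist V z y < \<delta>} \<inter> space m"
    using measurable_space[OF q] by (auto simp: T_def)
  then have T: "T \<in> events" "prob T > 1 - \<epsilon>"
    using hamming_ball_measurable[OF pq(2) B(1), of \<delta>] B(3) q by (auto simp: measure_distr intro: measurable_sets)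
  define near where "near ab x \<longleftrightarrow> x \<in> G \<and> hamming_dist V (fst ab) (p x) < \<delta> \<and> hamming_dist V (snd ab) (q x) < \<delta>" for ab x
  define pick where "pick ab = (SOME x. near ab x)" for ab
  define F where "F = pick ` {ab \<in> A \<times> B. \<exists>x. near ab x}"
  have pick: "near ab (pick ab)" if "near ab x" for ab x unfolding pick_def using someI[of "near ab", OF that] .
  have F: "finite F" "F \<subseteq> space m" "card F \<le> card A * card B"
  proof -
    have fin: "finite {ab \<in> A \<times> B. \<exists>x. near ab x}" using A(1) B(1) by auto
    then show "finite F" by (simp add: F_def)
    show "F \<subseteq> space m" using pick sets.sets_into_space[OF G(1)] by (auto simp: F_def near_def)
    have "card F \<le> card {ab \<in> A \<times> B. \<exists>x. near ab x}" unfolding F_def using fin by (rule card_image_le)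
    also have "\<dots> \<le> card (A \<times> B)" using A(1) B(1) by (intro card_mono) auto
    finally show "card F \<le> card A * card B" by (simp add: card_cartesian_product)
  qed
  have tri: "hamming_dist V y y' \<le> hamming_dist V z y + hamming_dist V z y'" for y y' z :: "'v \<Rightarrow> 'd::metric_space"
    unfolding hamming_dist_vavg vavg_add[symmetric] by (rule vavg_mono) (simp add: dist_triangle3)
  have "G \<inter> S \<inter> T \<subseteq> {y \<in> space m. \<exists>z\<in>F. hamming_dist V z y < \<delta>'}"
  proof
    fix x assume x: "x \<in> G \<inter> S \<inter> T"
    then obtain a b where ab: "a \<in> A" "b \<in> B" "near (a, b) x" by (auto simp: S_def T_def near_def)
    let ?z = "pick (a, b)"
    have z: "near (a, b) ?z" by (rule pick[OF ab(3)])
    have "hamming_dist V (p ?z) (p x) < 2 * \<delta>" "hamming_dist V (q ?z) (q x) < 2 * \<delta>"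
      using z ab(3) tri[of "p ?z" "p x" a] tri[of "q ?z" "q x" b] by (auto simp: near_def)
    then have "hamming_dist V ?z x < \<delta>'" using z ab(3) by (intro separated) (auto simp: near_def)
    moreover have "?z \<in> F" unfolding F_def using ab by blast
    moreover have "x \<in> space m" using x sets.sets_into_space[OF G(1)] by auto
    ultimately show "x \<in> {y \<in> space m. \<exists>z\<in>F. hamming_dist V z y < \<delta>'}" by blast
  qed
  then have "prob (G \<inter> S \<inter> T) \<le> prob {y \<in> space m. \<exists>z\<in>F. hamming_dist V z y < \<delta>'}"
    by (rule finite_measure_mono[OF _ hamming_ball_measurable[OF m F(1)]])
  moreover have inter: "prob (X \<inter> Y) \<ge> prob X + prob Y - 1" if "X \<in> events" "Y \<in> events" for X Y
  proof -
    have "prob (X \<union> Y) = prob X + prob Y - prob (X \<inter> Y)"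
      by (rule measure_Un3) (use that in \<open>simp_all add: fmeasurable_eq_sets\<close>)
    moreover have "prob (X \<union> Y) \<le> 1" by simp
    ultimately show ?thesis by linarith
  qed
  have "prob (G \<inter> S) > 1 - 2 * \<epsilon>" using inter[OF G(1) S(1)] G(2) S(2) by linarith
  then have "prob (G \<inter> S \<inter> T) > 1 - 3 * \<epsilon>" using inter[of "G \<inter> S" T] G(1) S(1) T by auto
  ultimately have "prob {y \<in> space m. \<exists>z\<in>F. hamming_dist V z y < \<delta>'} > 1 - \<epsilon>'" using \<epsilon>' by linarith
  from cov_le_card[OF F(1,2) this] F(3) show ?thesis by (simp add: A(2) B(2))
qed

section \<open>Codes that separate models\<close>

lemma dist_le_net:
  fixes a b :: "'a::metric_space"
  assumes K: "finite K" "(UNIV :: 'a set) \<subseteq> (\<Union>c\<in>K. ball c \<rho>)"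
  shows "dist a b \<le> 2 * \<rho> + (\<Sum>c\<in>K. \<bar>dist c a - dist c b\<bar>)"
proof -
  have "a \<in> (\<Union>c\<in>K. ball c \<rho>)" using K(2) by blast
  then obtain c where c: "c \<in> K" "dist c a < \<rho>" by auto
  have "\<bar>dist c a - dist c b\<bar> \<le> (\<Sum>c\<in>K. \<bar>dist c a - dist c b\<bar>)"
    using c(1) K(1) by (intro member_le_sum) auto
  moreover have "dist a b \<le> dist c a + dist c b" by (rule dist_triangle3)
  ultimately show ?thesis using c(2) by linarith
qed

text \<open>The functions \<open>u c z = dist c (z 0)\<close> for \<open>c\<close> in a finite net \<open>K\<close> determine letters up to a small error, and
by \<open>\<psi>\<close> each of them is \<open>L\<^sup>1\<close>-close to a continuous function \<open>w c\<close> of the coded configuration. On models this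
persists in expectation, hence by Markov's inequality on a set \<open>G\<close> of large measure. Two models of
\<open>G\<close> with close codes have close values of all \<open>w c\<close>, so of all \<open>u c\<close>, so they are close themselves.\<close>

lemma codes_separate_models:
  fixes W :: "nat \<Rightarrow> 'v set" and \<tau> :: "nat \<Rightarrow> 'g::{group_add,countable} \<Rightarrow> 'v \<Rightarrow> 'v"
    and m :: "nat \<Rightarrow> ('v \<Rightarrow> 'c::{metric_space,second_countable_topology}) measure"
    and \<phi> :: "('g \<Rightarrow> 'c) \<Rightarrow> 'd::{complete_space,second_countable_topology}"
  assumes coding: "coding W \<tau> m P \<phi> f r" and q: "quenched_converges W \<tau> m P"
    and C: "compact (UNIV :: 'c set)"
    and \<psi> [measurable]: "\<psi> \<in> borel_measurable borel" and inverse: "AE z in P. \<psi> (stationary_code \<phi> z) = z 0"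
    and \<delta>': "\<delta>' > 0" and \<epsilon>: "\<epsilon> > 0"
  obtains \<delta> where "\<delta> > 0" "\<forall>\<^sub>F i in sequentially. \<exists>G\<in>sets (m i). measure (m i) G > 1 - \<epsilon> \<and>
    (\<forall>x\<in>G. \<forall>x'\<in>G. hamming_dist (W i) (code_map (W i) (\<tau> i) (r i) x) (code_map (W i) (\<tau> i) (r i) x') < 4 * \<delta> \<longrightarrow>
      hamming_dist (W i) x x' < \<delta>')"
proof -
  interpret coding W \<tau> m P \<phi> f r by (rule coding)
  define Q where "Q = distr P borel (stationary_code \<phi>)"
  have Q: "Q \<in> prob_measures" unfolding Q_def by (rule coded_process)
  interpret Q: prob_space Q by (rule prob_measuresD[OF Q])
  note Q_measurable = measurable_cong_sets[OF prob_measuresD(2)[OF Q] refl]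
  have sm: "stationary_code \<phi> \<in> borel_measurable P"
    using stationary_code_measurable[OF \<phi>_measurable] by (simp add: P_measurable)
  obtain B where B: "B > 0" "\<And>x y::'c. dist x y \<le> B" using bounded_dist_if_compact_UNIV[OF C] by blast
  have "\<forall>e>0. \<exists>K. finite K \<and> K \<subseteq> UNIV \<and> (UNIV :: 'c set) \<subseteq> (\<Union>c\<in>K. ball c e)"
    using C unfolding compact_eq_totally_bounded by blast
  then obtain K where K: "finite K" "(UNIV :: 'c set) \<subseteq> (\<Union>c\<in>K. ball c (\<delta>'/8))"
    using \<delta>' by (meson divide_pos_pos zero_less_numeral)
  \<comment> \<open>The constants leave \<open>\<delta>'/4\<close> for the net, \<open>3 \<delta>'/8\<close> for three errors \<open>t\<close> per net point and \<open>\<delta>'/4\<close> for the codes.\<close>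
  define t where "t = \<delta>' / (8 * (real (card K) + 1))"
  have t: "t > 0" "card K * t \<le> \<delta>'/8"
    using \<delta>' by (simp_all add: t_def field_simps)
  define \<theta> where "\<theta> = t * \<epsilon> / (real (card K) + 1)"
  have \<theta>: "\<theta> > 0" using t \<epsilon> by (simp add: \<theta>_def)
  define u where "u c z = dist c (z 0)" for c :: 'c and z :: "'g \<Rightarrow> 'c"
  have u: "bounded_continuous (u c)" for c
    unfolding bounded_continuous_def u_def using B(2)
    by (auto intro!: continuous_intros continuous_on_product_coordinates boundedI[of _ B])
  have "\<exists>w. bounded_continuous w \<and> (\<integral>z. \<bar>u c z - w (stationary_code \<phi> z)\<bar> \<partial>P) < \<theta>" for c
  proof -
    have s_meas: "(\<lambda>y. dist c (\<psi> y)) \<in> borel_measurable borel" by measurable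
    have "integrable Q (\<lambda>y. dist c (\<psi> y))"
      using s_meas B(2) by (intro Q.integrable_bounded[of _ B]) (simp_all add: Q_measurable)
    from bounded_continuous_dense_L1[OF Q this \<theta>] obtain w
      where w: "bounded_continuous w" "(\<integral>y. \<bar>dist c (\<psi> y) - w y\<bar> \<partial>Q) < \<theta>" by blast
    note wm = bounded_continuous_measurable[OF w(1)]
    have dm: "(\<lambda>y. \<bar>dist c (\<psi> y) - w y\<bar>) \<in> borel_measurable borel" using s_meas wm by measurable
    have "(\<integral>z. \<bar>u c z - w (stationary_code \<phi> z)\<bar> \<partial>P) = (\<integral>z. \<bar>dist c (\<psi> (stationary_code \<phi> z)) - w (stationary_code \<phi> z)\<bar> \<partial>P)"
    proof (rule integral_cong_AE)
      show "(\<lambda>z. \<bar>u c z - w (stationary_code \<phi> z)\<bar>) \<in> borel_measurable P"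
        using bounded_continuous_measurable[OF u] measurable_compose[OF sm wm] by (simp add: P_measurable)
      show "(\<lambda>z. \<bar>dist c (\<psi> (stationary_code \<phi> z)) - w (stationary_code \<phi> z)\<bar>) \<in> borel_measurable P"
        using measurable_compose[OF sm dm] .
      show "AE z in P. \<bar>u c z - w (stationary_code \<phi> z)\<bar> = \<bar>dist c (\<psi> (stationary_code \<phi> z)) - w (stationary_code \<phi> z)\<bar>"
        using inverse by eventually_elim (simp add: u_def)
    qed
    also have "\<dots> = (\<integral>y. \<bar>dist c (\<psi> y) - w y\<bar> \<partial>Q)"
      unfolding Q_def by (rule integral_distr[OF sm dm, symmetric])
    finally show ?thesis using w by auto
  qed
  then obtain w where w: "\<And>c. bounded_continuous (w c)"
    "\<And>c. (\<integral>z. \<bar>u c z - w c (stationary_code \<phi> z)\<bar> \<partial>P) < \<theta>" by metis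
  have "\<exists>F C. finite F \<and> C \<ge> 0 \<and> (\<forall>y y'. \<bar>w c y - w c y'\<bar> \<le> t + C * (\<Sum>g\<in>F. dist (y g) (y' g)))" for c
    using bounded_continuous_modulus[OF compact_alphabet w(1) t(1)] by metis
  then obtain F L where F: "\<And>c. finite (F c)" "\<And>c. L c \<ge> 0"
    "\<And>c y y'. \<bar>w c y - w c y'\<bar> \<le> t + L c * (\<Sum>g\<in>F c. dist (y g) (y' g))" by metis
  define Lip where "Lip = (\<Sum>c\<in>K. L c * real (card (F c)))"
  have Lip: "Lip \<ge> 0" unfolding Lip_def using F(2) by (intro sum_nonneg) auto
  define \<delta> where "\<delta> = \<delta>' / (16 * (Lip + 1))"
  have \<delta>: "\<delta> > 0" "Lip * (4 * \<delta>) \<le> \<delta>'/4"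
    using \<delta>' Lip by (simp_all add: \<delta>_def field_simps add_pos_nonneg)
  let ?c = "\<lambda>i. code_map (W i) (\<tau> i) (r i)"
  let ?pn = "\<lambda>i. pullback_name (\<tau> i)"
  have "\<forall>\<^sub>F i in sequentially. \<forall>c\<in>K. vavg (W i) (\<lambda>v. \<integral>x. \<bar>u c (?pn i v x) - w c (?pn i v (?c i x))\<bar> \<partial>m i) < \<theta>"
    by (intro eventually_ball_finite[OF K(1)] ballI decoding[OF q w(1) u w(2)])
  then have "\<forall>\<^sub>F i in sequentially. \<exists>G\<in>sets (m i). measure (m i) G > 1 - \<epsilon> \<and>
    (\<forall>x\<in>G. \<forall>x'\<in>G. hamming_dist (W i) (?c i x) (?c i x') < 4 * \<delta> \<longrightarrow> hamming_dist (W i) x x' < \<delta>')"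
  proof eventually_elim
    case (elim i)
    interpret prob_space "m i" by (rule model_sequenceD(4)[OF models])
    define a where "a c v x = \<bar>u c (?pn i v x) - w c (?pn i v (?c i x))\<bar>" for c v x
    define A where "A c x = vavg (W i) (\<lambda>v. a c v x)" for c x
    have a_int: "integrable (m i) (a c v)" if "v \<in> W i" for c v
      unfolding a_def
      by (intro integrable_abs Bochner_Integration.integrable_diff pushed_integrable[OF w(1) that]
          model_integrable[OF bounded_continuous_measurable[OF u] _ that, of _ B]) (simp add: u_def B)
    have A_int: "integrable (m i) (A c)" for c
      unfolding A_def vavg_def by (intro integrable_divide Bochner_Integration.integrable_sum a_int)
    note [measurable] = borel_measurable_integrable[OF A_int]
    have A_nonneg: "A c x \<ge> 0" for c x unfolding A_def a_def by (rule vavg_nonneg) simp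
    have A_small: "(\<integral>x. A c x \<partial>m i) < \<theta>" if "c \<in> K" for c
    proof -
      have "(\<integral>x. A c x \<partial>m i) = vavg (W i) (\<lambda>v. \<integral>x. a c v x \<partial>m i)"
        unfolding A_def vavg_def by (simp add: Bochner_Integration.integral_sum a_int)
      then show ?thesis using elim that by (simp add: a_def)
    qed
    define bad where "bad c = {x \<in> space (m i). A c x \<ge> t}" for c
    have bad_meas: "bad c \<in> events" for c unfolding bad_def by measurable
    have bad_small: "prob (bad c) \<le> \<theta> / t" if "c \<in> K" for c
    proof -
      have "prob (bad c) \<le> (\<integral>x. A c x \<partial>m i) / t"
        using integral_Markov_inequality_measure[OF A_int[of c], of "space (m i)" t] t A_nonneg by (simp add: bad_def)
      also have "\<dots> \<le> \<theta> / t" using A_small[OF that] t by (intro divide_right_mono) auto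
      finally show ?thesis .
    qed
    define G where "G = space (m i) - (\<Union>c\<in>K. bad c)"
    have U: "(\<Union>c\<in>K. bad c) \<in> events" using K(1) bad_meas by (intro sets.finite_UN) auto
    have "prob (\<Union>c\<in>K. bad c) \<le> (\<Sum>c\<in>K. prob (bad c))"
      using K(1) bad_meas by (intro finite_measure_subadditive_finite) auto
    also have "\<dots> \<le> (\<Sum>c\<in>K. \<theta> / t)" by (intro sum_mono bad_small)
    also have "\<dots> = card K * \<epsilon> / (card K + 1)" using t by (simp add: \<theta>_def)
    also have "\<dots> < \<epsilon>" using \<epsilon> by (simp add: field_simps)
    finally have "prob G > 1 - \<epsilon>" unfolding G_def using prob_compl[OF U] by simp
    moreover have "G \<in> events" unfolding G_def using U by auto
    moreover have "hamming_dist (W i) x x' < \<delta>'"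
      if G: "x \<in> G" "x' \<in> G" and close: "hamming_dist (W i) (?c i x) (?c i x') < 4 * \<delta>" for x x'
    proof -
      let ?y = "?c i x" and ?y' = "?c i x'"
      let ?H = "hamming_dist (W i) ?y ?y'"
      have A: "A c x < t" "A c x' < t" if "c \<in> K" for c
        using G that by (auto simp: G_def bad_def not_le)
      \<comment> \<open>The permutation \<open>\<tau> i 0\<close> need not be the identity, but averages do not notice it.\<close>
      have "hamming_dist (W i) x x' = vavg (W i) (\<lambda>v. dist (x (\<tau> i 0 v)) (x' (\<tau> i 0 v)))"
        unfolding hamming_dist_vavg
        using vavg_permutes[OF model_sequenceD(3)[OF models, of i 0], of "\<lambda>v. dist (x v) (x' v)"] by simp
      also have "\<dots> \<le> vavg (W i) (\<lambda>v. \<delta>'/4 + (\<Sum>c\<in>K. a c v x + a c v x' + t + L c * (\<Sum>g\<in>F c. dist (?y (\<tau> i g v)) (?y' (\<tau> i g v)))))"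
      proof (rule vavg_mono)
        fix v
        have "\<bar>u c (?pn i v x) - u c (?pn i v x')\<bar> \<le> a c v x + a c v x' + t + L c * (\<Sum>g\<in>F c. dist (?y (\<tau> i g v)) (?y' (\<tau> i g v)))" for c
          using F(3)[of c "?pn i v ?y" "?pn i v ?y'"] unfolding a_def pullback_name_def[of "\<tau> i" v ?y] pullback_name_def[of "\<tau> i" v ?y']
          by linarith
        then have "(\<Sum>c\<in>K. \<bar>u c (?pn i v x) - u c (?pn i v x')\<bar>)
          \<le> (\<Sum>c\<in>K. a c v x + a c v x' + t + L c * (\<Sum>g\<in>F c. dist (?y (\<tau> i g v)) (?y' (\<tau> i g v))))" by (intro sum_mono)
        moreover have "dist (x (\<tau> i 0 v)) (x' (\<tau> i 0 v)) \<le> 2 * (\<delta>'/8) + (\<Sum>c\<in>K. \<bar>u c (?pn i v x) - u c (?pn i v x')\<bar>)"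
          using dist_le_net[OF K] by (simp add: u_def pullback_name_def)
        ultimately show "dist (x (\<tau> i 0 v)) (x' (\<tau> i 0 v)) \<le>
          \<delta>'/4 + (\<Sum>c\<in>K. a c v x + a c v x' + t + L c * (\<Sum>g\<in>F c. dist (?y (\<tau> i g v)) (?y' (\<tau> i g v))))" by linarith
      qed
      also have "\<dots> = \<delta>'/4 + (\<Sum>c\<in>K. A c x + A c x' + t + L c * (\<Sum>g\<in>F c. vavg (W i) (\<lambda>v. dist (?y (\<tau> i g v)) (?y' (\<tau> i g v)))))"
        unfolding vavg_add vavg_sum vavg_cmult vavg_const[OF model_sequenceD(7)[OF models]] A_def ..
      also have "\<dots> = \<delta>'/4 + (\<Sum>c\<in>K. A c x + A c x' + t + L c * real (card (F c)) * ?H)"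
        using vavg_permutes[OF model_sequenceD(3)[OF models, of i], of "\<lambda>v. dist (?y v) (?y' v)"]
        by (simp add: hamming_dist_vavg mult.assoc)
      also have "\<dots> \<le> \<delta>'/4 + (\<Sum>c\<in>K. 3 * t + L c * real (card (F c)) * ?H)"
        using A by (intro add_left_mono sum_mono) (smt (verit))
      also have "\<dots> = \<delta>'/4 + 3 * (card K * t) + Lip * ?H"
        by (simp add: sum.distrib Lip_def sum_distrib_right)
      also have "\<dots> \<le> \<delta>'/4 + 3 * (\<delta>'/8) + Lip * (4 * \<delta>)"
        using t(2) mult_left_mono[OF less_imp_le[OF close] Lip] by linarith
      also have "\<dots> < \<delta>'" using \<delta>(2) \<delta>' by linarith
      finally show ?thesis .
    qed
    ultimately show ?case by blast
  qed
  with \<delta>(1) show ?thesis by (rule that)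
qed

section \<open>Models of a joining\<close>

lemma log_nat_mono: "a \<le> b \<Longrightarrow> log_nat a \<le> log_nat b"
  by (auto simp: log_nat_def)

lemma log_nat_mult_le: "log_nat (a * b) \<le> log_nat a + log_nat b"
  by (auto simp: log_nat_def ln_mult)

lemma rate_mult_le:
  "ereal (1 / real n) * log_nat (a * b) \<le> ereal (1 / real n) * log_nat a + ereal (1 / real n) * log_nat b"
proof -
  have "ereal (1 / real n) * log_nat (a * b) \<le> ereal (1 / real n) * (log_nat a + log_nat b)"
    by (intro ereal_mult_left_mono log_nat_mult_le) simp
  also have "\<dots> = ereal (1 / real n) * log_nat a + ereal (1 / real n) * log_nat b"
    using distrib_left_ereal_nn[of "1 / real n" "log_nat a" "log_nat b"] by (simp add: mult.commute)
  finally show ?thesis .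
qed

text \<open>A set of mass more than \<open>1/2\<close> cannot be covered by an empty net.\<close>

lemma cov_rate_nonneg:
  fixes m :: "nat \<Rightarrow> ('v \<Rightarrow> 'a::{metric_space,second_countable_topology}) measure"
  assumes models: "model_sequence W \<tau> m" and C: "compact (UNIV :: 'a set)"
  shows "cov_rate W m \<ge> 0"
proof -
  have "0 \<le> ereal (1 / real (card (W i))) * log_nat (cov (1/2) 1 (m i) (hamming_dist (W i)))" for i
  proof -
    have "m i \<in> model_measures (W i)" using models by (simp add: model_sequence_def)
    then obtain F where F: "finite F" "card F = cov (1/2) 1 (m i) (hamming_dist (W i))"
      "measure (m i) {y \<in> space (m i). \<exists>z\<in>F. hamming_dist (W i) z y < 1} > 1 - 1/2"
      by (rule cov_attained[OF C model_sequenceD(1,2)[OF models], where \<epsilon>="1/2" and \<delta>=1]) auto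
    from F(3) have "F \<noteq> {}" by auto
    then have "cov (1/2) 1 (m i) (hamming_dist (W i)) \<noteq> 0" using F(1,2) by (metis card_eq_0_iff)
    then show ?thesis by (simp add: log_nat_def)
  qed
  then have "0 \<le> limsup (\<lambda>i. ereal (1 / real (card (W i))) * log_nat (cov (1/2) 1 (m i) (hamming_dist (W i))))"
    by (intro le_Limsup) auto
  also have "\<dots> \<le> cov_rate W m"
    unfolding cov_rate_def by (rule SUP_upper2[of 1], simp, rule SUP_upper2[of "1/2"]) auto
  finally show ?thesis .
qed

definition growth_rate :: "(nat \<Rightarrow> 'v set) \<Rightarrow> (nat \<Rightarrow> ('v \<Rightarrow> 'a::metric_space) measure) \<Rightarrow> real \<Rightarrow> real \<Rightarrow> nat \<Rightarrow> ereal"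
  where "growth_rate W m \<delta> \<epsilon> i = ereal (1 / real (card (W i))) * log_nat (cov \<epsilon> \<delta> (m i) (hamming_dist (W i)))"

lemma limsup_growth_rate_le:
  assumes "\<delta> > 0" "\<epsilon> > 0"
  shows "limsup (growth_rate W m \<delta> \<epsilon>) \<le> cov_rate W m"
  unfolding cov_rate_def growth_rate_def[abs_def]
  by (rule SUP_upper2[of \<delta>], simp add: assms, rule SUP_upper2[of \<epsilon>]) (simp_all add: assms)

text \<open>The rules for \<open>\<alpha>\<close> and \<open>\<beta>\<close> are chosen together, as one coding into the product alphabet, since it is
from both that the inverse \<open>\<psi>\<close> recovers the process. The two codes are then read off by the coordinate projections, and closeness of
both gives closeness in the product.\<close>

theorem joint_models:
  fixes W :: "nat \<Rightarrow> 'v set" and \<tau> :: "nat \<Rightarrow> 'g::{group_add,countable} \<Rightarrow> 'v \<Rightarrow> 'v"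
    and m :: "nat \<Rightarrow> ('v \<Rightarrow> 'c::polish_space) measure" and P :: "('g \<Rightarrow> 'c) measure"
    and \<alpha> :: "('g \<Rightarrow> 'c) \<Rightarrow> 'a::polish_space" and \<beta> :: "('g \<Rightarrow> 'c) \<Rightarrow> 'b::polish_space"
  assumes models: "model_sequence W \<tau> m" and sofic: "sofic_approximation W \<tau>"
    and P: "metric_process P" and compact: "compact (UNIV :: 'a set)" "compact (UNIV :: 'b set)"
    and \<alpha> [measurable]: "\<alpha> \<in> borel_measurable borel" and \<beta> [measurable]: "\<beta> \<in> borel_measurable borel"
    and \<psi>: "\<psi> \<in> borel_measurable borel"
    and inverse: "AE z in P. \<psi> (\<lambda>g. (stationary_code \<alpha> z g, stationary_code \<beta> z g)) = z 0"
    and q: "quenched_converges W \<tau> m P"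
  obtains m1 m2 where "model_sequence W \<tau> m1" "model_sequence W \<tau> m2"
    "quenched_converges W \<tau> m1 (distr P borel (stationary_code \<alpha>))"
    "quenched_converges W \<tau> m2 (distr P borel (stationary_code \<beta>))"
    "doubly_quenched_converges W \<tau> m P \<Longrightarrow> doubly_quenched_converges W \<tau> m1 (distr P borel (stationary_code \<alpha>))"
    "doubly_quenched_converges W \<tau> m P \<Longrightarrow> doubly_quenched_converges W \<tau> m2 (distr P borel (stationary_code \<beta>))"
    "cov_rate W m \<le> cov_rate W m1 + cov_rate W m2"
proof -
  have P': "P \<in> prob_measures" "\<And>g. distr P borel (shift g) = P" and C: "compact (UNIV :: 'c set)"
    using P by (auto simp: metric_process_def prob_measures_def)
  define \<phi> where "\<phi> z = (\<alpha> z, \<beta> z)" for z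
  have \<phi>: "\<phi> \<in> borel_measurable borel" unfolding \<phi>_def by (intro borel_measurable_Pair \<alpha> \<beta>)
  have inv: "AE z in P. \<psi> (stationary_code \<phi> z) = z 0"
    using inverse by (simp add: stationary_code_def \<phi>_def)
  obtain f \<kappa> where coding: "coding W \<tau> m P \<phi> f (\<lambda>i. f (\<kappa> i :: nat))"
    by (rule exists_coding[OF models sofic P' C compact_UNIV_Times[OF compact] \<phi> q])
  interpret coding W \<tau> m P \<phi> f "\<lambda>i. f (\<kappa> i)" by (rule coding)
  let ?c = "\<lambda>i. code_map (W i) (\<tau> i) (f (\<kappa> i))"
  let ?Q = "distr P borel (stationary_code \<phi>)"
  define m1 where "m1 i = distr (coded i) (model_space (W i)) (letter_map (W i) fst)" for i
  define m2 where "m2 i = distr (coded i) (model_space (W i)) (letter_map (W i) snd)" for i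
  have cont: "continuous_on UNIV (fst :: 'a \<times> 'b \<Rightarrow> 'a)" "continuous_on UNIV (snd :: 'a \<times> 'b \<Rightarrow> 'b)"
    by (intro continuous_intros)+
  note meas = cont[THEN borel_measurable_continuous_onI]
  note q' = coded_quenched_converges[OF q]
  have sc: "stationary_code \<phi> \<in> borel_measurable P"
    using stationary_code_measurable[OF \<phi>] by (simp add: P_measurable)
  have marg: "distr ?Q borel (\<lambda>y g. fst (y g)) = distr P borel (stationary_code \<alpha>)"
    "distr ?Q borel (\<lambda>y g. snd (y g)) = distr P borel (stationary_code \<beta>)"
    using distr_distr[OF letter_process_measurable[OF meas(1)] sc] distr_distr[OF letter_process_measurable[OF meas(2)] sc]
    by (simp_all add: o_def stationary_code_def[abs_def] \<phi>_def)
  have cm: "?c i \<in> measurable (m i) (model_space (W i))" for i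
    by (rule code_map_measurable[OF models r_measurable])
  note lm = meas[THEN letter_map_measurable]
  have m1: "m1 i = distr (m i) (model_space (W i)) (letter_map (W i) fst \<circ> ?c i)" for i
    unfolding m1_def coded_def by (rule distr_distr[OF lm(1) cm])
  have m2: "m2 i = distr (m i) (model_space (W i)) (letter_map (W i) snd \<circ> ?c i)" for i
    unfolding m2_def coded_def by (rule distr_distr[OF lm(2) cm])
  show ?thesis
  proof (rule that[of m1 m2])
    show "model_sequence W \<tau> m1" "model_sequence W \<tau> m2"
      unfolding m1_def[abs_def] m2_def[abs_def]
      using letter_map_quenched_converges(1)[OF coded_models coded_process _ q'] cont by blast+
    show "quenched_converges W \<tau> m1 (distr P borel (stationary_code \<alpha>))"
      using letter_map_quenched_converges(3)[OF coded_models coded_process cont(1) q'] by (simp add: m1_def[abs_def] marg)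
    show "quenched_converges W \<tau> m2 (distr P borel (stationary_code \<beta>))"
      using letter_map_quenched_converges(3)[OF coded_models coded_process cont(2) q'] by (simp add: m2_def[abs_def] marg)
    {
      assume "doubly_quenched_converges W \<tau> m P"
      note dq = coded_doubly_quenched_converges[OF this]
      show "doubly_quenched_converges W \<tau> m1 (distr P borel (stationary_code \<alpha>))"
        using letter_map_doubly_quenched_converges[OF coded_models coded_process cont(1) dq] by (simp add: m1_def[abs_def] marg)
      show "doubly_quenched_converges W \<tau> m2 (distr P borel (stationary_code \<beta>))"
        using letter_map_doubly_quenched_converges[OF coded_models coded_process cont(2) dq] by (simp add: m2_def[abs_def] marg)
    }
    show "cov_rate W m \<le> cov_rate W m1 + cov_rate W m2"
      unfolding cov_rate_def[of W m]
    proof (intro SUP_least)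
      fix \<delta>' \<epsilon> :: real assume "\<delta>' \<in> {0<..}" "\<epsilon> \<in> {0<..}"
      then have pos: "\<delta>' > 0" "\<epsilon> / 3 > 0" by auto
      obtain \<delta> where \<delta>: "\<delta> > 0" and G: "\<forall>\<^sub>F i in sequentially. \<exists>G\<in>sets (m i). measure (m i) G > 1 - \<epsilon>/3 \<and>
        (\<forall>x\<in>G. \<forall>x'\<in>G. hamming_dist (W i) (?c i x) (?c i x') < 4 * \<delta> \<longrightarrow> hamming_dist (W i) x x' < \<delta>')"
        by (rule codes_separate_models[OF coding q C \<psi> inv pos])
      from G have "\<forall>\<^sub>F i in sequentially. growth_rate W m \<delta>' \<epsilon> i \<le> growth_rate W m1 \<delta> (\<epsilon>/3) i + growth_rate W m2 \<delta> (\<epsilon>/3) i"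
      proof eventually_elim
        case (elim i)
        then obtain G where G: "G \<in> sets (m i)" "measure (m i) G > 1 - \<epsilon>/3"
          and sep: "\<And>x x'. x \<in> G \<Longrightarrow> x' \<in> G \<Longrightarrow> hamming_dist (W i) (?c i x) (?c i x') < 4 * \<delta> \<Longrightarrow> hamming_dist (W i) x x' < \<delta>'"
          by blast
        have split: "hamming_dist (W i) y y' \<le> hamming_dist (W i) (letter_map (W i) fst y) (letter_map (W i) fst y') +
          hamming_dist (W i) (letter_map (W i) snd y) (letter_map (W i) snd y')" for y y' :: "'v \<Rightarrow> 'a \<times> 'b"
          unfolding hamming_dist_vavg vavg_add[symmetric]
        proof (rule vavg_mono)
          fix v assume "v \<in> W i"
          then show "dist (y v) (y' v) \<le> dist (letter_map (W i) fst y v) (letter_map (W i) fst y' v) +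
            dist (letter_map (W i) snd y v) (letter_map (W i) snd y' v)"
            unfolding dist_prod_def letter_map_def by simp (rule sqrt_sum_squares_le_sum; simp)
        qed
        have "cov \<epsilon> \<delta>' (m i) (hamming_dist (W i)) \<le>
          cov (\<epsilon>/3) \<delta> (m1 i) (hamming_dist (W i)) * cov (\<epsilon>/3) \<delta> (m2 i) (hamming_dist (W i))"
          unfolding m1 m2
        proof (rule cov_product_bound[OF compact model_sequenceD(1,2)[OF models] _ _ _ G pos(2) \<delta>])
          show "m i \<in> model_measures (W i)" using models by (simp add: model_sequence_def)
          show "letter_map (W i) fst \<circ> ?c i \<in> measurable (m i) (model_space (W i))"
            "letter_map (W i) snd \<circ> ?c i \<in> measurable (m i) (model_space (W i))"
            by (rule measurable_comp[OF cm lm(1)], rule measurable_comp[OF cm lm(2)])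
          fix x x' assume x: "x \<in> G" "x' \<in> G"
            and close: "hamming_dist (W i) ((letter_map (W i) fst \<circ> ?c i) x) ((letter_map (W i) fst \<circ> ?c i) x') < 2 * \<delta>"
              "hamming_dist (W i) ((letter_map (W i) snd \<circ> ?c i) x) ((letter_map (W i) snd \<circ> ?c i) x') < 2 * \<delta>"
          show "hamming_dist (W i) x x' < \<delta>'"
            using close split[of "?c i x" "?c i x'"] by (intro sep[OF x]) simp
        qed simp
        then have "growth_rate W m \<delta>' \<epsilon> i \<le> ereal (1 / real (card (W i))) *
          log_nat (cov (\<epsilon>/3) \<delta> (m1 i) (hamming_dist (W i)) * cov (\<epsilon>/3) \<delta> (m2 i) (hamming_dist (W i)))"
          unfolding growth_rate_def by (intro ereal_mult_left_mono log_nat_mono) auto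
        also have "\<dots> \<le> growth_rate W m1 \<delta> (\<epsilon>/3) i + growth_rate W m2 \<delta> (\<epsilon>/3) i"
          unfolding growth_rate_def by (rule rate_mult_le)
        finally show ?case .
      qed
      then have "limsup (growth_rate W m \<delta>' \<epsilon>) \<le> limsup (\<lambda>i. growth_rate W m1 \<delta> (\<epsilon>/3) i + growth_rate W m2 \<delta> (\<epsilon>/3) i)"
        by (rule Limsup_mono)
      also have "\<dots> \<le> limsup (growth_rate W m1 \<delta> (\<epsilon>/3)) + limsup (growth_rate W m2 \<delta> (\<epsilon>/3))" by (rule ereal_limsup_add_mono)
      also have "\<dots> \<le> cov_rate W m1 + cov_rate W m2" 
        by (intro add_mono limsup_growth_rate_le \<delta> pos(2))
      finally show "limsup (\<lambda>i. ereal (1 / real (card (W i))) * log_nat (cov \<epsilon> \<delta>' (m i) (hamming_dist (W i)))) \<le>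
        cov_rate W m1 + cov_rate W m2" by (simp add: growth_rate_def[abs_def])
    qed
  qed
qed

section \<open>Joinings\<close>

lemma inverse_equivariant:
  assumes \<phi>: "\<phi> \<in> measurable L P" and \<psi>: "\<psi> \<in> measurable P L" and push: "distr P L \<psi> = L"
    and R: "R \<in> measurable L L" "distr L L R = L"
    and inv: "AE x in L. \<psi> (\<phi> x) = x" "AE y in P. \<phi> (\<psi> y) = y"
    and equivariant: "AE x in L. \<phi> (R x) = S (\<phi> x)"
  shows "AE y in P. \<psi> (S y) = R (\<psi> y)"
proof -
  have pull: "AE y in P. Q (\<psi> y)" if Q: "AE x in L. Q x" for Q
    by (rule AE_distrD[OF \<psi>]) (unfold push, rule Q)
  have "AE x in L. \<psi> (\<phi> (R x)) = R x"
    by (rule AE_distrD[OF R(1), where P="\<lambda>x. \<psi> (\<phi> x) = x"]) (unfold R(2), rule inv(1))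
  from pull[OF this] pull[OF equivariant] inv(2) show ?thesis
    by eventually_elim simp
qed

text \<open>By equivariance a factor map into a process is the stationary code of its coordinate at the identity.\<close>

lemma factor_of_joining:
  fixes Q :: "('g::{group_add,countable} \<Rightarrow> 'a::polish_space) measure" and P :: "('g \<Rightarrow> 'c::polish_space) measure"
  assumes P: "metric_process P" and Q: "metric_process Q"
    and \<pi>: "\<pi> \<in> measurable P M" "distr P M \<pi> = M"
    and equivariant: "\<And>g. AE z in P. \<pi> (shift g z) = T g (\<pi> z)"
    and \<phi>: "\<phi> \<in> measurable M Q" "distr M Q \<phi> = Q" "\<And>g. AE x in M. \<phi> (T g x) = shift g (\<phi> x)"
  shows "(\<lambda>z. \<phi> (\<pi> z) 0) \<in> borel_measurable borel"
    and "AE z in P. stationary_code (\<lambda>z. \<phi> (\<pi> z) 0) z = \<phi> (\<pi> z)"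
    and "distr P borel (stationary_code (\<lambda>z. \<phi> (\<pi> z) 0)) = Q"
proof -
  have sP: "sets P = sets borel" and sQ: "sets Q = sets borel" using P Q by (auto simp: metric_process_def)
  have \<phi>': "\<phi> \<in> borel_measurable M" using \<phi>(1) unfolding measurable_cong_sets[OF refl sQ] .
  have \<phi>\<pi>: "(\<lambda>z. \<phi> (\<pi> z)) \<in> borel_measurable P" by (rule measurable_compose[OF \<pi>(1) \<phi>'])
  have "(\<lambda>z. \<phi> (\<pi> z) 0) \<in> borel_measurable P" by (rule measurable_compose[OF \<phi>\<pi> measurable_product_coordinates])
  then show meas: "(\<lambda>z. \<phi> (\<pi> z) 0) \<in> borel_measurable borel" unfolding measurable_cong_sets[OF sP refl] .
  have "AE z in P. \<phi> (T g (\<pi> z)) = shift g (\<phi> (\<pi> z))" for g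
    by (rule AE_distrD[OF \<pi>(1), where P="\<lambda>x. \<phi> (T g x) = shift g (\<phi> x)"]) (unfold \<pi>(2), rule \<phi>(3))
  note eq = this
  have "AE z in P. \<phi> (\<pi> (shift g z)) 0 = \<phi> (\<pi> z) g" for g
    using eq[of g] equivariant[of g]
  proof eventually_elim
    case (elim z)
    have "shift g (\<phi> (\<pi> z)) 0 = \<phi> (\<pi> z) g" by (simp add: shift_def)
    then show ?case unfolding elim(2) elim(1) .
  qed
  then have "AE z in P. \<forall>g. \<phi> (\<pi> (shift g z)) 0 = \<phi> (\<pi> z) g" by (simp add: AE_all_countable)
  then show ae: "AE z in P. stationary_code (\<lambda>z. \<phi> (\<pi> z) 0) z = \<phi> (\<pi> z)"
    by eventually_elim (simp add: stationary_code_def)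
  have "distr P borel (stationary_code (\<lambda>z. \<phi> (\<pi> z) 0)) = distr P borel (\<lambda>z. \<phi> (\<pi> z))"
  proof (rule distr_cong_AE[OF refl _ ae])
    show "stationary_code (\<lambda>z. \<phi> (\<pi> z) 0) \<in> borel_measurable P"
      using stationary_code_measurable[OF meas] unfolding measurable_cong_sets[OF sP refl] .
  qed (simp_all add: \<phi>\<pi>)
  also have "\<dots> = distr P Q (\<phi> \<circ> \<pi>)" by (rule distr_cong) (simp_all add: sQ)
  also have "\<dots> = Q" using distr_distr[OF \<phi>(1) \<pi>(1)] by (simp add: \<pi>(2) \<phi>(2))
  finally show "distr P borel (stationary_code (\<lambda>z. \<phi> (\<pi> z) 0)) = Q" .
qed

text \<open>The isomorphisms are inverted and composed with the projections of the joining. Both components of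
the point of the joining are recovered from the two coded configurations, and thus the point of the
process of \<open>\<lambda>\<close>.\<close>

lemma joining_generates:
  fixes P\<^sub>M :: "('g::{group_add, countable} \<Rightarrow> 'a::polish_space) measure"
    and P\<^sub>N :: "('g \<Rightarrow> 'b::polish_space) measure" and P\<^sub>L :: "('g \<Rightarrow> 'c::polish_space) measure"
  assumes sys: "g_system M T" "g_system N S" and join: "joining M T N S L"
    and PM: "process_of_system P\<^sub>M M T" and PN: "process_of_system P\<^sub>N N S"
    and PL: "process_of_system P\<^sub>L L (product_action T S)"
  obtains \<alpha> \<beta> \<psi> where "\<alpha> \<in> borel_measurable borel" "\<beta> \<in> borel_measurable borel" "\<psi> \<in> borel_measurable borel"
    "distr P\<^sub>L borel (stationary_code \<alpha>) = P\<^sub>M" "distr P\<^sub>L borel (stationary_code \<beta>) = P\<^sub>N"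
    "AE z in P\<^sub>L. \<psi> (\<lambda>g. (stationary_code \<alpha> z g, stationary_code \<beta> z g)) = z 0"
proof -
  have proc: "metric_process P\<^sub>M" "metric_process P\<^sub>N" "metric_process P\<^sub>L"
    using PM PN PL by (auto simp: process_of_system_def)
  obtain \<phi>L \<psi>L where L: "\<phi>L \<in> measurable L P\<^sub>L" "\<psi>L \<in> measurable P\<^sub>L L" "distr P\<^sub>L L \<psi>L = L"
    "AE x in L. \<psi>L (\<phi>L x) = x" "AE y in P\<^sub>L. \<phi>L (\<psi>L y) = y" "\<forall>g. AE x in L. \<phi>L (product_action T S g x) = shift g (\<phi>L x)"
    using PL unfolding process_of_system_def system_isomorphic_def by (elim conjE exE) (rule that, assumption+)
  obtain \<phi>M \<psi>M where M: "\<phi>M \<in> measurable M P\<^sub>M" "\<psi>M \<in> measurable P\<^sub>M M" "distr M P\<^sub>M \<phi>M = P\<^sub>M"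
    "AE x in M. \<psi>M (\<phi>M x) = x" "\<forall>g. AE x in M. \<phi>M (T g x) = shift g (\<phi>M x)"
    using PM unfolding process_of_system_def system_isomorphic_def by (elim conjE exE) (rule that, assumption+)
  obtain \<phi>N \<psi>N where N: "\<phi>N \<in> measurable N P\<^sub>N" "\<psi>N \<in> measurable P\<^sub>N N" "distr N P\<^sub>N \<phi>N = P\<^sub>N"
    "AE x in N. \<psi>N (\<phi>N x) = x" "\<forall>g. AE x in N. \<phi>N (S g x) = shift g (\<phi>N x)"
    using PN unfolding process_of_system_def system_isomorphic_def by (elim conjE exE) (rule that, assumption+)
  have sL: "sets L = sets (M \<Otimes>\<^sub>M N)" and push: "distr L M fst = M" "distr L N snd = N"
    and inv: "\<And>g. distr L L (product_action T S g) = L"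
    using join by (auto simp: joining_def)
  have proj: "fst \<in> measurable L M" "snd \<in> measurable L N"
    by (simp_all add: measurable_cong_sets[OF sL refl])
  have R: "product_action T S g \<in> measurable L L" for g
  proof -
    have [measurable]: "T g \<in> measurable M M" "S g \<in> measurable N N" using sys by (auto simp: g_system_def)
    have "(\<lambda>z. (T g (fst z), S g (snd z))) \<in> measurable (M \<Otimes>\<^sub>M N) (M \<Otimes>\<^sub>M N)" by measurable
    then show ?thesis
      by (simp add: measurable_cong_sets[OF sL sL] product_action_def map_prod_def case_prod_beta')
  qed
  have eqv: "AE z in P\<^sub>L. \<psi>L (shift g z) = product_action T S g (\<psi>L z)" for g
    by (rule inverse_equivariant[OF L(1,2,3) R inv L(4,5) L(6)[rule_format]])
  define \<pi>M where "\<pi>M z = fst (\<psi>L z)" for z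
  define \<pi>N where "\<pi>N z = snd (\<psi>L z)" for z
  have \<pi>M: "\<pi>M \<in> measurable P\<^sub>L M" "distr P\<^sub>L M \<pi>M = M" "AE z in P\<^sub>L. \<pi>M (shift g z) = T g (\<pi>M z)" for g
  proof -
    show "\<pi>M \<in> measurable P\<^sub>L M" unfolding \<pi>M_def by (rule measurable_compose[OF L(2) proj(1)])
    show "distr P\<^sub>L M \<pi>M = M" using distr_distr[OF proj(1) L(2)] by (simp add: L(3) push o_def \<pi>M_def[abs_def])
    show "AE z in P\<^sub>L. \<pi>M (shift g z) = T g (\<pi>M z)"
      using eqv[of g] by eventually_elim (simp add: \<pi>M_def product_action_def)
  qed
  have \<pi>N: "\<pi>N \<in> measurable P\<^sub>L N" "distr P\<^sub>L N \<pi>N = N" "AE z in P\<^sub>L. \<pi>N (shift g z) = S g (\<pi>N z)" for g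
  proof -
    show "\<pi>N \<in> measurable P\<^sub>L N" unfolding \<pi>N_def by (rule measurable_compose[OF L(2) proj(2)])
    show "distr P\<^sub>L N \<pi>N = N" using distr_distr[OF proj(2) L(2)] by (simp add: L(3) push o_def \<pi>N_def[abs_def])
    show "AE z in P\<^sub>L. \<pi>N (shift g z) = S g (\<pi>N z)"
      using eqv[of g] by eventually_elim (simp add: \<pi>N_def product_action_def)
  qed
  note facM = factor_of_joining[OF proc(3,1) \<pi>M M(1,3) M(5)[rule_format]]
  note facN = factor_of_joining[OF proc(3,2) \<pi>N N(1,3) N(5)[rule_format]]
  define \<psi> where "\<psi> y = \<phi>L (\<psi>M (\<lambda>g. fst (y g)), \<psi>N (\<lambda>g. snd (y g))) 0" for y
  have \<psi>: "\<psi> \<in> borel_measurable borel"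
  proof -
    have sP: "sets P\<^sub>M = sets borel" "sets P\<^sub>N = sets borel" "sets P\<^sub>L = sets borel" using proc by (auto simp: metric_process_def)
    have unzip: "(\<lambda>(y :: 'g \<Rightarrow> 'a \<times> 'b) g. fst (y g)) \<in> borel_measurable borel" "(\<lambda>(y :: 'g \<Rightarrow> 'a \<times> 'b) g. snd (y g)) \<in> borel_measurable borel"
      by (intro letter_process_measurable borel_measurable_continuous_onI continuous_intros)+
    have \<psi>MN: "\<psi>M \<in> measurable borel M" "\<psi>N \<in> measurable borel N"
      using M(2) N(2) by (simp_all add: measurable_cong_sets[OF sP(1) refl] measurable_cong_sets[OF sP(2) refl])
    have "(\<lambda>y :: 'g \<Rightarrow> 'a \<times> 'b. (\<psi>M (\<lambda>g. fst (y g)), \<psi>N (\<lambda>g. snd (y g)))) \<in> measurable borel (M \<Otimes>\<^sub>M N)"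
      by (intro measurable_Pair measurable_compose[OF unzip(1) \<psi>MN(1)] measurable_compose[OF unzip(2) \<psi>MN(2)])
    moreover have "(\<lambda>x. \<phi>L x 0) \<in> borel_measurable (M \<Otimes>\<^sub>M N)"
      using measurable_compose[OF L(1)[unfolded measurable_cong_sets[OF sL sP(3)]] measurable_product_coordinates] .
    ultimately show ?thesis unfolding \<psi>_def by (rule measurable_compose)
  qed
  have "AE z in P\<^sub>L. \<psi>M (\<phi>M (\<pi>M z)) = \<pi>M z"
    by (rule AE_distrD[OF \<pi>M(1), where P="\<lambda>x. \<psi>M (\<phi>M x) = x"]) (unfold \<pi>M(2), rule M(4))
  moreover have "AE z in P\<^sub>L. \<psi>N (\<phi>N (\<pi>N z)) = \<pi>N z"
    by (rule AE_distrD[OF \<pi>N(1), where P="\<lambda>x. \<psi>N (\<phi>N x) = x"]) (unfold \<pi>N(2), rule N(4))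
  ultimately have "AE z in P\<^sub>L. \<psi> (\<lambda>g. (stationary_code (\<lambda>z. \<phi>M (\<pi>M z) 0) z g, stationary_code (\<lambda>z. \<phi>N (\<pi>N z) 0) z g)) = z 0"
    using facM(2) facN(2) L(5)
  proof eventually_elim
    case (elim z)
    then show ?case by (simp add: \<psi>_def) (simp add: \<pi>M_def \<pi>N_def)
  qed
  then show ?thesis by (rule that[OF facM(1) facN(1) \<psi> facM(3) facN(3)])
qed

lemma sofic_approximation_subsequence:
  assumes sofic: "sofic_approximation V \<sigma>" and n: "strict_mono n"
  shows "sofic_approximation (V \<circ> n) (\<sigma> \<circ> n)"
proof -
  have sub: "(\<lambda>i. proportion (V (n i)) (p (n i))) \<longlonglongrightarrow> 1" if "(\<lambda>i. proportion (V i) (p i)) \<longlonglongrightarrow> 1" for p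
    using LIMSEQ_subseq_LIMSEQ[OF that n] by (simp add: o_def)
  have "(\<lambda>i. proportion (V (n i)) (\<lambda>v. \<sigma> (n i) g (\<sigma> (n i) h v) = \<sigma> (n i) (g + h) v)) \<longlonglongrightarrow> 1" for g h
    using sofic by (intro sub[of "\<lambda>i v. \<sigma> i g (\<sigma> i h v) = \<sigma> i (g + h) v"]) (simp add: sofic_approximation_def)
  moreover have "(\<lambda>i. proportion (V (n i)) (\<lambda>v. \<sigma> (n i) g v \<noteq> v)) \<longlonglongrightarrow> 1" if "g \<noteq> 0" for g
    using sofic that by (intro sub[of "\<lambda>i v. \<sigma> i g v \<noteq> v"]) (simp add: sofic_approximation_def)
  ultimately show ?thesis using sofic by (simp add: sofic_approximation_def)
qed

text \<open>The nonnegative witnesses rule out that a summand on the right-hand side is \<open>-\<infinity>\<close>.\<close>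

lemma Sup_le_entropy_plus:
  assumes "\<And>x. x \<in> X \<Longrightarrow> \<exists>a\<in>A. \<exists>b\<in>B. 0 \<le> a \<and> 0 \<le> b \<and> x \<le> a + b"
  shows "Sup X \<le> entropy_plus (Sup A) (Sup B)"
proof (rule Sup_least)
  fix x assume "x \<in> X"
  then obtain a b where ab: "a \<in> A" "b \<in> B" "0 \<le> a" "0 \<le> b" "x \<le> a + b" using assms by blast
  have le: "a \<le> Sup A" "b \<le> Sup B" using ab by (auto intro: Sup_upper)
  then have "Sup A \<noteq> -\<infinity>" "Sup B \<noteq> -\<infinity>" using ab by auto
  moreover have "x \<le> Sup A + Sup B" using ab(5) add_mono[OF le] by (rule order_trans)
  ultimately show "x \<le> entropy_plus (Sup A) (Sup B)" by (simp add: entropy_plus_def)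
qed

theorem proposition7p1:
  fixes V :: "nat \<Rightarrow> 'v set"
    and \<sigma> :: "nat \<Rightarrow> 'g::{group_add, countable} \<Rightarrow> 'v \<Rightarrow> 'v"
    and M :: "'x measure" and T :: "'g \<Rightarrow> 'x \<Rightarrow> 'x"
    and N :: "'y measure" and S :: "'g \<Rightarrow> 'y \<Rightarrow> 'y"
    and L :: "('x \<times> 'y) measure"
    and P\<^sub>M :: "('g \<Rightarrow> 'a::polish_space) measure"
    and P\<^sub>N :: "('g \<Rightarrow> 'b::polish_space) measure"
    and P\<^sub>L :: "('g \<Rightarrow> 'c::polish_space) measure"
  assumes "sofic_approximation V \<sigma>"
    and "g_system M T" and "g_system N S" and "joining M T N S L"
    and "process_of_system P\<^sub>M M T"
    and "process_of_system P\<^sub>N N S"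
    and "process_of_system P\<^sub>L L (product_action T S)"
  shows "quenched_entropy V \<sigma> P\<^sub>L
           \<le> entropy_plus (quenched_entropy V \<sigma> P\<^sub>M) (quenched_entropy V \<sigma> P\<^sub>N) \<and>
         doubly_quenched_entropy V \<sigma> P\<^sub>L
           \<le> entropy_plus (doubly_quenched_entropy V \<sigma> P\<^sub>M) (doubly_quenched_entropy V \<sigma> P\<^sub>N)"
proof -
  have proc: "metric_process P\<^sub>M" "metric_process P\<^sub>N" "metric_process P\<^sub>L"
    using assms by (auto simp: process_of_system_def)
  have compact: "compact (UNIV :: 'a set)" "compact (UNIV :: 'b set)" and PL: "P\<^sub>L \<in> prob_measures"
    using proc by (auto simp: metric_process_def prob_measures_def)
  obtain \<alpha> \<beta> \<psi> where codes: "\<alpha> \<in> borel_measurable borel" "\<beta> \<in> borel_measurable borel" "\<psi> \<in> borel_measurable borel"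
    and push: "distr P\<^sub>L borel (stationary_code \<alpha>) = P\<^sub>M" "distr P\<^sub>L borel (stationary_code \<beta>) = P\<^sub>N"
    and inv: "AE z in P\<^sub>L. \<psi> (\<lambda>g. (stationary_code \<alpha> z g, stationary_code \<beta> z g)) = z 0"
    by (rule joining_generates[OF assms(2-7)])
  have models_iff: "model_sequence (V \<circ> n) (\<sigma> \<circ> n) m \<longleftrightarrow> (\<forall>i. m i \<in> model_measures (V (n i)))"
    for n and m :: "nat \<Rightarrow> ('v \<Rightarrow> 'e::topological_space) measure"
    using assms(1) by (auto simp: model_sequence_def sofic_approximation_def)
  have step: "\<exists>m1 m2. (\<forall>i. m1 i \<in> model_measures (V (n i))) \<and> (\<forall>i. m2 i \<in> model_measures (V (n i))) \<and>
      quenched_converges (V \<circ> n) (\<sigma> \<circ> n) m1 P\<^sub>M \<and> quenched_converges (V \<circ> n) (\<sigma> \<circ> n) m2 P\<^sub>N \<and>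
      (doubly_quenched_converges (V \<circ> n) (\<sigma> \<circ> n) m P\<^sub>L \<longrightarrow>
        doubly_quenched_converges (V \<circ> n) (\<sigma> \<circ> n) m1 P\<^sub>M \<and> doubly_quenched_converges (V \<circ> n) (\<sigma> \<circ> n) m2 P\<^sub>N) \<and>
      0 \<le> cov_rate (V \<circ> n) m1 \<and> 0 \<le> cov_rate (V \<circ> n) m2 \<and>
      cov_rate (V \<circ> n) m \<le> cov_rate (V \<circ> n) m1 + cov_rate (V \<circ> n) m2"
    if n: "strict_mono n" and m: "\<forall>i. m i \<in> model_measures (V (n i))"
      and q: "quenched_converges (V \<circ> n) (\<sigma> \<circ> n) m P\<^sub>L" for n m
  proof -
    have models: "model_sequence (V \<circ> n) (\<sigma> \<circ> n) m" using m by (simp add: models_iff)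
    show ?thesis
    proof (rule joint_models[OF models sofic_approximation_subsequence[OF assms(1) n] proc(3) compact codes inv q, unfolded push])
      fix m1 m2
      assume *: "model_sequence (V \<circ> n) (\<sigma> \<circ> n) m1" "model_sequence (V \<circ> n) (\<sigma> \<circ> n) m2"
        "quenched_converges (V \<circ> n) (\<sigma> \<circ> n) m1 P\<^sub>M" "quenched_converges (V \<circ> n) (\<sigma> \<circ> n) m2 P\<^sub>N"
        "doubly_quenched_converges (V \<circ> n) (\<sigma> \<circ> n) m P\<^sub>L \<Longrightarrow> doubly_quenched_converges (V \<circ> n) (\<sigma> \<circ> n) m1 P\<^sub>M"
        "doubly_quenched_converges (V \<circ> n) (\<sigma> \<circ> n) m P\<^sub>L \<Longrightarrow> doubly_quenched_converges (V \<circ> n) (\<sigma> \<circ> n) m2 P\<^sub>N"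
        "cov_rate (V \<circ> n) m \<le> cov_rate (V \<circ> n) m1 + cov_rate (V \<circ> n) m2"
      then show ?thesis
        using cov_rate_nonneg[OF *(1) compact(1)] cov_rate_nonneg[OF *(2) compact(2)] unfolding models_iff by blast
    qed
  qed
  have dq: "quenched_converges (V \<circ> n) (\<sigma> \<circ> n) m P\<^sub>L"
    if "\<forall>i. m i \<in> model_measures (V (n i))" "doubly_quenched_converges (V \<circ> n) (\<sigma> \<circ> n) m P\<^sub>L" for n m
    by (rule doubly_quenched_imp_quenched[OF _ PL that(2)]) (simp add: models_iff that(1))
  have "quenched_entropy V \<sigma> P\<^sub>L \<le> entropy_plus (quenched_entropy V \<sigma> P\<^sub>M) (quenched_entropy V \<sigma> P\<^sub>N)"
    unfolding quenched_entropy_def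
    by (rule Sup_le_entropy_plus, elim CollectE exE conjE, frule (2) step, blast)
  moreover have "doubly_quenched_entropy V \<sigma> P\<^sub>L
      \<le> entropy_plus (doubly_quenched_entropy V \<sigma> P\<^sub>M) (doubly_quenched_entropy V \<sigma> P\<^sub>N)"
    unfolding doubly_quenched_entropy_def
    by (rule Sup_le_entropy_plus, elim CollectE exE conjE, frule (1) dq, frule (2) step, blast)
  ultimately show ?thesis ..
qed

end
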